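(* Let $E/K$ be a finite Galois extension of fields with Galois group $G$. Suppose $G=HS\cong H\rtimes S$ for subgroups $H,S$ of $G$ with $H$ normal in $G$ and $H\cap S$ trivial, and let $S'$ be a subgroup of $S$. Let $L:=E^S$ and $L':=E^{S'}$ be the fixed fields, so that $K\subseteq L\subseteq L'\subseteq E$, with $L/K$ and $L'/L$ not necessarily Galois. Suppose there is a Hopf-Galois structure of type $N$ on $L/K$ and a Hopf-Galois structure of type $M$ on $L'/L$. Then there is a Hopf-Galois structure of type $N\times M$ on $L'/K$.
   Context: Let $F'/F$ be a finite separable extension of fields with Galois closure $\widetilde E$, let $\Gamma=\mathrm{Gal}(\widetilde E/F)$, $\Delta=\mathrm{Gal}(\widetilde E/F')$ and $X=\Gamma/\Delta$ (left cosets). By the theorem of Greither and Pareigis, Hopf-Galois structures on $F'/F$ correspond bijectively to regular subgroups $P$ of $\mathrm{Perm}(X)$ that are normalised by the image of $\Gamma$ acting on $X$ by left translation; $P$ corresponds to the structure given by the Hopf algebra $\widetilde E[P]^{\Gamma}$. The Hopf-Galois structure corresponding to $P$ is said to be of type $N$ if $P\cong N$ as groups. *)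

theory Defs
  imports "HOL-Algebra.Algebra" "HOL-Algebra.Left_Coset"
begin

section \<open>Galois extensions\<close>

text \<open>An intermediate field \<open>M\<close> of an ambient field \<open>E\<close> is a set with \<^term>\<open>subfield M E\<close>;
  as a field in its own right it is the ring \<^term>\<open>E\<lparr>carrier := M\<rparr>\<close>.  Automorphisms are
  extensional functions, so that \<open>Gal(E/F)\<close> is a subgroup of \<^term>\<open>BijGroup (carrier E)\<close>.\<close>

definition gal :: "('e, 'm) ring_scheme \<Rightarrow> 'e set \<Rightarrow> ('e \<Rightarrow> 'e) monoid" where
  "gal E F = (BijGroup (carrier E))
     \<lparr>carrier := {\<sigma> \<in> Bij (carrier E) \<inter> ring_iso E E. \<forall>x\<in>F. \<sigma> x = x}\<rparr>"

definition fixed_field :: "('e, 'm) ring_scheme \<Rightarrow> ('e \<Rightarrow> 'e) set \<Rightarrow> 'e set" where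
  "fixed_field E S = {x \<in> carrier E. \<forall>\<sigma>\<in>S. \<sigma> x = x}"

definition finite_galois :: "('e, 'm) ring_scheme \<Rightarrow> 'e set \<Rightarrow> bool" where
  "finite_galois E F \<longleftrightarrow> field E \<and> subfield F E \<and> ring.finite_dimension E F (carrier E) \<and>
     fixed_field E (carrier (gal E F)) = F"

definition galois_closure :: "('e, 'm) ring_scheme \<Rightarrow> 'e set \<Rightarrow> 'e set \<Rightarrow> 'e set \<Rightarrow> bool" where
  "galois_closure E F F' M \<longleftrightarrow>
     subfield M E \<and> F' \<subseteq> M \<and> finite_galois (E\<lparr>carrier := M\<rparr>) F \<and>
     (\<forall>M'. subfield M' E \<and> F' \<subseteq> M' \<and> M' \<subseteq> M \<and> finite_galois (E\<lparr>carrier := M'\<rparr>) F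
        \<longrightarrow> M' = M)"


section \<open>Linear maps and tensors\<close>

definition linear_map ::
  "('f, 'k) ring_scheme \<Rightarrow> ('f, 'v, 'm) module_scheme \<Rightarrow> ('f, 'w, 'n) module_scheme \<Rightarrow>
   ('v \<Rightarrow> 'w) \<Rightarrow> bool" where
  "linear_map R V W f \<longleftrightarrow> f \<in> carrier V \<rightarrow> carrier W \<and>
     (\<forall>x\<in>carrier V. \<forall>y\<in>carrier V. f (x \<oplus>\<^bsub>V\<^esub> y) = f x \<oplus>\<^bsub>W\<^esub> f y) \<and>
     (\<forall>r\<in>carrier R. \<forall>x\<in>carrier V. f (r \<odot>\<^bsub>V\<^esub> x) = r \<odot>\<^bsub>W\<^esub> f x)"

text \<open>The set \<open>F'\<close> as a module, with scalar multiplication the multiplication of \<open>E\<close>.\<close>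

definition ext_module :: "('e, 'm) ring_scheme \<Rightarrow> 'e set \<Rightarrow> ('e, 'e) module" where
  "ext_module E F' = \<lparr>carrier = F', monoid.mult = (\<otimes>\<^bsub>E\<^esub>), one = \<one>\<^bsub>E\<^esub>, ring.zero = \<zero>\<^bsub>E\<^esub>,
     ring.add = (\<oplus>\<^bsub>E\<^esub>), smult = (\<otimes>\<^bsub>E\<^esub>)\<rparr>"

definition bilinear_form ::
  "('f, 'k) ring_scheme \<Rightarrow> ('f, 'v, 'm) module_scheme \<Rightarrow> ('f, 'w, 'n) module_scheme \<Rightarrow>
   ('v \<Rightarrow> 'w \<Rightarrow> 'f) \<Rightarrow> bool" where
  "bilinear_form R V W \<beta> \<longleftrightarrow>
     (\<forall>w\<in>carrier W. linear_map R V (ext_module R (carrier R)) (\<lambda>v. \<beta> v w)) \<and>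
     (\<forall>v\<in>carrier V. linear_map R W (ext_module R (carrier R)) (\<beta> v))"

definition trilinear_form ::
  "('f, 'k) ring_scheme \<Rightarrow> ('f, 'v, 'm) module_scheme \<Rightarrow> ('v \<Rightarrow> 'v \<Rightarrow> 'v \<Rightarrow> 'f) \<Rightarrow> bool" where
  "trilinear_form R V \<tau> \<longleftrightarrow>
     (\<forall>v\<in>carrier V. bilinear_form R V V (\<tau> v)) \<and>
     (\<forall>v\<in>carrier V. \<forall>w\<in>carrier V. linear_map R V (ext_module R (carrier R)) (\<lambda>u. \<tau> u v w))"

definition lsum :: "('a, 'm) ring_scheme \<Rightarrow> ('x \<Rightarrow> 'a) \<Rightarrow> 'x list \<Rightarrow> 'a" where
  "lsum R f xs = foldr (\<lambda>x s. f x \<oplus>\<^bsub>R\<^esub> s) xs \<zero>\<^bsub>R\<^esub>"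

text \<open>An element of \<open>V \<otimes>\<^sub>R W\<close> is given by a list of pairs, \<open>[(v\<^sub>1,w\<^sub>1), \<dots>]\<close> standing for
  \<open>\<Sum> v\<^sub>i \<otimes> w\<^sub>i\<close>.  \<open>R\<close> is always a field, so two lists denote the same tensor iff every
  bilinear form on \<open>V \<times> W\<close> takes the same value on them.\<close>

definition tensor_eq ::
  "('f, 'k) ring_scheme \<Rightarrow> ('f, 'v, 'm) module_scheme \<Rightarrow> ('f, 'w, 'n) module_scheme \<Rightarrow>
   ('v \<times> 'w) list \<Rightarrow> ('v \<times> 'w) list \<Rightarrow> bool" where
  "tensor_eq R V W xs ys \<longleftrightarrow>
     (\<forall>\<beta>. bilinear_form R V W \<beta> \<longrightarrow> lsum R (\<lambda>(v, w). \<beta> v w) xs = lsum R (\<lambda>(v, w). \<beta> v w) ys)"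


section \<open>Hopf algebras\<close>

record ('f, 'a) hopf = "('f, 'a) module" +
  comult :: "'a \<Rightarrow> ('a \<times> 'a) list"
  counit :: "'a \<Rightarrow> 'f"
  antipode :: "'a \<Rightarrow> 'a"

text \<open>The comultiplication is a function into lists of pairs, hence only meaningful up to
  \<^const>\<open>tensor_eq\<close>; accordingly the axioms on it are equations of tensors.\<close>

locale hopf_algebra =
  fixes R :: "('f, 'k) ring_scheme" and A :: "('f, 'a, 'm) hopf_scheme"
  assumes field: "field R"
    and ring: "ring A"
    and module: "module R A"
    and smult_mult_left: "\<lbrakk>r \<in> carrier R; a \<in> carrier A; b \<in> carrier A\<rbrakk>
          \<Longrightarrow> (r \<odot>\<^bsub>A\<^esub> a) \<otimes>\<^bsub>A\<^esub> b = r \<odot>\<^bsub>A\<^esub> (a \<otimes>\<^bsub>A\<^esub> b)"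
    and smult_mult_right: "\<lbrakk>r \<in> carrier R; a \<in> carrier A; b \<in> carrier A\<rbrakk>
          \<Longrightarrow> a \<otimes>\<^bsub>A\<^esub> (r \<odot>\<^bsub>A\<^esub> b) = r \<odot>\<^bsub>A\<^esub> (a \<otimes>\<^bsub>A\<^esub> b)"
    and counit_linear: "linear_map R A (ext_module R (carrier R)) (counit A)"
    and counit_mult: "\<lbrakk>a \<in> carrier A; b \<in> carrier A\<rbrakk>
          \<Longrightarrow> counit A (a \<otimes>\<^bsub>A\<^esub> b) = counit A a \<otimes>\<^bsub>R\<^esub> counit A b"
    and counit_one: "counit A \<one>\<^bsub>A\<^esub> = \<one>\<^bsub>R\<^esub>"
    and comult_closed: "a \<in> carrier A \<Longrightarrow> set (comult A a) \<subseteq> carrier A \<times> carrier A"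
    and comult_add: "\<lbrakk>a \<in> carrier A; b \<in> carrier A\<rbrakk>
          \<Longrightarrow> tensor_eq R A A (comult A (a \<oplus>\<^bsub>A\<^esub> b)) (comult A a @ comult A b)"
    and comult_smult: "\<lbrakk>r \<in> carrier R; a \<in> carrier A\<rbrakk>
          \<Longrightarrow> tensor_eq R A A (comult A (r \<odot>\<^bsub>A\<^esub> a)) [(r \<odot>\<^bsub>A\<^esub> u, v). (u, v) \<leftarrow> comult A a]"
    and comult_mult: "\<lbrakk>a \<in> carrier A; b \<in> carrier A\<rbrakk>
          \<Longrightarrow> tensor_eq R A A (comult A (a \<otimes>\<^bsub>A\<^esub> b))
                [(u \<otimes>\<^bsub>A\<^esub> u', v \<otimes>\<^bsub>A\<^esub> v'). (u, v) \<leftarrow> comult A a, (u', v') \<leftarrow> comult A b]"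
    and comult_one: "tensor_eq R A A (comult A \<one>\<^bsub>A\<^esub>) [(\<one>\<^bsub>A\<^esub>, \<one>\<^bsub>A\<^esub>)]"
    and coassoc: "\<lbrakk>a \<in> carrier A; trilinear_form R A \<tau>\<rbrakk>
          \<Longrightarrow> lsum R (\<lambda>(u, v). lsum R (\<lambda>(u1, u2). \<tau> u1 u2 v) (comult A u)) (comult A a)
            = lsum R (\<lambda>(u, v). lsum R (\<lambda>(v1, v2). \<tau> u v1 v2) (comult A v)) (comult A a)"
    and counit_left: "a \<in> carrier A \<Longrightarrow> lsum A (\<lambda>(u, v). counit A u \<odot>\<^bsub>A\<^esub> v) (comult A a) = a"
    and counit_right: "a \<in> carrier A \<Longrightarrow> lsum A (\<lambda>(u, v). counit A v \<odot>\<^bsub>A\<^esub> u) (comult A a) = a"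
    and antipode_linear: "linear_map R A A (antipode A)"
    and antipode_left: "a \<in> carrier A
          \<Longrightarrow> lsum A (\<lambda>(u, v). antipode A u \<otimes>\<^bsub>A\<^esub> v) (comult A a) = counit A a \<odot>\<^bsub>A\<^esub> \<one>\<^bsub>A\<^esub>"
    and antipode_right: "a \<in> carrier A
          \<Longrightarrow> lsum A (\<lambda>(u, v). u \<otimes>\<^bsub>A\<^esub> antipode A v) (comult A a) = counit A a \<odot>\<^bsub>A\<^esub> \<one>\<^bsub>A\<^esub>"

definition cocommutative :: "('f, 'k) ring_scheme \<Rightarrow> ('f, 'a, 'm) hopf_scheme \<Rightarrow> bool" where
  "cocommutative R A \<longleftrightarrow>
     (\<forall>a\<in>carrier A. tensor_eq R A A [(v, u). (u, v) \<leftarrow> comult A a] (comult A a))"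

definition finite_dimensional :: "('f, 'k) ring_scheme \<Rightarrow> ('f, 'a, 'm) module_scheme \<Rightarrow> bool" where
  "finite_dimensional R V \<longleftrightarrow> (\<exists>B. finite B \<and> B \<subseteq> carrier V \<and>
     (\<forall>v\<in>carrier V. \<exists>c\<in>B \<rightarrow> carrier R. v = (\<Oplus>\<^bsub>V\<^esub>b\<in>B. c b \<odot>\<^bsub>V\<^esub> b)))"

definition hopf_iso ::
  "('f, 'k) ring_scheme \<Rightarrow> ('f, 'a, 'm) hopf_scheme \<Rightarrow> ('f, 'b, 'n) hopf_scheme \<Rightarrow>
   ('a \<Rightarrow> 'b) \<Rightarrow> bool" where
  "hopf_iso R A B \<phi> \<longleftrightarrow> \<phi> \<in> ring_iso A B \<and> linear_map R A B \<phi> \<and>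
     (\<forall>a\<in>carrier A.
        tensor_eq R B B [(\<phi> u, \<phi> v). (u, v) \<leftarrow> comult A a] (comult B (\<phi> a)) \<and>
        counit B (\<phi> a) = counit A a \<and>
        antipode B (\<phi> a) = \<phi> (antipode A a))"


section \<open>Hopf-Galois structures\<close>

text \<open>An \<open>F\<close>-Hopf algebra \<open>A\<close> acting on \<open>F'\<close> so that \<open>F'\<close> is an \<open>A\<close>-module algebra and
  \<open>F' \<otimes>\<^sub>F A \<rightarrow> End\<^sub>F(F')\<close>, \<open>x \<otimes> h \<mapsto> (y \<mapsto> x (h \<cdot> y))\<close>, is bijective.\<close>

locale hopf_galois_structure =
  fixes E :: "('e, 'm) ring_scheme" and F F' :: "'e set"
    and A :: "('e, 'a, 'n) hopf_scheme" and act :: "'a \<Rightarrow> 'e \<Rightarrow> 'e"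
  assumes field: "field E"
    and subfields: "subfield F E" "subfield F' E" "F \<subseteq> F'"
    and hopf: "hopf_algebra (E\<lparr>carrier := F\<rparr>) A"
    and findim: "finite_dimensional (E\<lparr>carrier := F\<rparr>) A"
    and cocomm: "cocommutative (E\<lparr>carrier := F\<rparr>) A"
    and act_linear: "h \<in> carrier A
          \<Longrightarrow> linear_map (E\<lparr>carrier := F\<rparr>) (ext_module E F') (ext_module E F') (act h)"
    and act_linear_left: "x \<in> F'
          \<Longrightarrow> linear_map (E\<lparr>carrier := F\<rparr>) A (ext_module E F') (\<lambda>h. act h x)"
    and act_one: "x \<in> F' \<Longrightarrow> act \<one>\<^bsub>A\<^esub> x = x"
    and act_act: "\<lbrakk>h \<in> carrier A; k \<in> carrier A; x \<in> F'\<rbrakk>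
          \<Longrightarrow> act (h \<otimes>\<^bsub>A\<^esub> k) x = act h (act k x)"
    and act_unit: "h \<in> carrier A \<Longrightarrow> act h \<one>\<^bsub>E\<^esub> = counit A h"
    and act_mult: "\<lbrakk>h \<in> carrier A; x \<in> F'; y \<in> F'\<rbrakk>
          \<Longrightarrow> act h (x \<otimes>\<^bsub>E\<^esub> y) = lsum E (\<lambda>(u, v). act u x \<otimes>\<^bsub>E\<^esub> act v y) (comult A h)"
    and surjective: "linear_map (E\<lparr>carrier := F\<rparr>) (ext_module E F') (ext_module E F') f
          \<Longrightarrow> \<exists>xs. set xs \<subseteq> F' \<times> carrier A \<and>
                (\<forall>y\<in>F'. f y = lsum E (\<lambda>(x, h). x \<otimes>\<^bsub>E\<^esub> act h y) xs)"
    and injective: "\<lbrakk>set xs \<subseteq> F' \<times> carrier A;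
          \<forall>y\<in>F'. lsum E (\<lambda>(x, h). x \<otimes>\<^bsub>E\<^esub> act h y) xs = \<zero>\<^bsub>E\<^esub>\<rbrakk>
          \<Longrightarrow> tensor_eq (E\<lparr>carrier := F\<rparr>) (ext_module E F') A xs []"


section \<open>The Greither-Pareigis correspondence\<close>

text \<open>Throughout this section \<open>T\<close> is a Galois closure of \<open>F'/F\<close>, as a field in its own right,
  \<open>\<Gamma> = Gal(T/F)\<close>, \<open>\<Delta> = Gal(T/F')\<close> and \<open>X = \<Gamma>/\<Delta>\<close>.\<close>

definition gal_cosets ::
  "('e, 'm) ring_scheme \<Rightarrow> 'e set \<Rightarrow> 'e set \<Rightarrow> ('e \<Rightarrow> 'e) set set" where
  "gal_cosets T F F' = lcosets\<^bsub>gal T F\<^esub> (carrier (gal T F'))"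

definition left_translation ::
  "('e, 'm) ring_scheme \<Rightarrow> 'e set \<Rightarrow> 'e set \<Rightarrow> ('e \<Rightarrow> 'e) \<Rightarrow> ('e \<Rightarrow> 'e) set \<Rightarrow> ('e \<Rightarrow> 'e) set" where
  "left_translation T F F' \<gamma> = (\<lambda>c\<in>gal_cosets T F F'. \<gamma> <#\<^bsub>gal T F\<^esub> c)"

type_synonym 'e coset_perm = "('e \<Rightarrow> 'e) set \<Rightarrow> ('e \<Rightarrow> 'e) set"

definition conj_translation ::
  "('e, 'm) ring_scheme \<Rightarrow> 'e set \<Rightarrow> 'e set \<Rightarrow> ('e \<Rightarrow> 'e) \<Rightarrow> 'e coset_perm \<Rightarrow> 'e coset_perm" where
  "conj_translation T F F' \<gamma> p =
     (let B = BijGroup (gal_cosets T F F'); l = left_translation T F F' \<gamma>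
      in l \<otimes>\<^bsub>B\<^esub> p \<otimes>\<^bsub>B\<^esub> inv\<^bsub>B\<^esub> l)"

definition regular_subgroup :: "('x \<Rightarrow> 'x) set \<Rightarrow> 'x set \<Rightarrow> bool" where
  "regular_subgroup P \<Omega> \<longleftrightarrow> subgroup P (BijGroup \<Omega>) \<and>
     (\<forall>x\<in>\<Omega>. \<forall>y\<in>\<Omega>. \<exists>!p. p \<in> P \<and> p x = y)"

definition gp_subgroup ::
  "('e, 'm) ring_scheme \<Rightarrow> 'e set \<Rightarrow> 'e set \<Rightarrow> 'e coset_perm set \<Rightarrow> bool" where
  "gp_subgroup T F F' P \<longleftrightarrow> regular_subgroup P (gal_cosets T F F') \<and>
     (\<forall>\<gamma>\<in>carrier (gal T F). conj_translation T F F' \<gamma> ` P = P)"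

abbreviation perm_subgroup ::
  "('e, 'm) ring_scheme \<Rightarrow> 'e set \<Rightarrow> 'e set \<Rightarrow> 'e coset_perm set \<Rightarrow> 'e coset_perm monoid" where
  "perm_subgroup T F F' P \<equiv> (BijGroup (gal_cosets T F F'))\<lparr>carrier := P\<rparr>"

text \<open>\<open>R[G]\<close> for a finite group \<open>G\<close>; the element \<open>\<Sum> a\<^sub>p p\<close> is the function \<open>p \<mapsto> a\<^sub>p\<close>.\<close>

definition group_algebra ::
  "('r, 'm) ring_scheme \<Rightarrow> ('g, 'n) monoid_scheme \<Rightarrow> ('r, 'g \<Rightarrow> 'r) module" where
  "group_algebra R G = \<lparr>
     carrier = carrier G \<rightarrow>\<^sub>E carrier R,
     monoid.mult = (\<lambda>a b. \<lambda>q\<in>carrier G. \<Oplus>\<^bsub>R\<^esub>p\<in>carrier G. a p \<otimes>\<^bsub>R\<^esub> b (inv\<^bsub>G\<^esub> p \<otimes>\<^bsub>G\<^esub> q)),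
     one = (\<lambda>p\<in>carrier G. if p = \<one>\<^bsub>G\<^esub> then \<one>\<^bsub>R\<^esub> else \<zero>\<^bsub>R\<^esub>),
     ring.zero = (\<lambda>p\<in>carrier G. \<zero>\<^bsub>R\<^esub>),
     ring.add = (\<lambda>a b. \<lambda>p\<in>carrier G. a p \<oplus>\<^bsub>R\<^esub> b p),
     smult = (\<lambda>r a. \<lambda>p\<in>carrier G. r \<otimes>\<^bsub>R\<^esub> a p)\<rparr>"

text \<open>The fixed points of \<open>\<Gamma>\<close> on \<open>T[P]\<close>, where \<open>\<Gamma>\<close> acts on the coefficients and by conjugation
  on \<open>P\<close>.\<close>

definition gp_fixed ::
  "('e, 'm) ring_scheme \<Rightarrow> 'e set \<Rightarrow> 'e set \<Rightarrow> 'e coset_perm set \<Rightarrow> ('e coset_perm \<Rightarrow> 'e) set" where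
  "gp_fixed T F F' P = {a \<in> carrier (group_algebra T (perm_subgroup T F F' P)).
     \<forall>\<gamma>\<in>carrier (gal T F). \<forall>p\<in>P. a (conj_translation T F F' \<gamma> p) = \<gamma> (a p)}"

text \<open>The Hopf algebra \<open>A = T[P]\<^sup>\<Gamma>\<close>.  Its comultiplication is the restriction of that of \<open>T[P]\<close>,
  \<open>\<Sum> a\<^sub>p p \<mapsto> \<Sum> a\<^sub>p (p \<otimes> p)\<close>.  By Galois descent \<open>A \<otimes>\<^sub>F A\<close> embeds into
  \<open>T[P] \<otimes>\<^sub>T T[P] = T[P \<times> P]\<close>, and the image contains \<open>\<Sum> a\<^sub>p (p \<otimes> p)\<close> for every \<open>a \<in> A\<close>; so the list chosen below
  exists and is unique as an element of \<open>A \<otimes>\<^sub>F A\<close>.\<close>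

definition gp_hopf ::
  "('e, 'm) ring_scheme \<Rightarrow> 'e set \<Rightarrow> 'e set \<Rightarrow> 'e coset_perm set \<Rightarrow>
   ('e, 'e coset_perm \<Rightarrow> 'e) hopf" where
  "gp_hopf T F F' P = (let G = perm_subgroup T F F' P; TP = group_algebra T G in \<lparr>
     carrier = gp_fixed T F F' P,
     monoid.mult = (\<otimes>\<^bsub>TP\<^esub>), one = \<one>\<^bsub>TP\<^esub>, ring.zero = \<zero>\<^bsub>TP\<^esub>,
     ring.add = (\<oplus>\<^bsub>TP\<^esub>), smult = (\<odot>\<^bsub>TP\<^esub>),
     comult = (\<lambda>a. SOME xs. set xs \<subseteq> gp_fixed T F F' P \<times> gp_fixed T F F' P \<and>
        (\<forall>p\<in>P. \<forall>q\<in>P. lsum T (\<lambda>(u, v). u p \<otimes>\<^bsub>T\<^esub> v q) xs = (if p = q then a p else \<zero>\<^bsub>T\<^esub>))),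
     counit = (\<lambda>a. \<Oplus>\<^bsub>T\<^esub>p\<in>P. a p),
     antipode = (\<lambda>a. \<lambda>p\<in>P. a (inv\<^bsub>G\<^esub> p))\<rparr>)"

text \<open>All elements of the coset \<open>\<gamma>\<Delta>\<close> agree on \<open>F'\<close>; this is their common value at \<open>x\<close>.\<close>

definition coset_app :: "('e \<Rightarrow> 'e) set \<Rightarrow> 'e \<Rightarrow> 'e" where
  "coset_app c x = the_elem ((\<lambda>\<sigma>. \<sigma> x) ` c)"

text \<open>\<open>(\<Sum> a\<^sub>p p) \<cdot> x = \<Sum> a\<^sub>p (p\<inverse>(\<Delta>))(x)\<close>.\<close>

definition gp_action ::
  "('e, 'm) ring_scheme \<Rightarrow> 'e set \<Rightarrow> 'e set \<Rightarrow> 'e coset_perm set \<Rightarrow>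
   ('e coset_perm \<Rightarrow> 'e) \<Rightarrow> 'e \<Rightarrow> 'e" where
  "gp_action T F F' P a x =
     (\<Oplus>\<^bsub>T\<^esub>p\<in>P. a p \<otimes>\<^bsub>T\<^esub> coset_app ((inv\<^bsub>perm_subgroup T F F' P\<^esub> p) (carrier (gal T F'))) x)"

definition corresponds_to ::
  "('e, 'm) ring_scheme \<Rightarrow> 'e set \<Rightarrow> 'e set \<Rightarrow> ('e, 'a, 'n) hopf_scheme \<Rightarrow> ('a \<Rightarrow> 'e \<Rightarrow> 'e) \<Rightarrow>
   'e coset_perm set \<Rightarrow> bool" where
  "corresponds_to T F F' A act P \<longleftrightarrow>
     (\<exists>\<phi>. hopf_iso (T\<lparr>carrier := F\<rparr>) A (gp_hopf T F F' P) \<phi> \<and>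
       (\<forall>h\<in>carrier A. \<forall>x\<in>F'. act h x = gp_action T F F' P (\<phi> h) x))"

definition hopf_galois_structure_of_type ::
  "('e, 'm) ring_scheme \<Rightarrow> 'e set \<Rightarrow> 'e set \<Rightarrow> ('e, 'a, 'n) hopf_scheme \<Rightarrow> ('a \<Rightarrow> 'e \<Rightarrow> 'e) \<Rightarrow>
   ('g, 'k) monoid_scheme \<Rightarrow> bool" where
  "hopf_galois_structure_of_type E F F' A act N \<longleftrightarrow>
     hopf_galois_structure E F F' A act \<and>
     (\<exists>M P. galois_closure E F F' M \<and>
        gp_subgroup (E\<lparr>carrier := M\<rparr>) F F' P \<and>
        corresponds_to (E\<lparr>carrier := M\<rparr>) F F' A act P \<and>
        perm_subgroup (E\<lparr>carrier := M\<rparr>) F F' P \<cong> N)"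

end

theory Submission
  imports Defs
begin

text \<open>Let \<open>N\<^sub>0\<close> and \<open>M\<^sub>0\<close> be the regular permutation groups on \<open>G/S\<close> and \<open>S/S'\<close> that belong to the two
  given structures, normalised by the translations with elements of \<open>G\<close> and \<open>S\<close>.  Let \<open>\<pi>\<close> be the
  projection of \<open>G\<close> to \<open>S\<close> with kernel \<open>H\<close> (\<open>semidirect_projection\<close>).  Through \<open>\<pi>\<close> the group \<open>G\<close> acts
  on \<open>S/S'\<close>, and \<open>g S' \<mapsto> (g S, \<pi>(g) S')\<close> is an isomorphism of \<open>G\<close>-sets from \<open>G/S'\<close> to
  \<open>G/S \<times> S/S'\<close>.  So \<open>N\<^sub>0 \<times> M\<^sub>0\<close>, acting componentwise, is a regular group of permutations of \<open>G/S'\<close>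
  that is normalised by \<open>G\<close> (\<open>prod_perm_regular\<close>, \<open>prod_perm_iso\<close>, \<open>prod_perm_conj\<close>).

  The permutation groups in the definition of the type live on cosets for the Galois groups of
  three Galois closures rather than on cosets in \<open>G\<close>.  Restriction from \<open>E\<close> maps onto these Galois groups
  (\<open>restrict_gal_surj\<close>), and two automorphisms of \<open>E\<close> give the same coset iff they agree on the
  intermediate field (\<open>coset_of_eq_iff\<close>), so the three sets are \<open>G/S\<close>, \<open>S/S'\<close> and \<open>G/S'\<close>.  That
  \<open>L'\<close> has a Galois closure inside \<open>E\<close> is \<open>galois_closure_exists\<close>.

  Finally the group \<open>P\<close> obtained has to yield a Hopf-Galois structure; this is the easy direction of
  the theorem of Greither and Pareigis (\<open>gp_hopf_galois\<close>), for a Galois extension \<open>E/F\<close> with group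
  \<open>\<Gamma>\<close> and the algebra \<open>E[P]\<^sup>\<Gamma>\<close>.  The proof rests on explicit dual families instead of dimensions.
  Dedekind's independence of homomorphisms (\<open>homs_separated\<close>) gives \<open>a\<^sub>i\<close>, \<open>b\<^sub>i\<close> in \<open>E\<close> such that
  \<open>\<Sum> a\<^sub>i \<gamma>(b\<^sub>i)\<close> is \<open>1\<close> for \<open>\<gamma> = 1\<close> and \<open>0\<close> for the other \<open>\<gamma> \<in> \<Gamma>\<close>.  Summed over orbits in \<open>P\<close> they become
  elements \<open>e\<^sub>k\<close>, \<open>f\<^sub>k\<close> of \<open>E[P]\<^sup>\<Gamma>\<close> with \<open>\<Sum> e\<^sub>k(p) f\<^sub>k(q) = \<delta>\<^sub>p\<^sub>q\<close> (\<open>dual_families_exist\<close>).  The pairing of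
  \<open>f\<^sub>k\<close> with an element of \<open>E[P]\<^sup>\<Gamma>\<close> lies in \<open>F\<close>, so these families are an analogue of dual bases over \<open>F\<close>
  that is explicit over \<open>E\<close>.  They show that the algebra is finite-dimensional, that its
  comultiplication exists, with \<open>\<Sum> e\<^sub>k \<otimes> f\<^sub>k a\<close> representing \<open>\<Sum> a\<^sub>p (p \<otimes> p)\<close>, and that a tensor
  over \<open>F\<close> is determined by its matrix of coordinates in \<open>E\<close> (\<open>tensor_eqI\<close>), after which the
  Hopf algebra axioms become identities between such matrices.  Families of the same kind for
  \<open>F'\<close> in place of the algebra give the bijectivity of \<open>F' \<otimes> E[P]\<^sup>\<Gamma> \<rightarrow> End(F')\<close>.  The same coordinates also
  prove what is needed of Galois theory: Artin's theorem (\<open>gal_fixed_field\<close>), the Galois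
  correspondence (\<open>fixed_field_gal\<close>) and normality (\<open>hom_on_galois_is_gal\<close>).\<close>

section \<open>Sums over lists and over finite sets\<close>

lemma foldSetD_cong:
  "(A, x) \<in> foldSetD D f e \<Longrightarrow> (\<And>a. a \<in> A \<Longrightarrow> f a = g a) \<Longrightarrow> (A, x) \<in> foldSetD D g e"
proof (induction rule: foldSetD.induct)
  case emptyI
  then show ?case by (auto intro: foldSetD.emptyI)
next
  case (insertI x A y)
  have "g x y \<in> D" using insertI.hyps insertI.prems by (metis insertI1)
  moreover have "(A, y) \<in> foldSetD D g e" using insertI by auto
  ultimately show ?case
    using insertI.hyps insertI.prems foldSetD.insertI[of x A g y D e] by (metis insertI1)
qed

text \<open>The value of a finite sum depends on the summands alone, whether or not they lie in the
  carrier.  In this form the fact can be given to the simplifier as a congruence rule.\<close>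

lemma finsum_cong_fun: "(\<And>i. i \<in> A \<Longrightarrow> f i = g i) \<Longrightarrow> finsum R f A = finsum R g A"
proof -
  assume eq: "\<And>i. i \<in> A \<Longrightarrow> f i = g i"
  have "(A, x) \<in> foldSetD D ((\<oplus>\<^bsub>R\<^esub>) \<circ> f) e \<longleftrightarrow> (A, x) \<in> foldSetD D ((\<oplus>\<^bsub>R\<^esub>) \<circ> g) e"
    for x D e
    by (rule iffI; erule foldSetD_cong; simp add: eq)
  then show ?thesis
    by (simp add: finsum_def finprod_def foldD_def)
qed

lemma lsum_Nil [simp]: "lsum R f [] = \<zero>\<^bsub>R\<^esub>"
  and lsum_Cons [simp]: "lsum R f (x # xs) = f x \<oplus>\<^bsub>R\<^esub> lsum R f xs"
  by (simp_all add: lsum_def)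

lemma lsum_cong: "(\<And>x. x \<in> set xs \<Longrightarrow> f x = g x) \<Longrightarrow> lsum R f xs = lsum R g xs"
  by (induction xs) auto

lemma lsum_map: "lsum R f (map g xs) = lsum R (\<lambda>x. f (g x)) xs"
  by (induction xs) auto

lemma lsum_carrier_update [simp]: "lsum (R\<lparr>carrier := K\<rparr>) f xs = lsum R f xs"
  by (induction xs) auto

context ring
begin

lemma finsum_closed_fun [simp]:
  "(\<And>i. i \<in> A \<Longrightarrow> f i \<in> carrier R) \<Longrightarrow> finsum R f A \<in> carrier R"
  by (rule finsum_closed) auto

lemma finsum_add_fun:
  "(\<And>i. i \<in> A \<Longrightarrow> f i \<in> carrier R) \<Longrightarrow> (\<And>i. i \<in> A \<Longrightarrow> g i \<in> carrier R) \<Longrightarrow>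
   (\<Oplus>i\<in>A. f i \<oplus> g i) = finsum R f A \<oplus> finsum R g A"
  by (rule finsum_addf) auto

lemma finsum_mult_left:
  "finite A \<Longrightarrow> c \<in> carrier R \<Longrightarrow> (\<And>i. i \<in> A \<Longrightarrow> f i \<in> carrier R) \<Longrightarrow>
   c \<otimes> finsum R f A = (\<Oplus>i\<in>A. c \<otimes> f i)"
  by (rule finsum_rdistr) auto

lemma finsum_mult_right:
  "finite A \<Longrightarrow> c \<in> carrier R \<Longrightarrow> (\<And>i. i \<in> A \<Longrightarrow> f i \<in> carrier R) \<Longrightarrow>
   finsum R f A \<otimes> c = (\<Oplus>i\<in>A. f i \<otimes> c)"
  by (rule finsum_ldistr) auto

lemma finsum_swap:
  assumes "finite A" "finite B" "\<And>i j. i \<in> A \<Longrightarrow> j \<in> B \<Longrightarrow> f i j \<in> carrier R"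
  shows "(\<Oplus>i\<in>A. \<Oplus>j\<in>B. f i j) = (\<Oplus>j\<in>B. \<Oplus>i\<in>A. f i j)"
  using assms(1,3)
proof (induction A rule: finite_induct)
  case empty
  then show ?case by simp
next
  case (insert a A)
  have "(\<Oplus>j\<in>B. \<Oplus>i\<in>insert a A. f i j) = (\<Oplus>j\<in>B. f a j \<oplus> (\<Oplus>i\<in>A. f i j))"
    using insert by (intro finsum_cong_fun finsum_insert) auto
  also have "\<dots> = (\<Oplus>j\<in>B. f a j) \<oplus> (\<Oplus>j\<in>B. \<Oplus>i\<in>A. f i j)"
    using insert by (intro finsum_add_fun) auto
  finally show ?case
    using insert by (subst finsum_insert) auto
qed

lemma finsum_delta:
  assumes "finite A" "a \<in> A" "f a \<in> carrier R"
  shows "(\<Oplus>i\<in>A. if a = i then f i else \<zero>) = f a"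
proof -
  have "(\<Oplus>i\<in>A. if a = i then f i else \<zero>) = (\<Oplus>i\<in>A. if a = i then f a else \<zero>)"
    by (rule finsum_cong_fun) auto
  also have "\<dots> = f a"
    using add.finprod_singleton[of a A "\<lambda>_. f a"] assms by auto
  finally show ?thesis .
qed

lemma finsum_delta':
  assumes "finite A" "a \<in> A" "f a \<in> carrier R"
  shows "(\<Oplus>i\<in>A. if i = a then f i else \<zero>) = f a"
proof -
  have "(\<Oplus>i\<in>A. if i = a then f i else \<zero>) = (\<Oplus>i\<in>A. if a = i then f i else \<zero>)"
    by (rule finsum_cong_fun) auto
  then show ?thesis using finsum_delta[of A a f] assms by simp
qed

lemma finsum_zero_fun: "(\<And>i. i \<in> A \<Longrightarrow> f i = \<zero>) \<Longrightarrow> finsum R f A = \<zero>"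
  by (rule add.finprod_one_eqI) auto

lemma finsum_if_subset:
  assumes "finite A" "B \<subseteq> A" "\<And>i. i \<in> B \<Longrightarrow> f i \<in> carrier R"
  shows "(\<Oplus>i\<in>A. if i \<in> B then f i else \<zero>) = finsum R f B"
proof -
  have "finsum R f B = (\<Oplus>i\<in>B. if i \<in> B then f i else \<zero>)"
    by (rule finsum_cong_fun) auto
  also have "\<dots> = (\<Oplus>i\<in>A. if i \<in> B then f i else \<zero>)"
    using assms by (intro add.finprod_mono_neutral_cong_left) auto
  finally show ?thesis by simp
qed

lemma finsum_bij:
  assumes "bij_betw h A B" "\<And>i. i \<in> B \<Longrightarrow> f i \<in> carrier R"
  shows "(\<Oplus>i\<in>A. f (h i)) = finsum R f B"
proof -
  have "finsum R f (h ` A) = (\<Oplus>i\<in>A. f (h i))"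
    using assms by (intro finsum_reindex) (auto simp: bij_betw_def)
  then show ?thesis using assms by (simp add: bij_betw_def)
qed

lemma lsum_closed [simp]:
  "(\<And>x. x \<in> set xs \<Longrightarrow> f x \<in> carrier R) \<Longrightarrow> lsum R f xs \<in> carrier R"
  by (induction xs) auto

lemma lsum_zero: "(\<And>x. x \<in> set xs \<Longrightarrow> f x = \<zero>) \<Longrightarrow> lsum R f xs = \<zero>"
  by (induction xs) auto

lemma lsum_append:
  "(\<And>x. x \<in> set xs \<union> set ys \<Longrightarrow> f x \<in> carrier R) \<Longrightarrow>
   lsum R f (xs @ ys) = lsum R f xs \<oplus> lsum R f ys"
  by (induction xs) (auto simp: a_assoc)

lemma lsum_concat:
  "(\<And>xs x. xs \<in> set xss \<Longrightarrow> x \<in> set xs \<Longrightarrow> f x \<in> carrier R) \<Longrightarrow>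
   lsum R f (concat xss) = lsum R (lsum R f) xss"
proof (induction xss)
  case (Cons xs xss)
  have "lsum R f (xs @ concat xss) = lsum R f xs \<oplus> lsum R f (concat xss)"
    using Cons.prems by (intro lsum_append) auto
  moreover have "lsum R f (concat xss) = lsum R (lsum R f) xss"
    using Cons.prems by (intro Cons.IH) auto
  ultimately show ?case by simp
qed simp

lemma lsum_add:
  "(\<And>x. x \<in> set xs \<Longrightarrow> f x \<in> carrier R) \<Longrightarrow> (\<And>x. x \<in> set xs \<Longrightarrow> g x \<in> carrier R) \<Longrightarrow>
   lsum R (\<lambda>x. f x \<oplus> g x) xs = lsum R f xs \<oplus> lsum R g xs"
proof (induction xs)
  case (Cons x xs)
  then have "f x \<in> carrier R" "g x \<in> carrier R" "lsum R f xs \<in> carrier R" "lsum R g xs \<in> carrier R"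
    by auto
  moreover have "lsum R (\<lambda>x. f x \<oplus> g x) xs = lsum R f xs \<oplus> lsum R g xs"
    using Cons.prems by (intro Cons.IH) auto
  ultimately show ?case by (simp add: add.m_ac)
qed simp

lemma lsum_mult_left:
  "c \<in> carrier R \<Longrightarrow> (\<And>x. x \<in> set xs \<Longrightarrow> f x \<in> carrier R) \<Longrightarrow>
   c \<otimes> lsum R f xs = lsum R (\<lambda>x. c \<otimes> f x) xs"
  by (induction xs) (auto simp: r_distr)

lemma lsum_mult_right:
  "c \<in> carrier R \<Longrightarrow> (\<And>x. x \<in> set xs \<Longrightarrow> f x \<in> carrier R) \<Longrightarrow>
   lsum R f xs \<otimes> c = lsum R (\<lambda>x. f x \<otimes> c) xs"
  by (induction xs) (auto simp: l_distr)

lemma lsum_finsum_swap: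
  "finite A \<Longrightarrow> (\<And>x i. x \<in> set xs \<Longrightarrow> i \<in> A \<Longrightarrow> f x i \<in> carrier R) \<Longrightarrow>
   lsum R (\<lambda>x. \<Oplus>i\<in>A. f x i) xs = (\<Oplus>i\<in>A. lsum R (\<lambda>x. f x i) xs)"
proof (induction xs)
  case Nil
  then show ?case by (simp add: finsum_zero_fun)
next
  case (Cons x xs)
  then show ?case by (simp add: finsum_add_fun)
qed

lemma lsum_swap:
  "(\<And>x y. x \<in> set xs \<Longrightarrow> y \<in> set ys \<Longrightarrow> f x y \<in> carrier R) \<Longrightarrow>
   lsum R (\<lambda>x. lsum R (f x) ys) xs = lsum R (\<lambda>y. lsum R (\<lambda>x. f x y) xs) ys"
  by (induction xs) (auto simp: lsum_zero lsum_add)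

lemma finsum_product:
  assumes "finite A" "finite B" "\<And>i. i \<in> A \<Longrightarrow> f i \<in> carrier R" "\<And>j. j \<in> B \<Longrightarrow> g j \<in> carrier R"
  shows "finsum R f A \<otimes> finsum R g B = (\<Oplus>i\<in>A. \<Oplus>j\<in>B. f i \<otimes> g j)"
  using assms by (subst finsum_mult_right) (simp_all add: finsum_mult_left cong: finsum_cong_fun)

lemma lsum_finsum_product:
  assumes "finite A" "finite B" "\<And>x i. x \<in> set xs \<Longrightarrow> i \<in> A \<Longrightarrow> f x i \<in> carrier R"
    "\<And>x j. x \<in> set xs \<Longrightarrow> j \<in> B \<Longrightarrow> g x j \<in> carrier R"
  shows "lsum R (\<lambda>x. finsum R (f x) A \<otimes> finsum R (g x) B) xs
    = (\<Oplus>i\<in>A. \<Oplus>j\<in>B. lsum R (\<lambda>x. f x i \<otimes> g x j) xs)"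
  using assms
  by (simp add: finsum_product lsum_finsum_swap cong: lsum_cong finsum_cong_fun)

lemma lsum_distinct:
  "distinct xs \<Longrightarrow> (\<And>x. x \<in> set xs \<Longrightarrow> f x \<in> carrier R) \<Longrightarrow> lsum R f xs = finsum R f (set xs)"
proof (induction xs)
  case (Cons x xs)
  have "lsum R f xs = finsum R f (set xs)" using Cons by auto
  then show ?case using Cons.prems by (simp add: finsum_insert)
qed simp

end

text \<open>The hypothesis says that the functionals \<open>b \<mapsto> \<Sum> m x p \<cdot> b p\<close> are dual to the vectors with
  entries \<open>s x\<close>, so expanding \<open>b\<close> along them returns its entry at \<open>q\<close>.  Elements of descended
  algebras, elements of intermediate fields and coefficients of endomorphisms are all recovered
  in this way below.\<close>

lemma (in cring) dual_families_contract:
  assumes fin: "finite A" and q: "q \<in> A"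
    and cl: "\<And>x. x \<in> set xs \<Longrightarrow> s x \<in> carrier R" "\<And>x p. x \<in> set xs \<Longrightarrow> p \<in> A \<Longrightarrow> m x p \<in> carrier R"
      "\<And>p. p \<in> A \<Longrightarrow> b p \<in> carrier R"
    and dual: "\<And>p. p \<in> A \<Longrightarrow> lsum R (\<lambda>x. s x \<otimes> m x p) xs = (if q = p then \<one> else \<zero>)"
  shows "lsum R (\<lambda>x. (\<Oplus>p\<in>A. m x p \<otimes> b p) \<otimes> s x) xs = b q"
proof -
  have "lsum R (\<lambda>x. (\<Oplus>p\<in>A. m x p \<otimes> b p) \<otimes> s x) xs = lsum R (\<lambda>x. \<Oplus>p\<in>A. b p \<otimes> (s x \<otimes> m x p)) xs"
    using fin cl by (intro lsum_cong, subst finsum_mult_right) (simp_all add: m_ac cong: finsum_cong_fun)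
  also have "\<dots> = (\<Oplus>p\<in>A. b p \<otimes> lsum R (\<lambda>x. s x \<otimes> m x p) xs)"
    using fin cl by (simp add: lsum_finsum_swap lsum_mult_left cong: finsum_cong_fun)
  also have "\<dots> = (\<Oplus>p\<in>A. if q = p then b p else \<zero>)"
    using dual cl by (intro finsum_cong_fun) simp
  also have "\<dots> = b q"
    using fin q cl by (intro finsum_delta)
  finally show ?thesis .
qed

lemma lsum_hom:
  assumes "ring R" "ring S" "\<And>x y. x \<in> carrier R \<Longrightarrow> y \<in> carrier R \<Longrightarrow> h (x \<oplus>\<^bsub>R\<^esub> y) = h x \<oplus>\<^bsub>S\<^esub> h y"
    "h \<zero>\<^bsub>R\<^esub> = \<zero>\<^bsub>S\<^esub>" "\<And>x. x \<in> set xs \<Longrightarrow> f x \<in> carrier R"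
  shows "h (lsum R f xs) = lsum S (\<lambda>x. h (f x)) xs"
proof -
  interpret R: ring R by fact
  show ?thesis
    using assms(5) by (induction xs) (auto simp: assms(3,4))
qed

section \<open>Galois groups\<close>

lemma gal_mem_iff:
  "\<sigma> \<in> carrier (gal E F) \<longleftrightarrow>
     \<sigma> \<in> extensional (carrier E) \<and> bij_betw \<sigma> (carrier E) (carrier E) \<and> \<sigma> \<in> ring_hom E E \<and>
     (\<forall>x\<in>F. \<sigma> x = x)"
  by (auto simp: gal_def Bij_def ring_iso_def)

lemma gal_mono: "F \<subseteq> F' \<Longrightarrow> carrier (gal E F') \<subseteq> carrier (gal E F)"
  by (auto simp: gal_mem_iff subset_iff)

context
  fixes E :: "('e, 'm) ring_scheme" and \<sigma> F
  assumes E: "ring E" and \<sigma>: "\<sigma> \<in> carrier (gal E F)"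
begin

interpretation ring E by (rule E)

interpretation hom: ring_hom_ring E E \<sigma>
  using \<sigma> by (auto simp: gal_mem_iff intro: ring_hom_ringI2 E)

lemma gal_closed: "x \<in> carrier E \<Longrightarrow> \<sigma> x \<in> carrier E"
  and gal_add: "x \<in> carrier E \<Longrightarrow> y \<in> carrier E \<Longrightarrow> \<sigma> (x \<oplus>\<^bsub>E\<^esub> y) = \<sigma> x \<oplus>\<^bsub>E\<^esub> \<sigma> y"
  and gal_mult: "x \<in> carrier E \<Longrightarrow> y \<in> carrier E \<Longrightarrow> \<sigma> (x \<otimes>\<^bsub>E\<^esub> y) = \<sigma> x \<otimes>\<^bsub>E\<^esub> \<sigma> y"
  and gal_one: "\<sigma> \<one>\<^bsub>E\<^esub> = \<one>\<^bsub>E\<^esub>"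
  and gal_zero: "\<sigma> \<zero>\<^bsub>E\<^esub> = \<zero>\<^bsub>E\<^esub>"
  and gal_minus: "x \<in> carrier E \<Longrightarrow> \<sigma> (\<ominus>\<^bsub>E\<^esub> x) = \<ominus>\<^bsub>E\<^esub> \<sigma> x"
  by auto

lemma gal_fixes: "x \<in> F \<Longrightarrow> \<sigma> x = x"
  using \<sigma> by (auto simp: gal_mem_iff)

lemma gal_hom: "\<sigma> \<in> ring_hom E E"
  using \<sigma> by (auto simp: gal_mem_iff)

lemma gal_bij: "bij_betw \<sigma> (carrier E) (carrier E)"
  using \<sigma> by (auto simp: gal_mem_iff)

lemma gal_lsum:
  "(\<And>x. x \<in> set xs \<Longrightarrow> f x \<in> carrier E) \<Longrightarrow> \<sigma> (lsum E f xs) = lsum E (\<lambda>x. \<sigma> (f x)) xs"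
  by (rule lsum_hom[OF E E]) (auto simp: gal_add gal_zero)

lemma gal_finsum:
  "(\<And>x. x \<in> A \<Longrightarrow> f x \<in> carrier E) \<Longrightarrow> \<sigma> (finsum E f A) = (\<Oplus>\<^bsub>E\<^esub>x\<in>A. \<sigma> (f x))"
proof (induction A rule: infinite_finite_induct)
  case (insert a A)
  then show ?case by (subst (1 2) finsum_insert) (auto simp: gal_add gal_closed)
qed (auto simp: gal_zero finsum_infinite)

end

lemma gal_eqI:
  "\<lbrakk>\<sigma> \<in> carrier (gal E F); \<tau> \<in> carrier (gal E F'); \<And>x. x \<in> carrier E \<Longrightarrow> \<sigma> x = \<tau> x\<rbrakk> \<Longrightarrow> \<sigma> = \<tau>"
  by (rule extensionalityI[of _ "carrier E"]) (auto simp: gal_mem_iff)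

lemma gal_subgroup:
  fixes E (structure)
  assumes "field E" "F \<subseteq> carrier E"
  shows "subgroup (carrier (gal E F)) (BijGroup (carrier E))"
proof -
  interpret field E by fact
  interpret B: group "BijGroup (carrier E)" by (rule group_BijGroup)
  show ?thesis
  proof (rule B.subgroupI)
    show "carrier (gal E F) \<subseteq> carrier (BijGroup (carrier E))"
      by (auto simp: gal_def BijGroup_def)
    have "(\<lambda>x\<in>carrier E. x) \<in> carrier (gal E F)"
      using assms by (auto simp: gal_mem_iff bij_betw_def inj_on_def intro!: ring_hom_memI)
    then show "carrier (gal E F) \<noteq> {}" by auto
  next
    fix \<sigma> assume s: "\<sigma> \<in> carrier (gal E F)"
    then have B: "\<sigma> \<in> Bij (carrier E)" by (auto simp: gal_def)
    have inv: "inv\<^bsub>BijGroup (carrier E)\<^esub> \<sigma> = (\<lambda>x\<in>carrier E. inv_into (carrier E) \<sigma> x)"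
      by (rule inv_BijGroup[OF B])
    note bij = gal_bij[OF ring_axioms s]
    have iv: "inv_into (carrier E) \<sigma> (\<sigma> x) = x" if "x \<in> carrier E" for x
      using that bij by (simp add: bij_betw_def)
    have ic: "inv_into (carrier E) \<sigma> x \<in> carrier E" "\<sigma> (inv_into (carrier E) \<sigma> x) = x"
      if "x \<in> carrier E" for x
      using that bij by (auto simp: bij_betw_def f_inv_into_f inv_into_into)
    have "inv_into (carrier E) \<sigma> (x \<otimes> y) = inv_into (carrier E) \<sigma> x \<otimes> inv_into (carrier E) \<sigma> y"
      if "x \<in> carrier E" "y \<in> carrier E" for x y
      using gal_mult[OF ring_axioms s ic(1) ic(1), OF that] ic(1)[OF that(1)] ic(1)[OF that(2)]
        ic(2)[OF that(1)] ic(2)[OF that(2)] by (metis iv m_closed)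
    moreover have "inv_into (carrier E) \<sigma> (x \<oplus> y) = inv_into (carrier E) \<sigma> x \<oplus> inv_into (carrier E) \<sigma> y"
      if "x \<in> carrier E" "y \<in> carrier E" for x y
      using gal_add[OF ring_axioms s ic(1) ic(1), OF that] ic(1)[OF that(1)] ic(1)[OF that(2)]
        ic(2)[OF that(1)] ic(2)[OF that(2)] by (metis iv a_closed)
    moreover have "inv_into (carrier E) \<sigma> \<one> = \<one>"
      using iv[of \<one>] gal_one[OF ring_axioms s] by simp
    moreover have "inv_into (carrier E) \<sigma> x = x" if "x \<in> F" for x
      using iv[of x] gal_fixes[OF ring_axioms s that] that assms by auto
    ultimately show "inv\<^bsub>BijGroup (carrier E)\<^esub> \<sigma> \<in> carrier (gal E F)"
      unfolding inv using bij_betw_inv_into[OF bij] ic assms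
      by (auto simp: gal_mem_iff intro!: ring_hom_memI)
  next
    fix \<sigma> \<tau> assume s: "\<sigma> \<in> carrier (gal E F)" and t: "\<tau> \<in> carrier (gal E F)"
    then have "\<sigma> \<in> Bij (carrier E)" "\<tau> \<in> Bij (carrier E)" by (auto simp: gal_def)
    then show "\<sigma> \<otimes>\<^bsub>BijGroup (carrier E)\<^esub> \<tau> \<in> carrier (gal E F)"
      using assms compose_Bij[of \<sigma> "carrier E" \<tau>]
        gal_closed[OF ring_axioms s] gal_closed[OF ring_axioms t]
      by (auto simp: BijGroup_def gal_def ring_iso_def Bij_def compose_def
          gal_add[OF ring_axioms s] gal_add[OF ring_axioms t] gal_mult[OF ring_axioms s]
          gal_mult[OF ring_axioms t] gal_one[OF ring_axioms s] gal_one[OF ring_axioms t]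
          gal_fixes[OF ring_axioms s] gal_fixes[OF ring_axioms t] subset_iff intro!: ring_hom_memI)
  qed
qed

lemma gal_group: "field E \<Longrightarrow> F \<subseteq> carrier E \<Longrightarrow> group (gal E F)"
  using subgroup.subgroup_is_group[OF gal_subgroup group_BijGroup, of E F]
  by (simp add: gal_def)

lemma gal_comp_apply:
  "\<sigma> \<in> carrier (gal E F) \<Longrightarrow> \<tau> \<in> carrier (gal E F) \<Longrightarrow> x \<in> carrier E \<Longrightarrow>
   (\<sigma> \<otimes>\<^bsub>gal E F\<^esub> \<tau>) x = \<sigma> (\<tau> x)"
  by (auto simp: gal_def BijGroup_def compose_def)

lemma gal_id_apply: "x \<in> carrier E \<Longrightarrow> \<one>\<^bsub>gal E F\<^esub> x = x"
  by (auto simp: gal_def BijGroup_def)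

lemma gal_mult_eq: "monoid.mult (gal E F) = monoid.mult (gal E F')"
  by (simp add: gal_def)

lemma gal_as_carrier_update: "gal E F' = (gal E F)\<lparr>carrier := carrier (gal E F')\<rparr>"
  by (simp add: gal_def)

lemma gal_subgroup_gal:
  assumes "field E" "F \<subseteq> F'" "F' \<subseteq> carrier E"
  shows "subgroup (carrier (gal E F')) (gal E F)"
proof -
  interpret group "gal E F" using assms by (intro gal_group) auto
  interpret F': group "gal E F'" using assms by (intro gal_group) auto
  show ?thesis
    using F'.group_axioms gal_mono[of F F' E] assms
    by (intro group_incl_imp_subgroup) (auto simp flip: gal_as_carrier_update)
qed

context
  fixes E :: "('e, 'm) ring_scheme" and \<sigma> F
  assumes E: "field E" and F: "F \<subseteq> carrier E" and \<sigma>: "\<sigma> \<in> carrier (gal E F)"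
begin

interpretation field E by (rule E)
interpretation group "gal E F" by (rule gal_group[OF E F])

lemma gal_inv_apply: "x \<in> carrier E \<Longrightarrow> (inv\<^bsub>gal E F\<^esub> \<sigma>) (\<sigma> x) = x"
  and gal_apply_inv: "x \<in> carrier E \<Longrightarrow> \<sigma> ((inv\<^bsub>gal E F\<^esub> \<sigma>) x) = x"
  using \<sigma> by (simp_all add: gal_comp_apply[of _ E F, symmetric] gal_id_apply)

end

text \<open>This is Dedekind's theorem on the independence of homomorphisms into a field, in the
  form of a witness: the linear combination \<open>\<Sum> a\<^sub>i \<phi>(b\<^sub>i)\<close> tells \<open>g\<close> from the other
  homomorphisms \<open>\<phi>\<close>.  One factor \<open>(\<phi>(z) - \<phi>'(z)) / (g(z) - \<phi>'(z))\<close> per homomorphism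
  \<open>\<phi>'\<close> to be excluded, for some \<open>z\<close> with \<open>\<phi>'(z) \<noteq> g(z)\<close>, does this; multiplying out gives
  the sum.\<close>

lemma homs_separated:
  fixes E (structure)
  assumes "field E" "subring M E" "finite \<Phi>"
    and "g \<in> ring_hom (E\<lparr>carrier := M\<rparr>) E"
    and "\<And>\<phi>. \<phi> \<in> \<Phi> \<Longrightarrow> \<phi> \<in> ring_hom (E\<lparr>carrier := M\<rparr>) E"
    and "\<And>\<phi>. \<phi> \<in> \<Phi> \<Longrightarrow> \<exists>z\<in>M. \<phi> z \<noteq> g z"
  shows "\<exists>xs. set xs \<subseteq> carrier E \<times> M \<and> lsum E (\<lambda>(a, b). a \<otimes>\<^bsub>E\<^esub> g b) xs = \<one>\<^bsub>E\<^esub> \<and>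
    (\<forall>\<phi>\<in>\<Phi>. lsum E (\<lambda>(a, b). a \<otimes>\<^bsub>E\<^esub> \<phi> b) xs = \<zero>\<^bsub>E\<^esub>)"
  using assms(3,5,6)
proof (induction \<Phi> rule: finite_induct)
  interpret field E by fact
  case empty
  have "g \<one> = \<one>" using ring_hom_one[OF assms(4)] by simp
  then show ?case
    using subringE(3)[OF assms(2)] by (intro exI[of _ "[(\<one>, \<one>)]"]) auto
next
  interpret field E by fact
  case (insert \<phi> \<Phi>)
  obtain xs where xs: "set xs \<subseteq> carrier E \<times> M" "lsum E (\<lambda>(a, b). a \<otimes> g b) xs = \<one>"
    "\<And>\<psi>. \<psi> \<in> \<Phi> \<Longrightarrow> lsum E (\<lambda>(a, b). a \<otimes> \<psi> b) xs = \<zero>"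
    using insert by auto
  obtain z where z: "z \<in> M" "\<phi> z \<noteq> g z" using insert.prems(2)[of \<phi>] by auto
  have sub: "M \<subseteq> carrier E" using subringE(1)[OF assms(2)] .
  have phi: "\<phi> \<in> ring_hom (E\<lparr>carrier := M\<rparr>) E" using insert.prems by auto
  have c: "\<phi> z \<in> carrier E" "g z \<in> carrier E"
    using z ring_hom_closed[OF phi, of z] ring_hom_closed[OF assms(4), of z] by auto
  define d where "d = g z \<ominus> \<phi> z"
  have d: "d \<in> carrier E" "d \<noteq> \<zero>" using c z by (auto simp: d_def)
  define a1 where "a1 = inv d"
  have a1: "a1 \<in> carrier E" "a1 \<otimes> d = \<one>"
    using d field_Units unfolding a1_def by auto
  define ys where "ys = map (\<lambda>(a, b). (a \<otimes> a1, b \<otimes> z)) xs @ map (\<lambda>(a, b). (\<ominus> (a \<otimes> a1 \<otimes> \<phi> z), b)) xs"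
  have ys: "set ys \<subseteq> carrier E \<times> M"
    using xs(1) z c a1 sub subringE(6)[OF assms(2)] unfolding ys_def by auto
  have sum: "lsum E (\<lambda>(a, b). a \<otimes> \<psi> b) ys = (a1 \<otimes> (\<psi> z \<ominus> \<phi> z)) \<otimes> lsum E (\<lambda>(a, b). a \<otimes> \<psi> b) xs"
    if h: "\<psi> \<in> ring_hom (E\<lparr>carrier := M\<rparr>) E" for \<psi>
  proof -
    have psi: "\<psi> b \<in> carrier E" "\<psi> (b \<otimes> z) = \<psi> b \<otimes> \<psi> z" if "b \<in> M" for b
      using that z ring_hom_closed[OF h, of b] ring_hom_mult[OF h, of b z] by auto
    have ca: "\<And>a b. (a, b) \<in> set xs \<Longrightarrow> a \<in> carrier E \<and> b \<in> M" using xs by auto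
    have "lsum E (\<lambda>(a, b). a \<otimes> \<psi> b) ys
        = lsum E (\<lambda>(a, b). a \<otimes> a1 \<otimes> \<psi> (b \<otimes> z)) xs \<oplus> lsum E (\<lambda>(a, b). (\<ominus> (a \<otimes> a1 \<otimes> \<phi> z)) \<otimes> \<psi> b) xs"
      unfolding ys_def using psi z a1 c
      by (subst lsum_append) (auto simp: lsum_map case_prod_unfold dest!: ca)
    also have "\<dots> = lsum E (\<lambda>(a, b). a \<otimes> a1 \<otimes> \<psi> (b \<otimes> z) \<oplus> (\<ominus> (a \<otimes> a1 \<otimes> \<phi> z)) \<otimes> \<psi> b) xs"
      unfolding case_prod_unfold using psi z a1 c
      by (subst lsum_add) (auto dest!: ca)
    also have "\<dots> = lsum E (\<lambda>(a, b). (a1 \<otimes> (\<psi> z \<ominus> \<phi> z)) \<otimes> (a \<otimes> \<psi> b)) xs"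
    proof (rule lsum_cong, clarify)
      fix a b assume "(a, b) \<in> set xs"
      then have "a \<in> carrier E" "b \<in> M" using ca by auto
      moreover then have "\<psi> b \<in> carrier E" "\<psi> z \<in> carrier E" using psi z by auto
      ultimately show "a \<otimes> a1 \<otimes> \<psi> (b \<otimes> z) \<oplus> (\<ominus> (a \<otimes> a1 \<otimes> \<phi> z)) \<otimes> \<psi> b
          = (a1 \<otimes> (\<psi> z \<ominus> \<phi> z)) \<otimes> (a \<otimes> \<psi> b)"
        using psi(2)[of b] a1(1) c by algebra
    qed
    also have "\<dots> = (a1 \<otimes> (\<psi> z \<ominus> \<phi> z)) \<otimes> lsum E (\<lambda>(a, b). a \<otimes> \<psi> b) xs"
      unfolding case_prod_unfold using psi z a1 c
      by (subst lsum_mult_left) (auto dest!: ca)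
    finally show ?thesis .
  qed
  have "lsum E (\<lambda>(a, b). a \<otimes> g b) ys = \<one>"
    using sum[OF assms(4)] a1 xs(2) by (simp add: d_def)
  moreover have "lsum E (\<lambda>(a, b). a \<otimes> \<phi> b) ys = \<zero>"
  proof -
    have "lsum E (\<lambda>(a, b). a \<otimes> \<phi> b) xs \<in> carrier E"
      using xs(1) ring_hom_closed[OF phi] by (intro lsum_closed) auto
    moreover have "\<phi> z \<ominus> \<phi> z = \<zero>" using c by (simp add: minus_eq r_neg)
    ultimately show ?thesis using sum[OF phi] a1 by simp
  qed
  moreover have "lsum E (\<lambda>(a, b). a \<otimes> \<psi> b) ys = \<zero>" if "\<psi> \<in> \<Phi>" for \<psi>
  proof -
    have h: "\<psi> \<in> ring_hom (E\<lparr>carrier := M\<rparr>) E" using insert.prems that by auto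
    have "\<psi> z \<in> carrier E" using ring_hom_closed[OF h, of z] z by auto
    then show ?thesis using sum[OF h] xs(3)[OF that] a1 c by simp
  qed
  ultimately show ?case using ys by auto
qed

section \<open>Galois extensions without linear algebra\<close>

text \<open>The Galois correspondence, normality and descent are all obtained from one kind of object:
  coordinates \<open>(a\<^sub>i, b\<^sub>i)\<close> with \<open>\<Sum> a\<^sub>i \<gamma>(b\<^sub>i) = 1\<close> if \<open>\<gamma>\<close> lies in a given subgroup and \<open>0\<close>
  otherwise.  What the degree of the extension has to say enters only through the finiteness of
  the Galois group.\<close>

locale galois = field E for E (structure) +
  fixes F :: "'a set"
  assumes subfield: "subfield F E"
    and finite_gal: "finite (carrier (gal E F))"
    and fixed: "fixed_field E (carrier (gal E F)) = F"
begin

abbreviation "\<Gamma> \<equiv> carrier (gal E F)"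

sublocale G: group "gal E F"
  using subfieldE(3)[OF subfield] by (intro gal_group field_axioms)

lemma F_sub: "F \<subseteq> carrier E"
  using subfieldE(3)[OF subfield] .

lemmas gal_props =
  gal_closed[OF ring_axioms, of _ F] gal_add[OF ring_axioms, of _ F] gal_mult[OF ring_axioms, of _ F]
  gal_one[OF ring_axioms, of _ F] gal_zero[OF ring_axioms, of _ F] gal_fixes[OF ring_axioms, of _ F]
  gal_comp_apply[of _ E F] gal_id_apply[of _ E F]
  gal_inv_apply[OF field_axioms F_sub] gal_apply_inv[OF field_axioms F_sub]

lemma in_F_iff: "x \<in> F \<longleftrightarrow> x \<in> carrier E \<and> (\<forall>\<sigma>\<in>\<Gamma>. \<sigma> x = x)"
  using fixed by (auto simp: fixed_field_def)

lemma sum_over_gal_translate: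
  assumes "subgroup D (gal E F)" "\<tau> \<in> D" "\<And>\<sigma>. \<sigma> \<in> D \<Longrightarrow> f \<sigma> \<in> carrier E"
  shows "(\<Oplus>\<sigma>\<in>D. f (\<tau> \<otimes>\<^bsub>gal E F\<^esub> \<sigma>)) = (\<Oplus>\<sigma>\<in>D. f \<sigma>)"
proof (rule finsum_bij[OF _ assms(3)])
  interpret D: subgroup D "gal E F" by fact
  show "bij_betw (\<lambda>\<sigma>. \<tau> \<otimes>\<^bsub>gal E F\<^esub> \<sigma>) D D"
    using assms(2) D.mem_carrier
    by (intro bij_betwI[where g = "\<lambda>\<sigma>. inv\<^bsub>gal E F\<^esub> \<tau> \<otimes>\<^bsub>gal E F\<^esub> \<sigma>"])
       (auto simp: G.m_assoc[symmetric])
qed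

definition trace :: "('a \<Rightarrow> 'a) set \<Rightarrow> 'a \<Rightarrow> 'a" where
  "trace D x = (\<Oplus>\<sigma>\<in>D. \<sigma> x)"

lemma trace_closed:
  "D \<subseteq> \<Gamma> \<Longrightarrow> x \<in> carrier E \<Longrightarrow> trace D x \<in> carrier E"
  unfolding trace_def by (intro finsum_closed_fun) (auto intro: gal_props)

lemma gal_trace:
  assumes "subgroup D (gal E F)" "\<tau> \<in> D" "x \<in> carrier E"
  shows "\<tau> (trace D x) = trace D x"
proof -
  have D: "\<sigma> \<in> \<Gamma>" if "\<sigma> \<in> D" for \<sigma>
    using that assms(1) by (rule subgroup.mem_carrier[rotated])
  have "\<tau> (trace D x) = (\<Oplus>\<sigma>\<in>D. (\<tau> \<otimes>\<^bsub>gal E F\<^esub> \<sigma>) x)"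
    unfolding trace_def using assms D
    by (subst gal_finsum[OF ring_axioms D]) (auto intro!: finsum_cong_fun simp: gal_props)
  also have "\<dots> = trace D x"
    unfolding trace_def using assms D
    by (intro sum_over_gal_translate[of D \<tau> "\<lambda>\<sigma>. \<sigma> x"]) (auto intro: gal_props)
  finally show ?thesis .
qed

lemma trace_in_fixed_field:
  "subgroup D (gal E F) \<Longrightarrow> x \<in> carrier E \<Longrightarrow> trace D x \<in> fixed_field E D"
  unfolding fixed_field_def
  by (auto simp: gal_trace trace_closed subgroup.subset)

lemma trace_total_in_F: "x \<in> carrier E \<Longrightarrow> trace (\<Gamma>) x \<in> F"
  using trace_in_fixed_field[OF G.subgroup_self] fixed by simp

text \<open>Here the identity of \<open>M\<close> is separated from the automorphisms that move an element of \<open>M\<close>;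
  on those that fix \<open>M\<close> the sum has the same value as on the identity.\<close>

lemma separating_coordinates:
  assumes "subring M E" "F \<subseteq> M"
  obtains xs where "set xs \<subseteq> carrier E \<times> M"
    "\<And>\<gamma>. \<gamma> \<in> \<Gamma> \<Longrightarrow>
      lsum E (\<lambda>(a, b). a \<otimes> \<gamma> b) xs = (if \<gamma> \<in> carrier (gal E M) then \<one> else \<zero>)"
proof -
  have sub: "M \<subseteq> carrier E" using subringE(1)[OF assms(1)] .
  let ?\<Phi> = "\<Gamma> - carrier (gal E M)"
  have "\<exists>xs. set xs \<subseteq> carrier E \<times> M \<and> lsum E (\<lambda>(a, b). a \<otimes> id b) xs = \<one> \<and>
    (\<forall>\<phi>\<in>?\<Phi>. lsum E (\<lambda>(a, b). a \<otimes> \<phi> b) xs = \<zero>)"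
  proof (rule homs_separated[OF field_axioms assms(1)])
    show "finite ?\<Phi>" using finite_gal by auto
    show "id \<in> ring_hom (E\<lparr>carrier := M\<rparr>) E"
      using sub by (auto intro!: ring_hom_memI)
    fix \<phi> assume phi: "\<phi> \<in> ?\<Phi>"
    then show "\<phi> \<in> ring_hom (E\<lparr>carrier := M\<rparr>) E"
      using sub by (auto intro!: ring_hom_memI simp: gal_props subset_iff)
    show "\<exists>z\<in>M. \<phi> z \<noteq> id z"
      using phi by (auto simp: gal_mem_iff)
  qed
  then obtain xs where xs: "set xs \<subseteq> carrier E \<times> M" "lsum E (\<lambda>(a, b). a \<otimes> b) xs = \<one>"
    "\<And>\<phi>. \<phi> \<in> ?\<Phi> \<Longrightarrow> lsum E (\<lambda>(a, b). a \<otimes> \<phi> b) xs = \<zero>"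
    by auto
  have "lsum E (\<lambda>(a, b). a \<otimes> \<gamma> b) xs = (if \<gamma> \<in> carrier (gal E M) then \<one> else \<zero>)"
    if "\<gamma> \<in> \<Gamma>" for \<gamma>
  proof (cases "\<gamma> \<in> carrier (gal E M)")
    case True
    then have "lsum E (\<lambda>(a, b). a \<otimes> \<gamma> b) xs = lsum E (\<lambda>(a, b). a \<otimes> b) xs"
      using xs(1) by (intro lsum_cong) (auto simp: gal_fixes[OF ring_axioms True])
    then show ?thesis using True xs by simp
  qed (use xs that in auto)
  then show ?thesis using xs(1) that by blast
qed

lemma gal_over_top: "\<gamma> \<in> carrier (gal E (carrier E)) \<longleftrightarrow> \<gamma> = \<one>\<^bsub>gal E F\<^esub>"
proof
  assume g: "\<gamma> \<in> carrier (gal E (carrier E))"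
  show "\<gamma> = \<one>\<^bsub>gal E F\<^esub>"
    by (rule gal_eqI[OF g G.one_closed]) (use g in \<open>auto simp: gal_mem_iff gal_id_apply\<close>)
next
  assume "\<gamma> = \<one>\<^bsub>gal E F\<^esub>"
  then show "\<gamma> \<in> carrier (gal E (carrier E))"
    using G.one_closed by (auto simp: gal_mem_iff gal_id_apply)
qed

lemma galois_coordinates:
  obtains xs where "set xs \<subseteq> carrier E \<times> carrier E"
    "\<And>\<gamma>. \<gamma> \<in> \<Gamma> \<Longrightarrow>
      lsum E (\<lambda>(a, b). a \<otimes> \<gamma> b) xs = (if \<gamma> = \<one>\<^bsub>gal E F\<^esub> then \<one> else \<zero>)"
proof -
  obtain xs where "set xs \<subseteq> carrier E \<times> carrier E"
    "\<And>\<gamma>. \<gamma> \<in> \<Gamma> \<Longrightarrow>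
      lsum E (\<lambda>(a, b). a \<otimes> \<gamma> b) xs = (if \<gamma> \<in> carrier (gal E (carrier E)) then \<one> else \<zero>)"
    using separating_coordinates[OF carrier_is_subring F_sub] by blast
  then show ?thesis using that unfolding gal_over_top by blast
qed

text \<open>Replacing the \<open>b\<^sub>i\<close> by their traces sums the defining relation over a coset of \<open>D\<close>, which
  meets the identity exactly if \<open>\<gamma> \<in> D\<close>.  The new \<open>b\<^sub>i\<close> lie in the fixed field of \<open>D\<close>.\<close>

lemma coordinates_trace:
  assumes "subgroup D (gal E F)" "\<gamma> \<in> \<Gamma>"
    and xs: "set xs \<subseteq> carrier E \<times> carrier E"
    and d: "\<And>\<gamma>. \<gamma> \<in> \<Gamma> \<Longrightarrow>
      lsum E (\<lambda>(a, b). a \<otimes> \<gamma> b) xs = (if \<gamma> = \<one>\<^bsub>gal E F\<^esub> then \<one> else \<zero>)"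
  shows "lsum E (\<lambda>(a, b). a \<otimes> \<gamma> (trace D b)) xs = (if \<gamma> \<in> D then \<one> else \<zero>)"
proof -
  interpret D: subgroup D "gal E F" by fact
  have fin: "finite D" using D.subset finite_gal by (rule finite_subset)
  have cp: "fst p \<in> carrier E" "snd p \<in> carrier E" if "p \<in> set xs" for p
    using that xs by auto
  note D.mem_carrier[simp]
  have "lsum E (\<lambda>(a, b). a \<otimes> \<gamma> (trace D b)) xs
      = lsum E (\<lambda>p. \<Oplus>\<sigma>\<in>D. fst p \<otimes> (\<gamma> \<otimes>\<^bsub>gal E F\<^esub> \<sigma>) (snd p)) xs"
    using assms(2) fin unfolding case_prod_unfold trace_def
    by (intro lsum_cong) (simp add: cp gal_props gal_finsum[OF ring_axioms assms(2)] finsum_mult_left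
      cong: finsum_cong_fun)
  also have "\<dots> = (\<Oplus>\<sigma>\<in>D. lsum E (\<lambda>p. fst p \<otimes> (\<gamma> \<otimes>\<^bsub>gal E F\<^esub> \<sigma>) (snd p)) xs)"
    using fin assms(2) by (intro lsum_finsum_swap) (simp_all add: cp gal_props)
  also have "\<dots> = (\<Oplus>\<sigma>\<in>D. if inv\<^bsub>gal E F\<^esub> \<gamma> = \<sigma> then \<one> else \<zero>)"
  proof (rule finsum_cong_fun)
    fix \<sigma> assume s: "\<sigma> \<in> D"
    have "\<gamma> \<otimes>\<^bsub>gal E F\<^esub> \<sigma> = \<one>\<^bsub>gal E F\<^esub> \<longleftrightarrow> inv\<^bsub>gal E F\<^esub> \<gamma> = \<sigma>"
      using G.inv_solve_left[of \<sigma> \<gamma> "\<one>\<^bsub>gal E F\<^esub>"] D.mem_carrier[OF s] assms(2) by auto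
    then show "lsum E (\<lambda>p. fst p \<otimes> (\<gamma> \<otimes>\<^bsub>gal E F\<^esub> \<sigma>) (snd p)) xs = (if inv\<^bsub>gal E F\<^esub> \<gamma> = \<sigma> then \<one> else \<zero>)"
      using d[of "\<gamma> \<otimes>\<^bsub>gal E F\<^esub> \<sigma>"] s assms(2) by (simp add: case_prod_unfold)
  qed
  also have "\<dots> = (if \<gamma> \<in> D then \<one> else \<zero>)"
  proof (cases "\<gamma> \<in> D")
    case True
    then show ?thesis using finsum_delta[of D "inv\<^bsub>gal E F\<^esub> \<gamma>" "\<lambda>_. \<one>"] fin by simp
  next
    case False
    then have "inv\<^bsub>gal E F\<^esub> \<gamma> \<notin> D"
      using D.m_inv_closed[of "inv\<^bsub>gal E F\<^esub> \<gamma>"] assms(2) by auto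
    then show ?thesis using False by (auto intro!: finsum_zero_fun)
  qed
  finally show ?thesis .
qed

text \<open>If the trace vanished on all \<open>b\<^sub>i\<close>, so would the sum in \<open>coordinates_trace\<close>, which is \<open>1\<close> at
  the identity.  Scaling by the trace of a suitable \<open>b\<^sub>i\<close>, a \<open>D\<close>-fixed element, gives \<open>t\<close>.  Dividing
  \<open>1\<close> by the order of \<open>D\<close> instead would fail in bad characteristic.\<close>

lemma trace_one_exists:
  assumes "subgroup D (gal E F)"
  obtains t where "t \<in> carrier E" "trace D t = \<one>"
proof -
  interpret D: subgroup D "gal E F" by fact
  obtain xs where xs: "set xs \<subseteq> carrier E \<times> carrier E"
    "\<And>\<gamma>. \<gamma> \<in> \<Gamma> \<Longrightarrow>
      lsum E (\<lambda>(a, b). a \<otimes> \<gamma> b) xs = (if \<gamma> = \<one>\<^bsub>gal E F\<^esub> then \<one> else \<zero>)"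
    using galois_coordinates by blast
  have "lsum E (\<lambda>(a, b). a \<otimes> \<one>\<^bsub>gal E F\<^esub> (trace D b)) xs = \<one>"
    using coordinates_trace[OF assms G.one_closed xs] by simp
  moreover have "lsum E (\<lambda>(a, b). a \<otimes> \<one>\<^bsub>gal E F\<^esub> (trace D b)) xs = \<zero>"
    if "\<forall>(a, b)\<in>set xs. trace D b = \<zero>"
    using that xs(1) by (intro lsum_zero) (force simp: gal_id_apply)
  ultimately obtain a b where ab: "(a, b) \<in> set xs" "trace D b \<noteq> \<zero>"
    by fastforce
  then have b: "b \<in> carrier E" "trace D b \<noteq> \<zero>" using xs(1) by auto
  define s where "s = trace D b"
  have s: "s \<in> carrier E" "s \<noteq> \<zero>"
    using b trace_closed[OF D.subset] by (auto simp: s_def)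
  then have inv: "inv s \<in> carrier E" "inv s \<otimes> s = \<one>"
    using field_Units by auto
  have fx: "\<sigma> (inv s) = inv s" if "\<sigma> \<in> D" for \<sigma>
  proof -
    have \<sigma>: "\<sigma> \<in> \<Gamma>" using that by (rule D.mem_carrier)
    have "\<sigma> s = s" using gal_trace[OF assms that b(1)] by (simp add: s_def)
    moreover have "\<sigma> (s \<otimes> inv s) = \<sigma> s \<otimes> \<sigma> (inv s)"
      using gal_props(3)[OF \<sigma> s(1) inv(1)] .
    moreover have "s \<otimes> inv s = \<one>" using inv s m_comm by simp
    ultimately have "s \<otimes> \<sigma> (inv s) = \<one>" using \<sigma> by (simp add: gal_props)
    then show ?thesis
      using comm_inv_char[OF s(1) gal_props(1)[OF \<sigma> inv(1)]] by simp
  qed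
  have "trace D (inv s \<otimes> b) = (\<Oplus>\<sigma>\<in>D. inv s \<otimes> \<sigma> b)"
    unfolding trace_def by (intro finsum_cong_fun) (simp only: gal_props(3)[OF D.mem_carrier inv(1) b(1)] fx)
  also have "\<dots> = inv s \<otimes> s"
    unfolding s_def trace_def using inv(1)[unfolded s_def trace_def] b finite_subset[OF D.subset finite_gal]
    by (intro finsum_mult_left[symmetric]) (simp_all add: gal_props D.mem_carrier)
  finally show ?thesis using that[of "inv s \<otimes> b"] inv b by simp
qed

text \<open>Artin's theorem.  The traces in \<open>coordinates_trace\<close> are fixed by \<open>Gal(E/E\<^sup>D)\<close>, so every
  element of this group gives the sum there the value \<open>1\<close>, which only elements of \<open>D\<close> do.\<close>

lemma gal_fixed_field:
  assumes "subgroup D (gal E F)"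
  shows "carrier (gal E (fixed_field E D)) = D"
proof
  interpret D: subgroup D "gal E F" by fact
  show "D \<subseteq> carrier (gal E (fixed_field E D))"
    using D.subset by (auto simp: gal_mem_iff fixed_field_def)
  have "F \<subseteq> fixed_field E D"
    using F_sub D.subset by (auto simp: fixed_field_def gal_mem_iff)
  then have sub: "carrier (gal E (fixed_field E D)) \<subseteq> \<Gamma>" by (rule gal_mono)
  show "carrier (gal E (fixed_field E D)) \<subseteq> D"
  proof
    fix \<gamma> assume g: "\<gamma> \<in> carrier (gal E (fixed_field E D))"
    then have g': "\<gamma> \<in> \<Gamma>" using sub by auto
    obtain xs where xs: "set xs \<subseteq> carrier E \<times> carrier E"
      "\<And>\<gamma>. \<gamma> \<in> \<Gamma> \<Longrightarrow>
        lsum E (\<lambda>(a, b). a \<otimes> \<gamma> b) xs = (if \<gamma> = \<one>\<^bsub>gal E F\<^esub> then \<one> else \<zero>)"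
      using galois_coordinates by blast
    have "lsum E (\<lambda>(a, b). a \<otimes> \<gamma> (trace D b)) xs = lsum E (\<lambda>(a, b). a \<otimes> \<one>\<^bsub>gal E F\<^esub> (trace D b)) xs"
      using xs(1) trace_in_fixed_field[OF assms] trace_closed[OF D.subset]
      by (intro lsum_cong) (auto simp: gal_id_apply gal_fixes[OF ring_axioms g])
    then show "\<gamma> \<in> D"
      using coordinates_trace[OF assms g' xs] coordinates_trace[OF assms G.one_closed xs]
      by (auto split: if_splits)
  qed
qed

text \<open>The relation at \<open>\<gamma>\<inverse>\<tau>\<close>, after an application of \<open>\<gamma>\<close>.\<close>

lemma coordinates_sum_shift:
  assumes \<gamma>: "\<gamma> \<in> \<Gamma>" and \<tau>: "\<tau> \<in> \<Gamma>"
    and xs: "set xs \<subseteq> carrier E \<times> carrier E"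
    and d: "\<And>\<gamma>. \<gamma> \<in> \<Gamma> \<Longrightarrow>
      lsum E (\<lambda>(a, b). a \<otimes> \<gamma> b) xs = (if \<gamma> \<in> D then \<one> else \<zero>)"
  shows "lsum E (\<lambda>(a, b). \<gamma> a \<otimes> \<tau> b) xs = (if inv\<^bsub>gal E F\<^esub> \<gamma> \<otimes>\<^bsub>gal E F\<^esub> \<tau> \<in> D then \<one> else \<zero>)"
proof -
  let ?\<delta> = "inv\<^bsub>gal E F\<^esub> \<gamma> \<otimes>\<^bsub>gal E F\<^esub> \<tau>"
  have D: "?\<delta> \<in> \<Gamma>" using \<gamma> \<tau> by simp
  have "\<gamma> (lsum E (\<lambda>(a, b). a \<otimes> ?\<delta> b) xs) = lsum E (\<lambda>(a, b). \<gamma> (a \<otimes> ?\<delta> b)) xs"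
    unfolding case_prod_unfold
    using xs by (intro gal_lsum[OF ring_axioms \<gamma>]) (auto simp: gal_props(1)[OF D])
  also have "\<dots> = lsum E (\<lambda>(a, b). \<gamma> a \<otimes> \<tau> b) xs"
  proof (rule lsum_cong, clarify)
    fix a b assume "(a, b) \<in> set xs"
    then have "a \<in> carrier E" "b \<in> carrier E" using xs by auto
    then show "\<gamma> (a \<otimes> ?\<delta> b) = \<gamma> a \<otimes> \<tau> b"
      using \<gamma> \<tau> by (simp add: gal_props)
  qed
  finally show ?thesis using d[OF D] gal_one[OF ring_axioms \<gamma>] gal_zero[OF ring_axioms \<gamma>] by (auto split: if_splits)
qed

text \<open>For \<open>B = \<Gamma>\<close> and \<open>\<gamma> = 1\<close> this expands the trace of \<open>z\<close> over \<open>D\<close> along the \<open>b\<^sub>i\<close> with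
  coefficients in \<open>F\<close>; for \<open>B = D\<close> and \<open>z\<close> of trace \<open>1\<close> it says that the coordinates stay
  separating when the \<open>a\<^sub>i\<close> are averaged over \<open>D\<close>.\<close>

lemma trace_coordinates:
  assumes B: "subgroup B (gal E F)" and z: "z \<in> carrier E" and \<gamma>: "\<gamma> \<in> \<Gamma>"
    and xs: "set xs \<subseteq> carrier E \<times> carrier E"
    and d: "\<And>\<gamma>. \<gamma> \<in> \<Gamma> \<Longrightarrow>
      lsum E (\<lambda>(a, b). a \<otimes> \<gamma> b) xs = (if \<gamma> \<in> D then \<one> else \<zero>)"
  shows "lsum E (\<lambda>(a, b). trace B (z \<otimes> a) \<otimes> \<gamma> b) xs
    = (\<Oplus>\<sigma>\<in>B. if inv\<^bsub>gal E F\<^esub> \<sigma> \<otimes>\<^bsub>gal E F\<^esub> \<gamma> \<in> D then \<sigma> z else \<zero>)"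
proof -
  interpret B: subgroup B "gal E F" by fact
  have fin: "finite B" using B.subset finite_gal by (rule finite_subset)
  have xp: "fst p \<in> carrier E" "snd p \<in> carrier E" if "p \<in> set xs" for p using xs that by auto
  note cl = xp fin z \<gamma> gal_props B.mem_carrier
  have "lsum E (\<lambda>(a, b). trace B (z \<otimes> a) \<otimes> \<gamma> b) xs
      = lsum E (\<lambda>p. \<Oplus>\<sigma>\<in>B. \<sigma> z \<otimes> (\<sigma> (fst p) \<otimes> \<gamma> (snd p))) xs"
    unfolding case_prod_unfold trace_def
    by (rule lsum_cong, subst finsum_mult_right) (simp_all add: cl m_assoc cong: finsum_cong_fun)
  also have "\<dots> = (\<Oplus>\<sigma>\<in>B. \<sigma> z \<otimes> lsum E (\<lambda>p. \<sigma> (fst p) \<otimes> \<gamma> (snd p)) xs)"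
    by (simp add: cl lsum_finsum_swap lsum_mult_left cong: finsum_cong_fun)
  also have "\<dots> = (\<Oplus>\<sigma>\<in>B. if inv\<^bsub>gal E F\<^esub> \<sigma> \<otimes>\<^bsub>gal E F\<^esub> \<gamma> \<in> D then \<sigma> z else \<zero>)"
    using coordinates_sum_shift[OF B.mem_carrier \<gamma> xs d]
    by (intro finsum_cong_fun) (simp add: cl case_prod_unfold)
  finally show ?thesis .
qed

lemma trace_expansion:
  assumes D: "subgroup D (gal E F)" and z: "z \<in> carrier E"
    and xs: "set xs \<subseteq> carrier E \<times> carrier E"
    and d: "\<And>\<gamma>. \<gamma> \<in> \<Gamma> \<Longrightarrow>
      lsum E (\<lambda>(a, b). a \<otimes> \<gamma> b) xs = (if \<gamma> \<in> D then \<one> else \<zero>)"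
  shows "lsum E (\<lambda>(a, b). trace (\<Gamma>) (z \<otimes> a) \<otimes> b) xs = trace D z"
proof -
  interpret D: subgroup D "gal E F" by fact
  have "lsum E (\<lambda>(a, b). trace (\<Gamma>) (z \<otimes> a) \<otimes> b) xs
      = lsum E (\<lambda>(a, b). trace (\<Gamma>) (z \<otimes> a) \<otimes> \<one>\<^bsub>gal E F\<^esub> b) xs"
    using xs by (intro lsum_cong) (auto simp: gal_id_apply)
  also have "\<dots> = (\<Oplus>\<sigma>\<in>\<Gamma>.
      if inv\<^bsub>gal E F\<^esub> \<sigma> \<otimes>\<^bsub>gal E F\<^esub> \<one>\<^bsub>gal E F\<^esub> \<in> D then \<sigma> z else \<zero>)"
    by (rule trace_coordinates[OF G.subgroup_self z G.one_closed xs d])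
  also have "\<dots> = (\<Oplus>\<sigma>\<in>\<Gamma>. if \<sigma> \<in> D then \<sigma> z else \<zero>)"
    using D.m_inv_closed by (intro finsum_cong_fun) (metis G.inv_inv G.inv_closed G.r_one)
  also have "\<dots> = trace D z"
    unfolding trace_def using finite_gal D.subset z
    by (intro finsum_if_subset) (simp_all add: gal_props D.mem_carrier)
  finally show ?thesis .
qed

lemma subgroup_gal: "F \<subseteq> M \<Longrightarrow> M \<subseteq> carrier E \<Longrightarrow> subgroup (carrier (gal E M)) (gal E F)"
  by (rule gal_subgroup_gal[OF field_axioms])

text \<open>If \<open>w\<close> is fixed by \<open>\<Delta> = Gal(E/M)\<close>, take separating coordinates \<open>(a\<^sub>i, b\<^sub>i)\<close> with \<open>b\<^sub>i \<in> M\<close>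
  and an element \<open>t\<close> of \<open>\<Delta>\<close>-trace \<open>1\<close>.  Then \<open>w\<close>, being the \<open>\<Delta>\<close>-trace of \<open>w t\<close>, is
  \<open>\<Sum> Tr(w t a\<^sub>i) b\<^sub>i\<close>, and here the coefficients are in \<open>F\<close>.\<close>

lemma fixed_field_gal:
  assumes "subring M E" "F \<subseteq> M"
  shows "fixed_field E (carrier (gal E M)) = M"
proof
  have M_sub: "M \<subseteq> carrier E" using subringE(1)[OF assms(1)] .
  then show "M \<subseteq> fixed_field E (carrier (gal E M))"
    by (auto simp: fixed_field_def gal_mem_iff)
  note sg = subgroup_gal[OF assms(2) M_sub]
  interpret D: subgroup "carrier (gal E M)" "gal E F" by (rule sg)
  show "fixed_field E (carrier (gal E M)) \<subseteq> M"
  proof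
    fix w assume w: "w \<in> fixed_field E (carrier (gal E M))"
    then have wE: "w \<in> carrier E" by (simp add: fixed_field_def)
    obtain xs where xs: "set xs \<subseteq> carrier E \<times> M"
      "\<And>\<gamma>. \<gamma> \<in> \<Gamma> \<Longrightarrow> lsum E (\<lambda>(a, b). a \<otimes> \<gamma> b) xs = (if \<gamma> \<in> carrier (gal E M) then \<one> else \<zero>)"
      using separating_coordinates[OF assms] by blast
    have xsE: "set xs \<subseteq> carrier E \<times> carrier E" using xs(1) M_sub by auto
    obtain t where t: "t \<in> carrier E" "trace (carrier (gal E M)) t = \<one>"
      using trace_one_exists[OF sg] by blast
    have "trace (carrier (gal E M)) (w \<otimes> t) = (\<Oplus>\<sigma>\<in>carrier (gal E M). w \<otimes> \<sigma> t)"
      unfolding trace_def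
    proof (rule finsum_cong_fun)
      fix \<sigma> assume s: "\<sigma> \<in> carrier (gal E M)"
      then have "\<sigma> w = w" using w by (auto simp: fixed_field_def)
      then show "\<sigma> (w \<otimes> t) = w \<otimes> \<sigma> t" using gal_props(3)[OF D.mem_carrier[OF s] wE t(1)] by simp
    qed
    also have "\<dots> = w \<otimes> trace (carrier (gal E M)) t"
      unfolding trace_def using wE t finite_subset[OF D.subset finite_gal]
      by (intro finsum_mult_left[symmetric]) (simp_all add: gal_props D.mem_carrier)
    finally have eq: "lsum E (\<lambda>(a, b). trace \<Gamma> (w \<otimes> t \<otimes> a) \<otimes> b) xs = w"
      using trace_expansion[OF sg _ xsE xs(2), of "w \<otimes> t"] wE t by simp
    interpret M: ring "E\<lparr>carrier := M\<rparr>" by (rule subring_is_ring[OF assms(1)])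
    have "lsum (E\<lparr>carrier := M\<rparr>) (\<lambda>(a, b). trace \<Gamma> (w \<otimes> t \<otimes> a) \<otimes> b) xs \<in> carrier (E\<lparr>carrier := M\<rparr>)"
    proof (rule M.lsum_closed, clarify)
      fix a b assume "(a, b) \<in> set xs"
      then have "a \<in> carrier E" "b \<in> M" using xs(1) by auto
      then show "trace \<Gamma> (w \<otimes> t \<otimes> a) \<otimes> b \<in> carrier (E\<lparr>carrier := M\<rparr>)"
        using trace_total_in_F[of "w \<otimes> t \<otimes> a"] assms(2) wE t subringE(6)[OF assms(1)] by auto
    qed
    then show "w \<in> M" using eq by simp
  qed
qed

lemma galois_intermediate:
  assumes "subfield M E" "F \<subseteq> M"
  shows "galois E M"
proof (intro galois.intro galois_axioms.intro)
  show "field E" by (rule field_axioms)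
  show "subfield M E" by fact
  show "finite (carrier (gal E M))"
    using finite_subset[OF gal_mono[OF assms(2)] finite_gal] .
  show "fixed_field E (carrier (gal E M)) = M"
    using fixed_field_gal[OF subfieldE(1)[OF assms(1)] assms(2)] .
qed

text \<open>Averaging the first entries of separating coordinates over \<open>Gal(E/M)\<close>, with a weight \<open>t\<close> of
  trace \<open>1\<close>, moves them into \<open>M\<close> as well.\<close>

lemma intermediate_coordinates:
  assumes "subring M E" "F \<subseteq> M"
  obtains xs where "set xs \<subseteq> M \<times> M"
    "\<And>\<gamma>. \<gamma> \<in> \<Gamma> \<Longrightarrow>
      lsum E (\<lambda>(a, b). a \<otimes> \<gamma> b) xs = (if \<gamma> \<in> carrier (gal E M) then \<one> else \<zero>)"
proof -
  have M_sub: "M \<subseteq> carrier E" using subringE(1)[OF assms(1)] .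
  note sg = subgroup_gal[OF assms(2) M_sub]
  interpret D: subgroup "carrier (gal E M)" "gal E F" by (rule sg)
  let ?D = "carrier (gal E M)"
  obtain xs where xs: "set xs \<subseteq> carrier E \<times> M"
    "\<And>\<gamma>. \<gamma> \<in> \<Gamma> \<Longrightarrow> lsum E (\<lambda>(a, b). a \<otimes> \<gamma> b) xs = (if \<gamma> \<in> ?D then \<one> else \<zero>)"
    using separating_coordinates[OF assms] by blast
  have xsE: "set xs \<subseteq> carrier E \<times> carrier E" using xs(1) M_sub by auto
  obtain t where t: "t \<in> carrier E" "trace ?D t = \<one>"
    using trace_one_exists[OF sg] by blast
  define ys where "ys = map (\<lambda>(a, b). (trace ?D (t \<otimes> a), b)) xs"
  have ys: "set ys \<subseteq> M \<times> M"
    using xs(1) t trace_in_fixed_field[OF sg] fixed_field_gal[OF assms] by (force simp: ys_def)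
  moreover have "lsum E (\<lambda>(a, b). a \<otimes> \<gamma> b) ys = (if \<gamma> \<in> ?D then \<one> else \<zero>)"
    if \<gamma>: "\<gamma> \<in> \<Gamma>" for \<gamma>
  proof -
    have "lsum E (\<lambda>(a, b). a \<otimes> \<gamma> b) ys = lsum E (\<lambda>(a, b). trace ?D (t \<otimes> a) \<otimes> \<gamma> b) xs"
      by (simp add: ys_def lsum_map case_prod_unfold)
    also have "\<dots> = (\<Oplus>\<sigma>\<in>?D. if inv\<^bsub>gal E F\<^esub> \<sigma> \<otimes>\<^bsub>gal E F\<^esub> \<gamma> \<in> ?D then \<sigma> t else \<zero>)"
      by (rule trace_coordinates[OF sg t(1) \<gamma> xsE xs(2)])
    also have "\<dots> = (\<Oplus>\<sigma>\<in>?D. if \<gamma> \<in> ?D then \<sigma> t else \<zero>)"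
    proof (rule finsum_cong_fun)
      fix \<sigma> assume s: "\<sigma> \<in> ?D"
      have "inv\<^bsub>gal E F\<^esub> \<sigma> \<otimes>\<^bsub>gal E F\<^esub> \<gamma> \<in> ?D \<longleftrightarrow> \<gamma> \<in> ?D"
      proof
        assume "inv\<^bsub>gal E F\<^esub> \<sigma> \<otimes>\<^bsub>gal E F\<^esub> \<gamma> \<in> ?D"
        from D.m_closed[OF s this] show "\<gamma> \<in> ?D"
          using D.mem_carrier[OF s] \<gamma> by (simp flip: G.m_assoc)
      qed (use s in \<open>intro D.m_closed D.m_inv_closed\<close>)
      then show "(if inv\<^bsub>gal E F\<^esub> \<sigma> \<otimes>\<^bsub>gal E F\<^esub> \<gamma> \<in> ?D then \<sigma> t else \<zero>) = (if \<gamma> \<in> ?D then \<sigma> t else \<zero>)"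
        by simp
    qed
    also have "\<dots> = (if \<gamma> \<in> ?D then trace ?D t else \<zero>)"
      by (simp add: trace_def finsum_zero_fun)
    finally show ?thesis using t by simp
  qed
  ultimately show ?thesis using that by blast
qed

end

section \<open>Finiteness, restriction and Galois closures\<close>

text \<open>Automorphisms permute the roots of polynomials with fixed coefficients.\<close>

lemma eval_gal:
  fixes E (structure)
  assumes "field E" "F \<subseteq> carrier E" "\<sigma> \<in> carrier (gal E F)" "set p \<subseteq> F" "x \<in> carrier E"
  shows "ring.eval E p (\<sigma> x) = \<sigma> (ring.eval E p x)"
  using assms(4)
proof -
  interpret field E by fact
  note s = gal_closed[OF ring_axioms assms(3)] gal_add[OF ring_axioms assms(3)]
    gal_mult[OF ring_axioms assms(3)] gal_zero[OF ring_axioms assms(3)] gal_one[OF ring_axioms assms(3)]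
  have pow: "\<sigma> x [^] (n::nat) = \<sigma> (x [^] n)" for n
    using assms(5) by (induction n) (auto simp: s)
  show ?thesis using assms(4)
  proof (induction p)
    case (Cons a p)
    then have "a \<in> F" "a \<in> carrier E" "set p \<subseteq> carrier E" using assms(2) by auto
    then show ?case
      using Cons assms(5) gal_fixes[OF ring_axioms assms(3), of a]
      by (simp add: s pow eval_in_carrier)
  qed (simp add: s)
qed

text \<open>An automorphism is determined by the images of finitely many generators, and each of
  these is a root of a fixed polynomial.\<close>

lemma finite_galois_imp_galois:
  assumes "finite_galois E F"
  shows "galois E F"
proof -
  interpret field E using assms by (simp add: finite_galois_def)
  have sf: "subfield F E" and fd: "finite_dimension F (carrier E)"
    and fx: "fixed_field E (carrier (gal E F)) = F"
    using assms by (auto simp: finite_galois_def)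
  have F: "F \<subseteq> carrier E" using subfieldE(3)[OF sf] .
  obtain n where "dimension n F (carrier E)" using fd by blast
  then obtain Us where Us: "set Us \<subseteq> carrier E" "Span F Us = carrier E"
    using exists_base[OF sf] by blast
  have "\<exists>p. p \<in> carrier (F [X]\<^bsub>E\<^esub>) \<and> p \<noteq> [] \<and> eval p u = \<zero>\<^bsub>E\<^esub>" if "u \<in> set Us" for u
  proof -
    have "u \<in> carrier E" using that Us by auto
    moreover have "(algebraic over F) u"
      using finite_dimension_imp_algebraic[OF sf carrier_is_subring fd] calculation by simp
    ultimately show ?thesis using algebraicE[OF subfieldE(1)[OF sf]] by metis
  qed
  then obtain p where p: "\<And>u. u \<in> set Us \<Longrightarrow> p u \<in> carrier (F [X]\<^bsub>E\<^esub>) \<and> p u \<noteq> [] \<and> eval (p u) u = \<zero>\<^bsub>E\<^esub>"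
    by metis
  let ?f = "\<lambda>\<sigma>. restrict \<sigma> (set Us)"
  have "finite (carrier (gal E F))"
  proof (rule inj_on_finite)
    show "inj_on ?f (carrier (gal E F))"
    proof (rule inj_onI)
      fix \<sigma> \<tau> assume st: "\<sigma> \<in> carrier (gal E F)" "\<tau> \<in> carrier (gal E F)" and eq: "?f \<sigma> = ?f \<tau>"
      note s = gal_closed[OF ring_axioms st(1)] gal_add[OF ring_axioms st(1)]
        gal_mult[OF ring_axioms st(1)] gal_zero[OF ring_axioms st(1)] gal_minus[OF ring_axioms st(1)]
        gal_fixes[OF ring_axioms st(1)]
      note t = gal_closed[OF ring_axioms st(2)] gal_add[OF ring_axioms st(2)]
        gal_mult[OF ring_axioms st(2)] gal_zero[OF ring_axioms st(2)] gal_minus[OF ring_axioms st(2)]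
        gal_fixes[OF ring_axioms st(2)]
      let ?V = "{x \<in> carrier E. \<sigma> x = \<tau> x}"
      have "subalgebra F ?V E"
      proof (intro subalgebra.intro subalgebra_axioms.intro)
        show "subgroup ?V (add_monoid E)"
          using s t by (intro add.subgroupI) (auto simp: a_inv_def[symmetric])
        show "k \<otimes>\<^bsub>E\<^esub> v \<in> ?V" if "k \<in> F" "v \<in> ?V" for k v
          using that s t F by auto
      qed
      moreover have "set Us \<subseteq> ?V"
      proof
        fix u assume "u \<in> set Us"
        then show "u \<in> ?V" using fun_cong[OF eq, of u] Us by auto
      qed
      ultimately have "Span F Us \<subseteq> ?V" by (rule subalgebra_Span_incl[OF sf])
      then show "\<sigma> = \<tau>" using st Us by (intro gal_eqI) auto
    qed
    show "?f ` carrier (gal E F) \<subseteq> (\<Pi>\<^sub>E u\<in>set Us. {x. is_root (p u) x})"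
    proof clarify
      fix \<sigma> assume s: "\<sigma> \<in> carrier (gal E F)"
      show "?f \<sigma> \<in> (\<Pi>\<^sub>E u\<in>set Us. {x. is_root (p u) x})"
      proof
        fix u assume u: "u \<in> set Us"
        then have "u \<in> carrier E" "set (p u) \<subseteq> F"
          using Us p[OF u] polynomial_incl by (auto simp: univ_poly_carrier[symmetric])
        then show "?f \<sigma> u \<in> {x. is_root (p u) x}"
          using u p[OF u] eval_gal[OF field_axioms F s, of "p u" u]
            gal_zero[OF ring_axioms s] gal_closed[OF ring_axioms s]
          by (simp add: is_root_def)
      qed auto
    qed
    have "finite {x. is_root (p u) x}" if "u \<in> set Us" for u
    proof (rule finite_number_of_roots)
      show "p u \<in> carrier (poly_ring E)"
        using p[OF that] carrier_polynomial[OF subfieldE(1)[OF sf]]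
        by (simp add: univ_poly_carrier[symmetric])
    qed
    then show "finite (\<Pi>\<^sub>E u\<in>set Us. {x. is_root (p u) x})" by (intro finite_PiE) auto
  qed
  then show ?thesis
    using sf fx by (intro galois.intro galois_axioms.intro field_axioms)
qed

text \<open>Normality of a Galois extension \<open>M/F\<close> inside \<open>E\<close>.  If \<open>g\<close> differed on \<open>M\<close> from every
  element of \<open>Gal(M/F)\<close>, there would be \<open>a\<^sub>i\<close>, \<open>b\<^sub>i\<close> with \<open>\<Sum> a\<^sub>i g(b\<^sub>i) = 1\<close> but
  \<open>\<Sum> a\<^sub>i \<tau>(b\<^sub>i) = 0\<close> for all \<open>\<tau>\<close>; expanding each \<open>b\<^sub>i\<close> by \<open>trace_expansion\<close> expresses the
  first sum by the others, with traces from \<open>M\<close> to \<open>F\<close> as coefficients, which \<open>g\<close> does not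
  change.\<close>

lemma hom_on_galois_is_gal:
  fixes E (structure)
  assumes "field E" and M: "subfield M E" and gal: "galois (E\<lparr>carrier := M\<rparr>) F"
    and g: "g \<in> ring_hom (E\<lparr>carrier := M\<rparr>) E" and gF: "\<And>x. x \<in> F \<Longrightarrow> g x = x"
  shows "\<exists>\<tau>\<in>carrier (gal (E\<lparr>carrier := M\<rparr>) F). \<forall>x\<in>M. \<tau> x = g x"
proof (rule ccontr)
  assume "\<not> ?thesis"
  then have differ: "\<exists>z\<in>M. \<tau> z \<noteq> g z" if "\<tau> \<in> carrier (gal (E\<lparr>carrier := M\<rparr>) F)" for \<tau>
    using that by blast
  interpret field E by fact
  interpret M: galois "E\<lparr>carrier := M\<rparr>" F by fact
  let ?T = "E\<lparr>carrier := M\<rparr>"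
  let ?\<Gamma> = "carrier (gal ?T F)"
  have sub: "M \<subseteq> carrier E" using subfieldE(3)[OF M] .
  have hom: "\<tau> \<in> ring_hom ?T E" if "\<tau> \<in> ?\<Gamma>" for \<tau>
    using gal_hom[OF M.ring_axioms that] sub by (auto simp: ring_hom_def Pi_def)
  have "\<exists>xs. set xs \<subseteq> carrier E \<times> M \<and> lsum E (\<lambda>(a, b). a \<otimes> g b) xs = \<one> \<and>
    (\<forall>\<phi>\<in>?\<Gamma>. lsum E (\<lambda>(a, b). a \<otimes> \<phi> b) xs = \<zero>)"
    using M.finite_gal hom differ by (intro homs_separated field_axioms subfieldE(1)[OF M] g) auto
  then obtain xs where xs: "set xs \<subseteq> carrier E \<times> M" "lsum E (\<lambda>(a, b). a \<otimes> g b) xs = \<one>"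
    "\<And>\<phi>. \<phi> \<in> ?\<Gamma> \<Longrightarrow> lsum E (\<lambda>(a, b). a \<otimes> \<phi> b) xs = \<zero>"
    by blast
  obtain ys where ys: "set ys \<subseteq> carrier ?T \<times> carrier ?T"
    "\<And>\<gamma>. \<gamma> \<in> ?\<Gamma> \<Longrightarrow> lsum ?T (\<lambda>(a, b). a \<otimes>\<^bsub>?T\<^esub> \<gamma> b) ys = (if \<gamma> = \<one>\<^bsub>gal ?T F\<^esub> then \<one>\<^bsub>?T\<^esub> else \<zero>\<^bsub>?T\<^esub>)"
    using M.galois_coordinates by blast
  have xp: "fst p \<in> carrier E" "snd p \<in> M" if "p \<in> set xs" for p using that xs by auto
  have yp: "fst p \<in> M" "snd p \<in> M" if "p \<in> set ys" for p using that ys by auto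
  have gM: "g x \<in> carrier E" if "x \<in> M" for x using ring_hom_closed[OF g, of x] that by simp
  have gE: "\<gamma> x \<in> carrier E" "\<gamma> x \<in> M" if "\<gamma> \<in> ?\<Gamma>" "x \<in> M" for \<gamma> x
    using gal_closed[OF M.ring_axioms that(1)] that sub by auto
  have gm: "\<gamma> (x \<otimes> y) = \<gamma> x \<otimes> \<gamma> y" if "\<gamma> \<in> ?\<Gamma>" "x \<in> M" "y \<in> M" for \<gamma> x y
    using gal_mult[OF M.ring_axioms that(1)] that by simp
  have fsum: "finsum ?T f A = finsum E f A" if "finite A" "\<And>i. i \<in> A \<Longrightarrow> f i \<in> M" for f and A :: "('a \<Rightarrow> 'a) set"
    using that
  proof (induction A rule: finite_induct)
    case (insert a A)
    then have "finsum ?T f (insert a A) = f a \<oplus>\<^bsub>?T\<^esub> finsum ?T f A"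
      by (intro M.finsum_insert) auto
    moreover have "finsum E f (insert a A) = f a \<oplus> finsum E f A"
      using insert sub by (intro finsum_insert) auto
    ultimately show ?case using insert by simp
  qed simp
  have mM: "x \<otimes> y \<in> M" if "x \<in> M" "y \<in> M" for x y
    using M.m_closed[of x y] that by simp
  let ?tr = "\<lambda>b p. M.trace ?\<Gamma> (b \<otimes> fst p)"
  have tr_F: "?tr b p \<in> F" if "b \<in> M" "p \<in> set ys" for b p
    using M.trace_total_in_F[of "b \<otimes> fst p"] that yp mM by simp
  have tr_M: "?tr b p \<in> M" "?tr b p \<in> carrier E" if "b \<in> M" "p \<in> set ys" for b p
    using tr_F[OF that] M.F_sub sub by auto
  have tr_eq: "?tr b p = (\<Oplus>\<gamma>\<in>?\<Gamma>. \<gamma> (fst p) \<otimes> \<gamma> b)" if "b \<in> M" "p \<in> set ys" for b p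
    using that M.finite_gal unfolding M.trace_def
    by (simp add: fsum gE gm mM yp m_comm cong: finsum_cong_fun)
  have expand: "g b = lsum E (\<lambda>p. ?tr b p \<otimes> g (snd p)) ys" if b: "b \<in> M" for b
  proof -
    have "b = lsum ?T (\<lambda>p. ?tr b p \<otimes> snd p) ys"
      using M.trace_expansion[OF M.G.triv_subgroup, of b ys] ys b subsetD[OF sub b]
      by (simp add: M.trace_def gal_id_apply case_prod_unfold)
    moreover have "g (lsum ?T (\<lambda>p. ?tr b p \<otimes> snd p) ys) = lsum E (\<lambda>p. g (?tr b p \<otimes> snd p)) ys"
    proof (rule lsum_hom[OF M.ring_axioms ring_axioms])
      show "g \<zero>\<^bsub>?T\<^esub> = \<zero>"
        using ring_hom_zero[OF g M.ring_axioms ring_axioms] by simp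
    qed (use ring_hom_add[OF g] tr_M b yp mM in auto)
    moreover have "\<dots> = lsum E (\<lambda>p. ?tr b p \<otimes> g (snd p)) ys"
      using ring_hom_mult[OF g] tr_M b yp gF tr_F by (intro lsum_cong) simp
    ultimately show ?thesis by simp
  qed
  have "lsum E (\<lambda>(a, b). a \<otimes> g b) xs = lsum E (\<lambda>q. lsum E (\<lambda>p. fst q \<otimes> ?tr (snd q) p \<otimes> g (snd p)) ys) xs"
    unfolding case_prod_unfold
    by (rule lsum_cong, subst expand) (simp_all add: lsum_mult_left xp yp gM tr_M m_assoc cong: lsum_cong)
  also have "\<dots> = lsum E (\<lambda>p. lsum E (\<lambda>q. fst q \<otimes> ?tr (snd q) p \<otimes> g (snd p)) xs) ys"
    by (rule lsum_swap) (simp add: xp yp gM tr_M)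
  also have "\<dots> = lsum E (\<lambda>p. lsum E (\<lambda>q. fst q \<otimes> ?tr (snd q) p) xs \<otimes> g (snd p)) ys"
    by (simp add: lsum_mult_right xp yp gM tr_M cong: lsum_cong)
  also have "\<dots> = \<zero>"
  proof (rule lsum_zero)
    fix p assume p: "p \<in> set ys"
    have "lsum E (\<lambda>q. fst q \<otimes> ?tr (snd q) p) xs
        = lsum E (\<lambda>q. \<Oplus>\<gamma>\<in>?\<Gamma>. \<gamma> (fst p) \<otimes> (fst q \<otimes> \<gamma> (snd q))) xs"
      using M.finite_gal p
      by (intro lsum_cong) (simp add: tr_eq finsum_mult_left xp yp gE m_lcomm cong: finsum_cong_fun)
    also have "\<dots> = (\<Oplus>\<gamma>\<in>?\<Gamma>. \<gamma> (fst p) \<otimes> lsum E (\<lambda>q. fst q \<otimes> \<gamma> (snd q)) xs)"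
      using M.finite_gal p by (simp add: lsum_finsum_swap lsum_mult_left xp yp gE cong: finsum_cong_fun)
    also have "\<dots> = \<zero>"
      using xs(3) p by (intro finsum_zero_fun) (simp add: case_prod_unfold yp gE)
    finally show "lsum E (\<lambda>q. fst q \<otimes> ?tr (snd q) p) xs \<otimes> g (snd p) = \<zero>"
      using gM yp[OF p] by simp
  qed
  finally show False using xs(2) by simp
qed

context galois
begin

lemma gal_agree_iff:
  assumes "F \<subseteq> M" "M \<subseteq> carrier E" "\<gamma> \<in> \<Gamma>" "\<gamma>' \<in> \<Gamma>"
  shows "(\<forall>x\<in>M. \<gamma> x = \<gamma>' x) \<longleftrightarrow> inv\<^bsub>gal E F\<^esub> \<gamma> \<otimes>\<^bsub>gal E F\<^esub> \<gamma>' \<in> carrier (gal E M)"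
proof -
  have "inv\<^bsub>gal E F\<^esub> \<gamma> \<otimes>\<^bsub>gal E F\<^esub> \<gamma>' \<in> carrier (gal E M)
      \<longleftrightarrow> (\<forall>x\<in>M. (inv\<^bsub>gal E F\<^esub> \<gamma> \<otimes>\<^bsub>gal E F\<^esub> \<gamma>') x = x)"
    using G.m_closed[OF G.inv_closed[OF assms(3)] assms(4)] by (auto simp: gal_mem_iff)
  also have "\<dots> \<longleftrightarrow> (\<forall>x\<in>M. \<gamma> x = \<gamma>' x)"
  proof (rule ball_cong[OF refl])
    fix x assume "x \<in> M"
    then have x: "x \<in> carrier E" using assms(2) by auto
    have "\<gamma> ((inv\<^bsub>gal E F\<^esub> \<gamma>) (\<gamma>' x)) = \<gamma>' x" "(inv\<^bsub>gal E F\<^esub> \<gamma>) (\<gamma> x) = x"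
      using x assms(3,4) by (simp_all add: gal_props)
    then show "(inv\<^bsub>gal E F\<^esub> \<gamma> \<otimes>\<^bsub>gal E F\<^esub> \<gamma>') x = x \<longleftrightarrow> \<gamma> x = \<gamma>' x"
      using x assms(3,4) by (auto simp: gal_comp_apply)
  qed
  finally show ?thesis by simp
qed

lemma gal_coset_eq_iff:
  assumes M: "F \<subseteq> M" "M \<subseteq> carrier E"
    and g: "\<gamma> \<in> \<Gamma>" "\<gamma>' \<in> \<Gamma>"
  shows "\<gamma> <#\<^bsub>gal E F\<^esub> carrier (gal E M) = \<gamma>' <#\<^bsub>gal E F\<^esub> carrier (gal E M) \<longleftrightarrow> (\<forall>x\<in>M. \<gamma> x = \<gamma>' x)"
  unfolding gal_agree_iff[OF assms]
  using G.lcos_self[OF g(2) subgroup_gal[OF M]] G.l_repr_independence[OF _ g(1) subgroup_gal[OF M], of \<gamma>']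
    subgroup.lcos_module_imp[OF subgroup_gal[OF M] G.group_axioms g(1), of \<gamma>']
    subgroup.lcos_module_rev[OF subgroup_gal[OF M] G.group_axioms g] by auto

lemma coset_app_gal_coset:
  assumes "F \<subseteq> M" "M \<subseteq> carrier E" "\<gamma> \<in> \<Gamma>" "x \<in> M"
  shows "coset_app (\<gamma> <#\<^bsub>gal E F\<^esub> carrier (gal E M)) x = \<gamma> x"
proof -
  have "(\<lambda>\<rho>. \<rho> x) ` (\<gamma> <#\<^bsub>gal E F\<^esub> carrier (gal E M)) = {\<gamma> x}"
  proof
    show "(\<lambda>\<rho>. \<rho> x) ` (\<gamma> <#\<^bsub>gal E F\<^esub> carrier (gal E M)) \<subseteq> {\<gamma> x}"
    proof (rule image_subsetI)
      fix \<rho> assume "\<rho> \<in> \<gamma> <#\<^bsub>gal E F\<^esub> carrier (gal E M)"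
      then obtain \<delta> where d: "\<delta> \<in> carrier (gal E M)" "\<rho> = \<gamma> \<otimes>\<^bsub>gal E F\<^esub> \<delta>"
        by (auto simp: l_coset_def)
      then have "\<delta> \<in> \<Gamma>" using gal_mono[OF assms(1)] by auto
      then show "\<rho> x \<in> {\<gamma> x}"
        using d assms by (auto simp: gal_comp_apply gal_fixes[OF ring_axioms])
    qed
    show "{\<gamma> x} \<subseteq> (\<lambda>\<rho>. \<rho> x) ` (\<gamma> <#\<^bsub>gal E F\<^esub> carrier (gal E M))"
      using G.lcos_self[OF assms(3) subgroup_gal[OF assms(1,2)]] by auto
  qed
  then show ?thesis by (simp add: coset_app_def)
qed

lemma gal_cosets_eq: "gal_cosets E F M = (\<lambda>\<gamma>. \<gamma> <#\<^bsub>gal E F\<^esub> carrier (gal E M)) ` \<Gamma>"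
  by (auto simp: gal_cosets_def LCOSETS_def)

lemma left_translation_coset:
  assumes "F \<subseteq> M" "M \<subseteq> carrier E" "\<gamma> \<in> \<Gamma>" "\<rho> \<in> \<Gamma>"
  shows "left_translation E F M \<gamma> (\<rho> <#\<^bsub>gal E F\<^esub> carrier (gal E M))
    = (\<gamma> \<otimes>\<^bsub>gal E F\<^esub> \<rho>) <#\<^bsub>gal E F\<^esub> carrier (gal E M)"
  using assms gal_mono[OF assms(1), of E] G.lcos_m_assoc[of "carrier (gal E M)" \<gamma> \<rho>]
  by (simp add: left_translation_def gal_cosets_eq)

lemma left_translation_Bij:
  assumes "F \<subseteq> M" "M \<subseteq> carrier E" "\<gamma> \<in> \<Gamma>"
  shows "left_translation E F M \<gamma> \<in> Bij (gal_cosets E F M)"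
proof -
  have "bij_betw (left_translation E F M \<gamma>) (gal_cosets E F M) (gal_cosets E F M)"
  proof (rule bij_betwI[where g = "left_translation E F M (inv\<^bsub>gal E F\<^esub> \<gamma>)"])
  qed (use assms in \<open>auto simp: gal_cosets_eq left_translation_coset simp flip: G.m_assoc\<close>)
  then show ?thesis by (auto simp: Bij_def left_translation_def)
qed

lemma finite_gal_cosets: "finite (gal_cosets E F M)"
  using finite_gal by (simp add: gal_cosets_eq)

lemma fixed_field_subfield:
  assumes "D \<subseteq> \<Gamma>"
  shows "subfield (fixed_field E D) E"
proof (rule subfieldI')
  have D: "\<rho> \<in> \<Gamma>" if "\<rho> \<in> D" for \<rho> using that assms by auto
  note p = gal_closed[OF ring_axioms D] gal_add[OF ring_axioms D] gal_mult[OF ring_axioms D]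
    gal_one[OF ring_axioms D] gal_zero[OF ring_axioms D] gal_minus[OF ring_axioms D]
  have fx: "\<rho> x = x" if "x \<in> fixed_field E D" "\<rho> \<in> D" for \<rho> x
    using that by (auto simp: fixed_field_def)
  have cl: "x \<in> carrier E" if "x \<in> fixed_field E D" for x
    using that by (auto simp: fixed_field_def)
  have memI: "x \<in> fixed_field E D" if "x \<in> carrier E" "\<And>\<rho>. \<rho> \<in> D \<Longrightarrow> \<rho> x = x" for x
    using that by (auto simp: fixed_field_def)
  show "subring (fixed_field E D) E"
    by (rule subringI; (intro memI)?) (simp_all add: cl p fx subsetI)
  fix k assume k: "k \<in> fixed_field E D - {\<zero>}"
  then have k': "k \<in> carrier E" "k \<noteq> \<zero>" by (auto simp: fixed_field_def)
  then have inv: "inv k \<in> carrier E" "k \<otimes> inv k = \<one>" using field_Units by auto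
  have "\<rho> (inv k) = inv k" if "\<rho> \<in> D" for \<rho>
  proof -
    have "\<rho> k = k" using k that by (auto simp: fixed_field_def)
    then have "k \<otimes> \<rho> (inv k) = \<one>"
      using p(3)[OF that k'(1) inv(1)] inv(2) p(4)[OF that] by simp
    then show ?thesis using comm_inv_char[OF k'(1) p(1)[OF that inv(1)]] by simp
  qed
  then show "inv k \<in> fixed_field E D" using inv by (auto simp: fixed_field_def)
qed

lemma F_in_fixed_field: "D \<subseteq> \<Gamma> \<Longrightarrow> F \<subseteq> fixed_field E D"
  using F_sub by (auto simp: fixed_field_def gal_mem_iff)

lemma restrict_gal_stable:
  assumes M: "subfield M E" "F \<subseteq> M"
    and stable: "\<And>\<rho> x. \<rho> \<in> \<Gamma> \<Longrightarrow> x \<in> M \<Longrightarrow> \<rho> x \<in> M"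
    and s: "\<rho> \<in> \<Gamma>"
  shows "restrict \<rho> M \<in> carrier (gal (E\<lparr>carrier := M\<rparr>) F)"
proof -
  have sub: "M \<subseteq> carrier E" using subfieldE(3)[OF M(1)] .
  have "bij_betw \<rho> M M"
    using sub s stable[of "inv\<^bsub>gal E F\<^esub> \<rho>"] stable[OF s]
    by (intro bij_betwI[where g = "inv\<^bsub>gal E F\<^esub> \<rho>"]) (auto simp: gal_props subset_iff)
  then have "bij_betw (restrict \<rho> M) M M" by simp
  moreover have "restrict \<rho> M \<in> ring_hom (E\<lparr>carrier := M\<rparr>) (E\<lparr>carrier := M\<rparr>)"
    using sub s stable[OF s] subringE[OF subfieldE(1)[OF M(1)]]
    by (intro ring_hom_memI) (auto simp: gal_props subset_iff)
  ultimately show ?thesis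
    using M(2) s by (auto simp: gal_mem_iff)
qed

end

text \<open>The second Galois extension \<open>M/F\<close> is not assumed to be stable under \<open>Gal(E/F)\<close>; this is
  what normality yields, and it makes restriction to \<open>M\<close> a homomorphism of Galois groups.\<close>

locale galois_tower = galois E F for E (structure) and F +
  fixes M
  assumes M_subfield: "subfield M E" and F_M: "F \<subseteq> M" and M_galois: "galois (E\<lparr>carrier := M\<rparr>) F"
begin

sublocale M: galois "E\<lparr>carrier := M\<rparr>" F by (rule M_galois)

lemma M_sub: "M \<subseteq> carrier E"
  using subfieldE(3)[OF M_subfield] .

lemma gal_stable: "\<rho> \<in> \<Gamma> \<Longrightarrow> x \<in> M \<Longrightarrow> \<rho> x \<in> M"
proof -
  assume s: "\<rho> \<in> \<Gamma>" and x: "x \<in> M"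
  have "\<rho> \<in> ring_hom (E\<lparr>carrier := M\<rparr>) E"
    using M_sub s by (auto intro!: ring_hom_memI simp: gal_props subset_iff)
  from hom_on_galois_is_gal[OF field_axioms M_subfield M_galois this] s x
  obtain \<tau> where "\<tau> \<in> carrier (gal (E\<lparr>carrier := M\<rparr>) F)" "\<tau> x = \<rho> x"
    by (auto simp: gal_props)
  then show ?thesis using gal_closed[OF M.ring_axioms, of \<tau> F x] x by simp
qed

lemma restrict_gal: "\<rho> \<in> \<Gamma> \<Longrightarrow> restrict \<rho> M \<in> carrier (gal (E\<lparr>carrier := M\<rparr>) F)"
  using gal_stable by (intro restrict_gal_stable M_subfield F_M) auto

lemma restrict_gal_hom: "group_hom (gal E F) (gal (E\<lparr>carrier := M\<rparr>) F) (\<lambda>\<rho>. restrict \<rho> M)"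
proof (intro group_hom.intro group_hom_axioms.intro G.group_axioms M.G.group_axioms homI restrict_gal)
  fix \<rho> \<tau> assume st: "\<rho> \<in> \<Gamma>" "\<tau> \<in> \<Gamma>"
  show "restrict (\<rho> \<otimes>\<^bsub>gal E F\<^esub> \<tau>) M = restrict \<rho> M \<otimes>\<^bsub>gal (E\<lparr>carrier := M\<rparr>) F\<^esub> restrict \<tau> M"
    by (rule gal_eqI[OF restrict_gal M.G.m_closed])
      (use st M_sub in \<open>auto simp: restrict_gal gal_comp_apply gal_stable subset_iff\<close>)
qed

text \<open>The fixed field of the image is \<open>F\<close>, so the image is everything by Artin's theorem.\<close>

lemma restrict_gal_surj: "(\<lambda>\<rho>. restrict \<rho> M) ` \<Gamma> = carrier (gal (E\<lparr>carrier := M\<rparr>) F)"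
proof -
  interpret r: group_hom "gal E F" "gal (E\<lparr>carrier := M\<rparr>) F" "\<lambda>\<rho>. restrict \<rho> M"
    by (rule restrict_gal_hom)
  let ?R = "(\<lambda>\<rho>. restrict \<rho> M) ` \<Gamma>"
  have "fixed_field (E\<lparr>carrier := M\<rparr>) ?R = F"
    using M_sub F_M F_sub in_F_iff by (auto simp: fixed_field_def subset_iff)
  then show ?thesis using M.gal_fixed_field[OF r.img_is_subgroup] by simp
qed

text \<open>Hence \<open>Gal(E/F)\<close> acts on the cosets \<open>Gal(M/F)/Gal(M/F')\<close>, transitively, and the
  elements that move the base point alike are those that agree on \<open>F'\<close>.  So this set of cosets
  is, as a set with an action of \<open>Gal(E/F)\<close>, the same for every choice of \<open>M\<close>.\<close>

definition coset_of :: "'a set \<Rightarrow> ('a \<Rightarrow> 'a) \<Rightarrow> ('a \<Rightarrow> 'a) set" where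
  "coset_of F' \<rho> = restrict \<rho> M <#\<^bsub>gal (E\<lparr>carrier := M\<rparr>) F\<^esub> carrier (gal (E\<lparr>carrier := M\<rparr>) F')"

lemma coset_of_eq_iff:
  assumes "F \<subseteq> F'" "F' \<subseteq> M" "\<rho> \<in> \<Gamma>" "\<tau> \<in> \<Gamma>"
  shows "coset_of F' \<rho> = coset_of F' \<tau> \<longleftrightarrow> (\<forall>x\<in>F'. \<rho> x = \<tau> x)"
  using M.gal_coset_eq_iff[of F' "restrict \<rho> M" "restrict \<tau> M"] assms
  by (auto simp: coset_of_def restrict_gal subset_iff)

lemma coset_of_surj: "coset_of F' ` \<Gamma> = gal_cosets (E\<lparr>carrier := M\<rparr>) F F'"
  unfolding M.gal_cosets_eq restrict_gal_surj[symmetric] by (auto simp: coset_of_def)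

lemma left_translation_coset_of:
  assumes "F \<subseteq> F'" "F' \<subseteq> M" "\<gamma> \<in> \<Gamma>" "\<rho> \<in> \<Gamma>"
  shows "left_translation (E\<lparr>carrier := M\<rparr>) F F' (restrict \<gamma> M) (coset_of F' \<rho>)
    = coset_of F' (\<gamma> \<otimes>\<^bsub>gal E F\<^esub> \<rho>)"
  using M.left_translation_coset[of F' "restrict \<gamma> M" "restrict \<rho> M"] assms
    group_hom.hom_mult[OF restrict_gal_hom, of \<gamma> \<rho>]
  by (simp add: coset_of_def restrict_gal)

end

text \<open>The Galois closure is the fixed field of the group \<open>C\<close> of automorphisms that are trivial on
  all conjugates of \<open>L\<close>, a normal subgroup.  A Galois extension of \<open>F\<close> that contains \<open>L\<close>
  contains these conjugates by normality, so its Galois group lies in \<open>C\<close>.\<close>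

lemma galois_closure_exists:
  fixes E (structure)
  assumes fg: "finite_galois E F" and L: "subfield L E" "F \<subseteq> L"
  shows "\<exists>M. galois_closure E F L M"
proof -
  interpret galois E F by (rule finite_galois_imp_galois[OF fg])
  have LE: "L \<subseteq> carrier E" using subfieldE(3)[OF L(1)] .
  define Y where "Y = (\<Union>\<rho>\<in>carrier (gal E F). \<rho> ` L)"
  have YE: "Y \<subseteq> carrier E" using LE by (auto simp: Y_def gal_props subset_iff)
  have LY: "L \<subseteq> Y"
  proof
    fix x assume "x \<in> L"
    then have "x = \<one>\<^bsub>gal E F\<^esub> x" using LE by (auto simp: gal_id_apply)
    then show "x \<in> Y" unfolding Y_def using \<open>x \<in> L\<close> G.one_closed by blast
  qed
  have Y_stable: "\<rho> y \<in> Y" if \<rho>: "\<rho> \<in> carrier (gal E F)" and y: "y \<in> Y" for \<rho> y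
  proof -
    obtain \<tau> x where t: "\<tau> \<in> carrier (gal E F)" "x \<in> L" "y = \<tau> x" using y by (auto simp: Y_def)
    then have "\<rho> y = (\<rho> \<otimes>\<^bsub>gal E F\<^esub> \<tau>) x" using \<rho> LE by (auto simp: gal_comp_apply)
    then show ?thesis unfolding Y_def using t G.m_closed[OF \<rho> t(1)] by blast
  qed
  let ?C = "carrier (gal E Y)"
  define M where "M = fixed_field E ?C"
  have CG: "?C \<subseteq> carrier (gal E F)" by (rule gal_mono) (use L(2) LY in auto)
  have YM: "Y \<subseteq> M" using YE by (auto simp: M_def fixed_field_def gal_mem_iff)
  have sM: "subfield M E" unfolding M_def by (rule fixed_field_subfield[OF CG])
  have ME: "M \<subseteq> carrier E" using subfieldE(3)[OF sM] .
  have FM: "F \<subseteq> M" using L(2) LY YM by auto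
  have stable: "\<rho> x \<in> M" if \<rho>: "\<rho> \<in> carrier (gal E F)" and x: "x \<in> M" for \<rho> x
  proof -
    have "\<tau> (\<rho> x) = \<rho> x" if t: "\<tau> \<in> ?C" for \<tau>
    proof -
      have t': "\<tau> \<in> carrier (gal E F)" using t CG by auto
      let ?c = "inv\<^bsub>gal E F\<^esub> \<rho> \<otimes>\<^bsub>gal E F\<^esub> (\<tau> \<otimes>\<^bsub>gal E F\<^esub> \<rho>)"
      have c: "?c \<in> carrier (gal E F)" using \<rho> t' by simp
      have "?c y = y" if "y \<in> Y" for y
        using that YE \<rho> t' gal_fixes[OF ring_axioms t Y_stable[OF \<rho> that]]
        by (auto simp: gal_props subset_iff)
      then have "?c \<in> ?C" using c by (auto simp: gal_mem_iff)
      then have "?c x = x" using x by (auto simp: M_def fixed_field_def)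
      moreover have "\<rho> (?c x) = \<tau> (\<rho> x)" using \<rho> t' x ME by (auto simp: gal_props subset_iff)
      ultimately show ?thesis by simp
    qed
    then show ?thesis using \<rho> x ME by (auto simp: M_def fixed_field_def gal_props subset_iff)
  qed
  interpret M: field "E\<lparr>carrier := M\<rparr>" by (rule subfield_iff(2)[OF sM])
  have sF: "subfield F (E\<lparr>carrier := M\<rparr>)"
    using FM subfield_iff(2)[OF subfield] by (intro M.subfield_iff(1)) auto
  have "finite_galois (E\<lparr>carrier := M\<rparr>) F"
    unfolding finite_galois_def
  proof (intro conjI M.field_axioms sF)
    have "subalgebra F M E"
    proof (intro subalgebra.intro subalgebra_axioms.intro)
      show "subgroup M (add_monoid E)" using subring.axioms(1)[OF subfieldE(1)[OF sM]] .
      show "k \<otimes> v \<in> M" if "k \<in> F" "v \<in> M" for k v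
        using subringE(6)[OF subfieldE(1)[OF sM]] that FM by blast
    qed
    then have "finite_dimension F M"
      using fg ME by (intro subalbegra_incl_imp_finite_dimension[OF subfield _ _ ME])
        (simp_all only: finite_galois_def)
    then obtain n where "dimension n F M" by blast
    then obtain Us where Us: "set Us \<subseteq> carrier E" "Span F Us = M"
      using exists_base[OF subfield] by blast
    then have "set Us \<subseteq> M" using Span_base_incl[OF subfield] by auto
    then have "M.finite_dimension F (M.Span F Us)"
      by (intro M.Span_finite_dimension[OF sF]) simp
    then show "M.finite_dimension F (carrier (E\<lparr>carrier := M\<rparr>))"
      using Us(2) Span_consistent[OF subfieldE(1)[OF sM]] by simp
    show "fixed_field (E\<lparr>carrier := M\<rparr>) (carrier (gal (E\<lparr>carrier := M\<rparr>) F)) = F"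
    proof
      show "F \<subseteq> fixed_field (E\<lparr>carrier := M\<rparr>) (carrier (gal (E\<lparr>carrier := M\<rparr>) F))"
        using FM by (auto simp: fixed_field_def gal_mem_iff)
      show "fixed_field (E\<lparr>carrier := M\<rparr>) (carrier (gal (E\<lparr>carrier := M\<rparr>) F)) \<subseteq> F"
      proof
        fix x assume x: "x \<in> fixed_field (E\<lparr>carrier := M\<rparr>) (carrier (gal (E\<lparr>carrier := M\<rparr>) F))"
        then have xM: "x \<in> M" by (simp add: fixed_field_def)
        have "\<rho> x = x" if "\<rho> \<in> carrier (gal E F)" for \<rho>
        proof -
          have "restrict \<rho> M \<in> carrier (gal (E\<lparr>carrier := M\<rparr>) F)"
            using stable that by (intro restrict_gal_stable sM FM) auto
          moreover have "\<forall>\<tau>\<in>carrier (gal (E\<lparr>carrier := M\<rparr>) F). \<tau> x = x"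
            using x by (simp add: fixed_field_def)
          ultimately have "restrict \<rho> M x = x" by blast
          then show ?thesis using xM by simp
        qed
        then show "x \<in> F" using xM ME by (auto simp: in_F_iff)
      qed
    qed
  qed
  moreover have "M' = M"
    if M': "subfield M' E" "L \<subseteq> M'" "M' \<subseteq> M" "finite_galois (E\<lparr>carrier := M'\<rparr>) F" for M'
  proof
    interpret M': galois_tower E F M'
    proof (intro galois_tower.intro galois_tower_axioms.intro galois_axioms)
      show "galois (E\<lparr>carrier := M'\<rparr>) F" by (rule finite_galois_imp_galois[OF M'(4)])
    qed (use M' L(2) in auto)
    have "Y \<subseteq> M'" using M'.gal_stable M'(2) by (auto simp: Y_def)
    then have "carrier (gal E M') \<subseteq> ?C" by (rule gal_mono)
    then have "M \<subseteq> fixed_field E (carrier (gal E M'))" by (auto simp: M_def fixed_field_def)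
    then show "M \<subseteq> M'"
      using fixed_field_gal[OF subfieldE(1)[OF M'(1)] M'.F_M] by simp
  qed fact
  ultimately show ?thesis
    unfolding galois_closure_def using sM LY YM by (intro exI[of _ M]) auto
qed

section \<open>Tensors over the base field, seen through coordinates\<close>

lemma linear_map_ext_moduleD:
  assumes "linear_map (E\<lparr>carrier := F\<rparr>) V (ext_module E W) f"
  shows "v \<in> carrier V \<Longrightarrow> f v \<in> W"
    and "v \<in> carrier V \<Longrightarrow> w \<in> carrier V \<Longrightarrow> f (v \<oplus>\<^bsub>V\<^esub> w) = f v \<oplus>\<^bsub>E\<^esub> f w"
    and "r \<in> F \<Longrightarrow> v \<in> carrier V \<Longrightarrow> f (r \<odot>\<^bsub>V\<^esub> v) = r \<otimes>\<^bsub>E\<^esub> f v"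
  using assms by (auto simp: linear_map_def ext_module_def)

lemma linear_map_ext_moduleI:
  assumes "\<And>v. v \<in> carrier V \<Longrightarrow> f v \<in> W"
    and "\<And>v w. v \<in> carrier V \<Longrightarrow> w \<in> carrier V \<Longrightarrow> f (v \<oplus>\<^bsub>V\<^esub> w) = f v \<oplus>\<^bsub>E\<^esub> f w"
    and "\<And>r v. r \<in> F \<Longrightarrow> v \<in> carrier V \<Longrightarrow> f (r \<odot>\<^bsub>V\<^esub> v) = r \<otimes>\<^bsub>E\<^esub> f v"
  shows "linear_map (E\<lparr>carrier := F\<rparr>) V (ext_module E W) f"
  using assms by (auto simp: linear_map_def ext_module_def)

lemma ext_module_carrier_update [simp]: "ext_module (E\<lparr>carrier := K\<rparr>) W = ext_module E W"
  by (simp add: ext_module_def)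

lemma bilinear_formD:
  assumes "bilinear_form (E\<lparr>carrier := F\<rparr>) V W \<beta>"
  shows "w \<in> carrier W \<Longrightarrow> linear_map (E\<lparr>carrier := F\<rparr>) V (ext_module E F) (\<lambda>v. \<beta> v w)"
    and "v \<in> carrier V \<Longrightarrow> linear_map (E\<lparr>carrier := F\<rparr>) W (ext_module E F) (\<beta> v)"
  using assms by (auto simp: bilinear_form_def)

context galois
begin

text \<open>A frame of an \<open>F\<close>-module \<open>V\<close>, given \<open>E\<close>-valued coordinate functions indexed by \<open>I\<close>:
  elements \<open>e\<close> and functionals \<open>v \<mapsto> \<Sum> f\<^sub>i v\<^sub>i\<close> with values in \<open>F\<close> such that every \<open>v\<close> is
  \<open>\<Sum> f(v) e\<close>.  It is stated through linear forms \<open>\<phi>\<close>, where the expansion is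
  a sum in \<open>E\<close>.\<close>

definition frame ::
  "('a, 'v, 'x) module_scheme \<Rightarrow> 'i set \<Rightarrow> ('v \<Rightarrow> 'i \<Rightarrow> 'a) \<Rightarrow> ('v \<times> ('i \<Rightarrow> 'a)) list \<Rightarrow> bool" where
  "frame V I ev es \<longleftrightarrow> finite I \<and> (\<forall>v\<in>carrier V. \<forall>i\<in>I. ev v i \<in> carrier E) \<and>
     set es \<subseteq> carrier V \<times> (I \<rightarrow> carrier E) \<and>
     (\<forall>\<phi> v. linear_map (E\<lparr>carrier := F\<rparr>) V (ext_module E F) \<phi> \<longrightarrow> v \<in> carrier V \<longrightarrow>
        \<phi> v = lsum E (\<lambda>(e, f). (\<Oplus>i\<in>I. f i \<otimes> ev v i) \<otimes> \<phi> e) es)"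

lemma frame_mem:
  assumes "frame V I ev es" "x \<in> set es"
  shows "fst x \<in> carrier V" and "i \<in> I \<Longrightarrow> snd x i \<in> carrier E"
proof -
  have "x \<in> carrier V \<times> (I \<rightarrow> carrier E)" using assms by (auto simp: frame_def)
  then show "fst x \<in> carrier V" "i \<in> I \<Longrightarrow> snd x i \<in> carrier E" by auto
qed

lemma frame_linear_form:
  assumes V: "frame V I ev es" and \<phi>: "linear_map (E\<lparr>carrier := F\<rparr>) V (ext_module E F) \<phi>"
    and v: "v \<in> carrier V"
  shows "\<phi> v = (\<Oplus>i\<in>I. ev v i \<otimes> lsum E (\<lambda>x. snd x i \<otimes> \<phi> (fst x)) es)"
proof -
  note ec = frame_mem[OF V]
  have cl: "finite I" "i \<in> I \<Longrightarrow> ev v i \<in> carrier E" "w \<in> carrier V \<Longrightarrow> \<phi> w \<in> carrier E" for i w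
    using V v linear_map_ext_moduleD(1)[OF \<phi>] F_sub by (auto simp: frame_def)
  have "\<phi> v = lsum E (\<lambda>x. (\<Oplus>i\<in>I. snd x i \<otimes> ev v i) \<otimes> \<phi> (fst x)) es"
    using V \<phi> v by (auto simp: frame_def case_prod_unfold)
  also have "\<dots> = lsum E (\<lambda>x. \<Oplus>i\<in>I. ev v i \<otimes> (snd x i \<otimes> \<phi> (fst x))) es"
    by (rule lsum_cong, subst finsum_mult_right) (simp_all add: cl ec m_ac cong: finsum_cong_fun)
  also have "\<dots> = (\<Oplus>i\<in>I. ev v i \<otimes> lsum E (\<lambda>x. snd x i \<otimes> \<phi> (fst x)) es)"
    by (simp add: lsum_finsum_swap lsum_mult_left cl ec cong: finsum_cong_fun)
  finally show ?thesis .
qed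

text \<open>Expanding the two arguments in turn represents the form by a matrix with entries in \<open>E\<close>.\<close>

lemma bilinear_form_via_frames:
  assumes V: "frame V I ev es" and W: "frame W J ev' es'"
    and \<beta>: "bilinear_form (E\<lparr>carrier := F\<rparr>) V W \<beta>"
  obtains t where "\<And>i j. i \<in> I \<Longrightarrow> j \<in> J \<Longrightarrow> t i j \<in> carrier E"
    "\<And>v w. v \<in> carrier V \<Longrightarrow> w \<in> carrier W \<Longrightarrow> \<beta> v w = (\<Oplus>i\<in>I. \<Oplus>j\<in>J. ev v i \<otimes> ev' w j \<otimes> t i j)"
proof -
  note ec = frame_mem[OF V]
  note ec' = frame_mem[OF W]
  have bc: "\<beta> v w \<in> carrier E" if "v \<in> carrier V" "w \<in> carrier W" for v w
    using linear_map_ext_moduleD(1)[OF bilinear_formD(1)[OF \<beta> that(2)] that(1)] F_sub by auto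
  have cl: "finite I" "finite J" "v \<in> carrier V \<Longrightarrow> i \<in> I \<Longrightarrow> ev v i \<in> carrier E"
    "w \<in> carrier W \<Longrightarrow> j \<in> J \<Longrightarrow> ev' w j \<in> carrier E" for v i w j
    using V W by (auto simp: frame_def)
  define d where "d e j = lsum E (\<lambda>y. snd y j \<otimes> \<beta> e (fst y)) es'" for e j
  define t where "t i j = lsum E (\<lambda>x. snd x i \<otimes> d (fst x) j) es" for i j
  have dc: "d (fst x) j \<in> carrier E" if "x \<in> set es" "j \<in> J" for x j
    using that by (simp add: d_def ec ec' bc)
  have "\<beta> v w = (\<Oplus>i\<in>I. \<Oplus>j\<in>J. ev v i \<otimes> ev' w j \<otimes> t i j)" if v: "v \<in> carrier V" and w: "w \<in> carrier W" for v w
  proof -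
    have "\<beta> v w = (\<Oplus>i\<in>I. ev v i \<otimes> lsum E (\<lambda>x. snd x i \<otimes> \<beta> (fst x) w) es)"
      by (rule frame_linear_form[OF V bilinear_formD(1)[OF \<beta> w] v])
    also have "\<dots> = (\<Oplus>i\<in>I. ev v i \<otimes> (\<Oplus>j\<in>J. ev' w j \<otimes> t i j))"
    proof (intro finsum_cong_fun arg_cong[where f = "\<lambda>s. ev v _ \<otimes> s"])
      fix i assume i: "i \<in> I"
      have "lsum E (\<lambda>x. snd x i \<otimes> \<beta> (fst x) w) es = lsum E (\<lambda>x. \<Oplus>j\<in>J. ev' w j \<otimes> (snd x i \<otimes> d (fst x) j)) es"
      proof (rule lsum_cong)
        fix x assume x: "x \<in> set es"
        have "\<beta> (fst x) w = (\<Oplus>j\<in>J. ev' w j \<otimes> d (fst x) j)"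
          unfolding d_def by (rule frame_linear_form[OF W bilinear_formD(2)[OF \<beta> ec(1)[OF x]] w])
        then show "snd x i \<otimes> \<beta> (fst x) w = (\<Oplus>j\<in>J. ev' w j \<otimes> (snd x i \<otimes> d (fst x) j))"
          by (simp add: finsum_mult_left cl ec dc x i w m_lcomm cong: finsum_cong_fun)
      qed
      then show "lsum E (\<lambda>x. snd x i \<otimes> \<beta> (fst x) w) es = (\<Oplus>j\<in>J. ev' w j \<otimes> t i j)"
        by (simp add: t_def lsum_finsum_swap lsum_mult_left cl ec dc i w cong: finsum_cong_fun)
    qed
    also have "\<dots> = (\<Oplus>i\<in>I. \<Oplus>j\<in>J. ev v i \<otimes> ev' w j \<otimes> t i j)"
      by (simp add: finsum_mult_left t_def cl ec dc v w m_assoc cong: finsum_cong_fun)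
    finally show ?thesis .
  qed
  moreover have "t i j \<in> carrier E" if "i \<in> I" "j \<in> J" for i j
    using that by (simp add: t_def ec dc)
  ultimately show ?thesis using that by blast
qed

text \<open>So a tensor is determined by its matrix of coordinates, although these have values in \<open>E\<close>
  and the tensor product is over \<open>F\<close>.\<close>

lemma bilinear_form_eqI:
  assumes "frame V I ev es" "frame W J ev' es'"
    and "set xs \<subseteq> carrier V \<times> carrier W" "set ys \<subseteq> carrier V \<times> carrier W"
    and "\<And>i j. i \<in> I \<Longrightarrow> j \<in> J \<Longrightarrow>
      lsum E (\<lambda>(v, w). ev v i \<otimes> ev' w j) xs = lsum E (\<lambda>(v, w). ev v i \<otimes> ev' w j) ys"
    and "bilinear_form (E\<lparr>carrier := F\<rparr>) V W \<beta>"
  shows "lsum E (\<lambda>(v, w). \<beta> v w) xs = lsum E (\<lambda>(v, w). \<beta> v w) ys"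
proof -
  obtain t where tc: "\<And>i j. i \<in> I \<Longrightarrow> j \<in> J \<Longrightarrow> t i j \<in> carrier E"
    and t: "\<And>v w. v \<in> carrier V \<Longrightarrow> w \<in> carrier W \<Longrightarrow> \<beta> v w = (\<Oplus>i\<in>I. \<Oplus>j\<in>J. ev v i \<otimes> ev' w j \<otimes> t i j)"
    using bilinear_form_via_frames[OF assms(1,2,6)] by blast
  have cl: "finite I" "finite J" "v \<in> carrier V \<Longrightarrow> i \<in> I \<Longrightarrow> ev v i \<in> carrier E"
    "w \<in> carrier W \<Longrightarrow> j \<in> J \<Longrightarrow> ev' w j \<in> carrier E" for v i w j
    using assms(1,2) by (auto simp: frame_def)
  have "lsum E (\<lambda>(v, w). \<beta> v w) zs = (\<Oplus>i\<in>I. \<Oplus>j\<in>J. lsum E (\<lambda>(v, w). ev v i \<otimes> ev' w j) zs \<otimes> t i j)"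
    if zs: "set zs \<subseteq> carrier V \<times> carrier W" for zs
  proof -
    have zp: "fst z \<in> carrier V" "snd z \<in> carrier W" if "z \<in> set zs" for z using zs that by auto
    show ?thesis
      by (simp add: case_prod_unfold t zp cl tc lsum_finsum_swap lsum_mult_right cong: lsum_cong finsum_cong_fun)
  qed
  then show ?thesis using assms(3-5) by (simp cong: finsum_cong_fun)
qed

lemma tensor_eqI:
  assumes "frame V I ev es" "frame W J ev' es'"
    and "set xs \<subseteq> carrier V \<times> carrier W" "set ys \<subseteq> carrier V \<times> carrier W"
    and "\<And>i j. i \<in> I \<Longrightarrow> j \<in> J \<Longrightarrow>
      lsum E (\<lambda>(v, w). ev v i \<otimes> ev' w j) xs = lsum E (\<lambda>(v, w). ev v i \<otimes> ev' w j) ys"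
  shows "tensor_eq (E\<lparr>carrier := F\<rparr>) V W xs ys"
  unfolding tensor_eq_def using bilinear_form_eqI[OF assms] by simp

end

section \<open>Galois descent of group algebras\<close>

text \<open>The fixed points of \<open>Gal(E/F)\<close> on \<open>E[P]\<close>, where \<open>\<gamma>\<close> acts on the coefficients and on the
  group \<open>P\<close> by \<open>c \<gamma>\<close>.  For a group \<open>P\<close> of permutations of cosets and conjugation by left
  translations this is \<^const>\<open>gp_fixed\<close>, and the Hopf algebra is \<^const>\<open>gp_hopf\<close>; the Hopf
  algebra axioms hold for any finite group \<open>P\<close> with such an action.\<close>

definition descended :: "('a, 'm) ring_scheme \<Rightarrow> 'a set \<Rightarrow> ('g, 'n) monoid_scheme \<Rightarrow>
    (('a \<Rightarrow> 'a) \<Rightarrow> 'g \<Rightarrow> 'g) \<Rightarrow> ('g \<Rightarrow> 'a) set" where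
  "descended E F P c = {a \<in> carrier P \<rightarrow>\<^sub>E carrier E.
     \<forall>\<gamma>\<in>carrier (gal E F). \<forall>p\<in>carrier P. a (c \<gamma> p) = \<gamma> (a p)}"

definition descended_hopf :: "('a, 'm) ring_scheme \<Rightarrow> 'a set \<Rightarrow> ('g, 'n) monoid_scheme \<Rightarrow>
    (('a \<Rightarrow> 'a) \<Rightarrow> 'g \<Rightarrow> 'g) \<Rightarrow> ('a, 'g \<Rightarrow> 'a) hopf" where
  "descended_hopf E F P c = \<lparr>
     carrier = descended E F P c,
     monoid.mult = (\<otimes>\<^bsub>group_algebra E P\<^esub>), one = \<one>\<^bsub>group_algebra E P\<^esub>,
     ring.zero = \<zero>\<^bsub>group_algebra E P\<^esub>, ring.add = (\<oplus>\<^bsub>group_algebra E P\<^esub>),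
     smult = (\<odot>\<^bsub>group_algebra E P\<^esub>),
     comult = (\<lambda>a. SOME xs. set xs \<subseteq> descended E F P c \<times> descended E F P c \<and>
        (\<forall>p\<in>carrier P. \<forall>q\<in>carrier P.
           lsum E (\<lambda>(u, v). u p \<otimes>\<^bsub>E\<^esub> v q) xs = (if p = q then a p else \<zero>\<^bsub>E\<^esub>))),
     counit = (\<lambda>a. \<Oplus>\<^bsub>E\<^esub>p\<in>carrier P. a p),
     antipode = (\<lambda>a. \<lambda>p\<in>carrier P. a (inv\<^bsub>P\<^esub> p))\<rparr>"

locale gal_group_action = galois E F + P: group P
  for E (structure) and F and P :: "('g, 'n) monoid_scheme" +
  fixes c :: "('a \<Rightarrow> 'a) \<Rightarrow> 'g \<Rightarrow> 'g"
  assumes finite_P: "finite (carrier P)"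
    and c_closed: "\<gamma> \<in> \<Gamma> \<Longrightarrow> p \<in> carrier P \<Longrightarrow> c \<gamma> p \<in> carrier P"
    and c_mult: "\<gamma> \<in> \<Gamma> \<Longrightarrow> p \<in> carrier P \<Longrightarrow> q \<in> carrier P \<Longrightarrow>
      c \<gamma> (p \<otimes>\<^bsub>P\<^esub> q) = c \<gamma> p \<otimes>\<^bsub>P\<^esub> c \<gamma> q"
    and c_comp: "\<gamma> \<in> \<Gamma> \<Longrightarrow> \<tau> \<in> \<Gamma> \<Longrightarrow> p \<in> carrier P \<Longrightarrow>
      c (\<gamma> \<otimes>\<^bsub>gal E F\<^esub> \<tau>) p = c \<gamma> (c \<tau> p)"
    and c_id: "p \<in> carrier P \<Longrightarrow> c \<one>\<^bsub>gal E F\<^esub> p = p"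
begin

abbreviation A where "A \<equiv> descended_hopf E F P c"

lemma A_simps:
  "carrier A = descended E F P c"
  "p \<in> carrier P \<Longrightarrow> (a \<oplus>\<^bsub>A\<^esub> b) p = a p \<oplus> b p"
  "p \<in> carrier P \<Longrightarrow> (r \<odot>\<^bsub>A\<^esub> a) p = r \<otimes> a p"
  "p \<in> carrier P \<Longrightarrow> \<zero>\<^bsub>A\<^esub> p = \<zero>"
  "p \<in> carrier P \<Longrightarrow> \<one>\<^bsub>A\<^esub> p = (if p = \<one>\<^bsub>P\<^esub> then \<one> else \<zero>)"
  "q \<in> carrier P \<Longrightarrow> (a \<otimes>\<^bsub>A\<^esub> b) q = (\<Oplus>p\<in>carrier P. a p \<otimes> b (inv\<^bsub>P\<^esub> p \<otimes>\<^bsub>P\<^esub> q))"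
  "counit A a = (\<Oplus>p\<in>carrier P. a p)"
  "p \<in> carrier P \<Longrightarrow> antipode A a p = a (inv\<^bsub>P\<^esub> p)"
  by (simp_all add: descended_hopf_def group_algebra_def)

lemma A_extensional:
  "a \<oplus>\<^bsub>A\<^esub> b \<in> extensional (carrier P)" "r \<odot>\<^bsub>A\<^esub> a \<in> extensional (carrier P)"
  "\<zero>\<^bsub>A\<^esub> \<in> extensional (carrier P)" "\<one>\<^bsub>A\<^esub> \<in> extensional (carrier P)"
  "a \<otimes>\<^bsub>A\<^esub> b \<in> extensional (carrier P)" "antipode A a \<in> extensional (carrier P)"
  by (simp_all add: descended_hopf_def group_algebra_def)

lemma A_closed: "a \<in> carrier A \<Longrightarrow> p \<in> carrier P \<Longrightarrow> a p \<in> carrier E"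
  by (auto simp: A_simps(1) descended_def)

lemma A_equivariant:
  "a \<in> carrier A \<Longrightarrow> \<gamma> \<in> \<Gamma> \<Longrightarrow> p \<in> carrier P \<Longrightarrow> a (c \<gamma> p) = \<gamma> (a p)"
  by (auto simp: A_simps(1) descended_def)

lemma A_memI:
  assumes "a \<in> extensional (carrier P)" "\<And>p. p \<in> carrier P \<Longrightarrow> a p \<in> carrier E"
    and "\<And>\<gamma> p. \<gamma> \<in> \<Gamma> \<Longrightarrow> p \<in> carrier P \<Longrightarrow> a (c \<gamma> p) = \<gamma> (a p)"
  shows "a \<in> carrier A"
  using assms by (auto simp: A_simps(1) descended_def PiE_def)

lemma A_eqI:
  assumes "a \<in> carrier A" "b \<in> carrier A" "\<And>p. p \<in> carrier P \<Longrightarrow> a p = b p"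
  shows "a = b"
  by (rule extensionalityI[of _ "carrier P"])
    (use assms in \<open>auto simp: A_simps(1) descended_def PiE_def\<close>)

lemma c_one: "\<gamma> \<in> \<Gamma> \<Longrightarrow> c \<gamma> \<one>\<^bsub>P\<^esub> = \<one>\<^bsub>P\<^esub>"
  using c_mult[of \<gamma> "\<one>\<^bsub>P\<^esub>" "\<one>\<^bsub>P\<^esub>"] c_closed[of \<gamma> "\<one>\<^bsub>P\<^esub>"] by simp

lemma c_inv:
  assumes "\<gamma> \<in> \<Gamma>" "p \<in> carrier P"
  shows "c \<gamma> (inv\<^bsub>P\<^esub> p) = inv\<^bsub>P\<^esub> (c \<gamma> p)"
proof -
  have "c \<gamma> (inv\<^bsub>P\<^esub> p) \<otimes>\<^bsub>P\<^esub> c \<gamma> p = \<one>\<^bsub>P\<^esub>"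
    using assms c_mult[of \<gamma> "inv\<^bsub>P\<^esub> p" p] c_one by simp
  then show ?thesis using assms by (intro P.inv_equality[symmetric]) (auto intro: c_closed)
qed

lemma c_bij:
  assumes "\<gamma> \<in> \<Gamma>"
  shows "bij_betw (c \<gamma>) (carrier P) (carrier P)"
  using assms
  by (intro bij_betwI[where g = "c (inv\<^bsub>gal E F\<^esub> \<gamma>)"])
    (auto intro: c_closed simp: c_id simp flip: c_comp)

lemma c_inj: "\<gamma> \<in> \<Gamma> \<Longrightarrow> p \<in> carrier P \<Longrightarrow> q \<in> carrier P \<Longrightarrow> c \<gamma> p = c \<gamma> q \<longleftrightarrow> p = q"
  using c_bij[of \<gamma>] by (auto simp: bij_betw_def inj_on_def)

lemma sum_c:
  "\<gamma> \<in> \<Gamma> \<Longrightarrow> (\<And>p. p \<in> carrier P \<Longrightarrow> f p \<in> carrier E) \<Longrightarrow>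
   (\<Oplus>p\<in>carrier P. f (c \<gamma> p)) = (\<Oplus>p\<in>carrier P. f p)"
  by (rule finsum_bij[OF c_bij])

lemma gal_sum_equivariant:
  assumes "\<gamma> \<in> \<Gamma>" "\<And>p. p \<in> carrier P \<Longrightarrow> f p \<in> carrier E"
    "\<And>p. p \<in> carrier P \<Longrightarrow> g p \<in> carrier E" "\<And>p. p \<in> carrier P \<Longrightarrow> g (c \<gamma> p) = \<gamma> (f p)"
  shows "\<gamma> (\<Oplus>p\<in>carrier P. f p) = (\<Oplus>p\<in>carrier P. g p)"
proof -
  have "\<gamma> (\<Oplus>p\<in>carrier P. f p) = (\<Oplus>p\<in>carrier P. g (c \<gamma> p))"
    using assms by (subst gal_finsum[OF ring_axioms assms(1)]) (auto intro!: finsum_cong_fun)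
  then show ?thesis using assms by (simp add: sum_c)
qed

lemma sum_equivariant_in_F:
  assumes "\<And>p. p \<in> carrier P \<Longrightarrow> f p \<in> carrier E"
    "\<And>\<gamma> p. \<gamma> \<in> \<Gamma> \<Longrightarrow> p \<in> carrier P \<Longrightarrow> f (c \<gamma> p) = \<gamma> (f p)"
  shows "(\<Oplus>p\<in>carrier P. f p) \<in> F"
  unfolding in_F_iff
  using assms gal_sum_equivariant[of _ f f] by auto

lemma pairing_in_F:
  assumes "a \<in> carrier A" "b \<in> carrier A"
  shows "(\<Oplus>p\<in>carrier P. a p \<otimes> b p) \<in> F"
  using assms by (intro sum_equivariant_in_F) (simp_all add: A_closed A_equivariant gal_props)

text \<open>Equivariant functions are closed under products of values, besides convolution.\<close>

definition pointwise :: "('g \<Rightarrow> 'a) \<Rightarrow> ('g \<Rightarrow> 'a) \<Rightarrow> 'g \<Rightarrow> 'a" where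
  "pointwise a b = (\<lambda>p\<in>carrier P. a p \<otimes> b p)"

lemma pointwise_closed: "a \<in> carrier A \<Longrightarrow> b \<in> carrier A \<Longrightarrow> pointwise a b \<in> carrier A"
  by (rule A_memI) (simp_all add: pointwise_def A_closed A_equivariant gal_props c_closed)

text \<open>The full trace of \<open>x p\<close>, for \<open>x \<in> E\<close> and \<open>p \<in> P\<close>.\<close>

definition orbit_sum :: "'a \<Rightarrow> 'g \<Rightarrow> 'g \<Rightarrow> 'a" where
  "orbit_sum x p = (\<lambda>q\<in>carrier P. \<Oplus>\<gamma>\<in>\<Gamma>. if c \<gamma> p = q then \<gamma> x else \<zero>)"

lemma orbit_sum_closed:
  assumes x: "x \<in> carrier E" and p: "p \<in> carrier P"
  shows "orbit_sum x p \<in> carrier A"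
proof (rule A_memI)
  show "orbit_sum x p \<in> extensional (carrier P)" by (simp add: orbit_sum_def)
  show "orbit_sum x p q \<in> carrier E" if "q \<in> carrier P" for q
    using that x by (auto simp: orbit_sum_def gal_props intro!: finsum_closed_fun)
  fix \<gamma> q assume g: "\<gamma> \<in> \<Gamma>" and q: "q \<in> carrier P"
  have "\<gamma> (orbit_sum x p q) = (\<Oplus>\<tau>\<in>\<Gamma>. \<gamma> (if c \<tau> p = q then \<tau> x else \<zero>))"
    using q g x by (simp add: orbit_sum_def gal_finsum[OF ring_axioms g] gal_props)
  also have "\<dots> = (\<Oplus>\<tau>\<in>\<Gamma>. if c (\<gamma> \<otimes>\<^bsub>gal E F\<^esub> \<tau>) p = c \<gamma> q then (\<gamma> \<otimes>\<^bsub>gal E F\<^esub> \<tau>) x else \<zero>)"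
    using q g x p by (intro finsum_cong_fun) (simp add: c_comp c_inj c_closed gal_props)
  also have "\<dots> = (\<Oplus>\<tau>\<in>\<Gamma>. if c \<tau> p = c \<gamma> q then \<tau> x else \<zero>)"
    using g x by (intro sum_over_gal_translate[OF G.subgroup_self, of \<gamma> "\<lambda>\<tau>. if c \<tau> p = c \<gamma> q then \<tau> x else \<zero>"])
      (auto simp: gal_props)
  finally show "orbit_sum x p (c \<gamma> q) = \<gamma> (orbit_sum x p q)"
    using g q by (simp add: orbit_sum_def c_closed)
qed

end

section \<open>Dual families and the comultiplication\<close>

context gal_group_action
begin

text \<open>If \<open>(x, y)\<close> runs through coordinates of \<open>E/F\<close> and \<open>t\<close> has trace \<open>1\<close>, the orbit sums of
  \<open>y\<close> and of \<open>t x\<close> over all \<open>p\<close> form a pair of dual families.\<close>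

lemma dual_families_exist:
  "\<exists>es. set es \<subseteq> carrier A \<times> carrier A \<and> (\<forall>p\<in>carrier P. \<forall>q\<in>carrier P.
     lsum E (\<lambda>(e, f). e p \<otimes> f q) es = (if p = q then \<one> else \<zero>))"
proof -
  obtain xs where xs: "set xs \<subseteq> carrier E \<times> carrier E"
    "\<And>\<gamma>. \<gamma> \<in> \<Gamma> \<Longrightarrow> lsum E (\<lambda>(a, b). a \<otimes> \<gamma> b) xs = (if \<gamma> = \<one>\<^bsub>gal E F\<^esub> then \<one> else \<zero>)"
    using galois_coordinates by blast
  obtain t where t: "t \<in> carrier E" "trace \<Gamma> t = \<one>"
    using trace_one_exists[OF G.subgroup_self] by blast
  obtain ps where ps: "distinct ps" "set ps = carrier P"
    using finite_distinct_list[OF finite_P] by blast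
  have xp: "fst x \<in> carrier E" "snd x \<in> carrier E" if "x \<in> set xs" for x using xs that by auto
  note cl = xp t(1) gal_props finite_gal finite_P
  define es where "es = concat (map (\<lambda>p0. map (\<lambda>x. (orbit_sum (snd x) p0, orbit_sum (t \<otimes> fst x) p0)) xs) ps)"
  have es: "set es \<subseteq> carrier A \<times> carrier A"
    using ps xp t by (auto simp: es_def intro!: orbit_sum_closed)
  have "lsum E (\<lambda>(e, f). e p \<otimes> f q) es = (if p = q then \<one> else \<zero>)"
    if p: "p \<in> carrier P" and q: "q \<in> carrier P" for p q
  proof -
    have inner: "lsum E (\<lambda>x. orbit_sum (snd x) p0 p \<otimes> orbit_sum (t \<otimes> fst x) p0 q) xs
        = (\<Oplus>\<tau>\<in>\<Gamma>. if c \<tau> p0 = p \<and> p = q then \<tau> t else \<zero>)"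
      if p0: "p0 \<in> carrier P" for p0
    proof -
      let ?k = "\<lambda>\<gamma> \<tau>. if c \<gamma> p0 = p \<and> c \<tau> p0 = q then \<tau> t else \<zero>"
      have kc: "?k \<gamma> \<tau> \<in> carrier E" if "\<tau> \<in> \<Gamma>" for \<gamma> \<tau> using that t by (simp add: gal_props)
      have "lsum E (\<lambda>x. orbit_sum (snd x) p0 p \<otimes> orbit_sum (t \<otimes> fst x) p0 q) xs
          = (\<Oplus>\<gamma>\<in>\<Gamma>. \<Oplus>\<tau>\<in>\<Gamma>. lsum E (\<lambda>x. (if c \<gamma> p0 = p then \<gamma> (snd x) else \<zero>)
              \<otimes> (if c \<tau> p0 = q then \<tau> (t \<otimes> fst x) else \<zero>)) xs)"
        using p q by (simp add: orbit_sum_def, intro lsum_finsum_product) (simp_all add: cl)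
      also have "\<dots> = (\<Oplus>\<gamma>\<in>\<Gamma>. \<Oplus>\<tau>\<in>\<Gamma>. lsum E (\<lambda>x. ?k \<gamma> \<tau> \<otimes> (\<tau> (fst x) \<otimes> \<gamma> (snd x))) xs)"
        by (rule finsum_cong_fun, rule finsum_cong_fun, rule lsum_cong) (simp add: cl m_ac)
      also have "\<dots> = (\<Oplus>\<gamma>\<in>\<Gamma>. \<Oplus>\<tau>\<in>\<Gamma>. if \<gamma> = \<tau> then ?k \<tau> \<tau> else \<zero>)"
      proof (intro finsum_cong_fun)
        fix \<gamma> \<tau> assume g: "\<gamma> \<in> \<Gamma>" "\<tau> \<in> \<Gamma>"
        have "lsum E (\<lambda>x. ?k \<gamma> \<tau> \<otimes> (\<tau> (fst x) \<otimes> \<gamma> (snd x))) xs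
            = ?k \<gamma> \<tau> \<otimes> lsum E (\<lambda>x. \<tau> (fst x) \<otimes> \<gamma> (snd x)) xs"
          using g by (intro lsum_mult_left[symmetric] kc) (simp_all add: cl)
        also have "lsum E (\<lambda>x. \<tau> (fst x) \<otimes> \<gamma> (snd x)) xs = (if inv\<^bsub>gal E F\<^esub> \<tau> \<otimes>\<^bsub>gal E F\<^esub> \<gamma> \<in> {\<one>\<^bsub>gal E F\<^esub>} then \<one> else \<zero>)"
          using coordinates_sum_shift[OF g(2,1) xs(1), of "{\<one>\<^bsub>gal E F\<^esub>}"] xs(2)
          by (simp add: case_prod_unfold)
        also have "inv\<^bsub>gal E F\<^esub> \<tau> \<otimes>\<^bsub>gal E F\<^esub> \<gamma> \<in> {\<one>\<^bsub>gal E F\<^esub>} \<longleftrightarrow> \<gamma> = \<tau>"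
          using G.inv_solve_left'[of "\<one>\<^bsub>gal E F\<^esub>" \<tau> \<gamma>] g by auto
        finally show "lsum E (\<lambda>x. ?k \<gamma> \<tau> \<otimes> (\<tau> (fst x) \<otimes> \<gamma> (snd x))) xs = (if \<gamma> = \<tau> then ?k \<tau> \<tau> else \<zero>)"
          using kc g by auto
      qed
      also have "\<dots> = (\<Oplus>\<gamma>\<in>\<Gamma>. ?k \<gamma> \<gamma>)"
        by (rule finsum_cong_fun, rule finsum_delta) (simp_all add: cl)
      also have "\<dots> = (\<Oplus>\<tau>\<in>\<Gamma>. if c \<tau> p0 = p \<and> p = q then \<tau> t else \<zero>)"
        by (rule finsum_cong_fun) auto
      finally show ?thesis .
    qed
    have "lsum E (\<lambda>(e, f). e p \<otimes> f q) es
        = lsum E (\<lambda>p0. lsum E (\<lambda>x. orbit_sum (snd x) p0 p \<otimes> orbit_sum (t \<otimes> fst x) p0 q) xs) ps"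
    proof -
      have "lsum E (\<lambda>(e, f). e p \<otimes> f q) es
        = lsum E (lsum E (\<lambda>(e, f). e p \<otimes> f q)) (map (\<lambda>p0. map (\<lambda>x. (orbit_sum (snd x) p0, orbit_sum (t \<otimes> fst x) p0)) xs) ps)"
        unfolding es_def
      proof (rule lsum_concat)
        fix l z assume "l \<in> set (map (\<lambda>p0. map (\<lambda>x. (orbit_sum (snd x) p0, orbit_sum (t \<otimes> fst x) p0)) xs) ps)"
          and "z \<in> set l"
        then have "fst z \<in> carrier A" "snd z \<in> carrier A"
          using ps(2) t(1) xp by (auto intro!: orbit_sum_closed)
        then show "(case z of (e, f) \<Rightarrow> e p \<otimes> f q) \<in> carrier E"
          using p q by (simp add: case_prod_unfold A_closed)
      qed
      then show ?thesis by (simp add: lsum_map)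
    qed
    also have "\<dots> = lsum E (\<lambda>p0. \<Oplus>\<tau>\<in>\<Gamma>. if c \<tau> p0 = p \<and> p = q then \<tau> t else \<zero>) ps"
      using ps inner by (intro lsum_cong) auto
    also have "\<dots> = (\<Oplus>p0\<in>carrier P. \<Oplus>\<tau>\<in>\<Gamma>. if c \<tau> p0 = p \<and> p = q then \<tau> t else \<zero>)"
      using lsum_distinct[OF ps(1), of "\<lambda>p0. \<Oplus>\<tau>\<in>\<Gamma>. if c \<tau> p0 = p \<and> p = q then \<tau> t else \<zero>"] ps(2)
      by (simp add: cl)
    also have "\<dots> = (\<Oplus>\<tau>\<in>\<Gamma>. \<Oplus>p0\<in>carrier P. if c \<tau> p0 = p \<and> p = q then \<tau> t else \<zero>)"
      by (rule finsum_swap) (simp_all add: cl)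
    also have "\<dots> = (\<Oplus>\<tau>\<in>\<Gamma>. if p = q then \<tau> t else \<zero>)"
    proof (rule finsum_cong_fun)
      fix \<tau> assume s: "\<tau> \<in> \<Gamma>"
      have "(\<Oplus>p0\<in>carrier P. if c \<tau> p0 = p \<and> p = q then \<tau> t else \<zero>)
          = (\<Oplus>p0\<in>carrier P. if p0 = p \<and> p = q then \<tau> t else \<zero>)"
        using s t by (intro sum_c[of \<tau> "\<lambda>p0. if p0 = p \<and> p = q then \<tau> t else \<zero>"]) (simp_all add: gal_props)
      also have "\<dots> = (if p = q then \<tau> t else \<zero>)"
        using finsum_delta'[OF finite_P p, of "\<lambda>_. \<tau> t"] s t by (auto simp: gal_props intro: finsum_zero_fun)
      finally show "(\<Oplus>p0\<in>carrier P. if c \<tau> p0 = p \<and> p = q then \<tau> t else \<zero>) = (if p = q then \<tau> t else \<zero>)" .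
    qed
    also have "\<dots> = (if p = q then \<one> else \<zero>)"
      using t by (auto simp: trace_def intro: finsum_zero_fun)
    finally show ?thesis .
  qed
  then show ?thesis using es by blast
qed

definition duals where
  "duals = (SOME es. set es \<subseteq> carrier A \<times> carrier A \<and> (\<forall>p\<in>carrier P. \<forall>q\<in>carrier P.
     lsum E (\<lambda>(e, f). e p \<otimes> f q) es = (if p = q then \<one> else \<zero>)))"

lemma duals_mem: "x \<in> set duals \<Longrightarrow> fst x \<in> carrier A" "x \<in> set duals \<Longrightarrow> snd x \<in> carrier A"
  and duals_delta: "p \<in> carrier P \<Longrightarrow> q \<in> carrier P \<Longrightarrow>
     lsum E (\<lambda>x. fst x p \<otimes> snd x q) duals = (if p = q then \<one> else \<zero>)"
  using someI_ex[OF dual_families_exist] unfolding duals_def[symmetric]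
  by (auto simp: case_prod_unfold)

lemma A_add: "a \<in> carrier A \<Longrightarrow> b \<in> carrier A \<Longrightarrow> a \<oplus>\<^bsub>A\<^esub> b \<in> carrier A"
  by (rule A_memI) (simp_all add: A_simps(2-) A_extensional A_closed A_equivariant gal_props c_closed)

lemma A_zero: "\<zero>\<^bsub>A\<^esub> \<in> carrier A"
  by (rule A_memI) (simp_all add: A_simps(2-) A_extensional gal_props c_closed)

lemma A_smult: "r \<in> F \<Longrightarrow> a \<in> carrier A \<Longrightarrow> r \<odot>\<^bsub>A\<^esub> a \<in> carrier A"
  using F_sub
  by (intro A_memI) (auto simp add: A_simps(2-) A_extensional A_closed A_equivariant gal_props c_closed)

lemma lsum_A_apply: "p \<in> carrier P \<Longrightarrow> lsum A g xs p = lsum E (\<lambda>x. g x p) xs"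
  by (induction xs) (auto simp: A_simps(2-))

lemma lsum_A_closed: "(\<And>x. x \<in> set xs \<Longrightarrow> g x \<in> carrier A) \<Longrightarrow> lsum A g xs \<in> carrier A"
  by (induction xs) (auto intro: A_add A_zero)

lemma dual_expansion:
  assumes a: "a \<in> carrier A"
  shows "lsum A (\<lambda>x. (\<Oplus>p\<in>carrier P. snd x p \<otimes> a p) \<odot>\<^bsub>A\<^esub> fst x) duals = a"
proof (rule A_eqI[OF _ a])
  show "lsum A (\<lambda>x. (\<Oplus>p\<in>carrier P. snd x p \<otimes> a p) \<odot>\<^bsub>A\<^esub> fst x) duals \<in> carrier A"
    by (rule lsum_A_closed, rule A_smult) (simp_all add: pairing_in_F duals_mem a)
  fix q assume q: "q \<in> carrier P"
  show "lsum A (\<lambda>x. (\<Oplus>p\<in>carrier P. snd x p \<otimes> a p) \<odot>\<^bsub>A\<^esub> fst x) duals q = a q"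
    using q a by (simp add: lsum_A_apply A_simps(2-),
      intro dual_families_contract) (simp_all add: duals_mem A_closed finite_P duals_delta)
qed

lemma A_frame: "frame A (carrier P) (\<lambda>a p. a p) duals"
  unfolding frame_def
proof (intro conjI allI impI ballI finite_P)
  show "set duals \<subseteq> carrier A \<times> (carrier P \<rightarrow> carrier E)"
  proof
    fix x assume "x \<in> set duals"
    then show "x \<in> carrier A \<times> (carrier P \<rightarrow> carrier E)"
      using duals_mem[of x] A_closed by (auto simp: mem_Times_iff)
  qed
next
  fix \<phi> v assume phi: "linear_map (E\<lparr>carrier := F\<rparr>) A (ext_module E F) \<phi>" and v: "v \<in> carrier A"
  note lin = linear_map_ext_moduleD[OF phi]
  let ?c = "\<lambda>x. \<Oplus>p\<in>carrier P. snd x p \<otimes> v p"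
  have "\<phi> (lsum A (\<lambda>x. ?c x \<odot>\<^bsub>A\<^esub> fst x) xs) = lsum E (\<lambda>x. ?c x \<otimes> \<phi> (fst x)) xs"
    if "set xs \<subseteq> set duals" for xs
    using that
  proof (induction xs)
    case Nil
    have "\<phi> \<zero>\<^bsub>A\<^esub> = \<phi> (\<zero> \<odot>\<^bsub>A\<^esub> \<zero>\<^bsub>A\<^esub>)"
      by (rule arg_cong[where f = \<phi>], rule A_eqI)
        (use A_zero A_smult subringE(2)[OF subfieldE(1)[OF subfield]] in \<open>auto simp: A_simps(2-)\<close>)
    also have "\<dots> = \<zero>"
      using lin(3)[of \<zero> "\<zero>\<^bsub>A\<^esub>"] lin(1)[of "\<zero>\<^bsub>A\<^esub>"] A_zero subringE(2)[OF subfieldE(1)[OF subfield]] F_sub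
      by auto
    finally show ?case by simp
  next
    case (Cons x xs)
    have sm: "?c y \<odot>\<^bsub>A\<^esub> fst y \<in> carrier A" if "y \<in> set duals" for y
      using that by (intro A_smult pairing_in_F duals_mem v)
    have "lsum A (\<lambda>x. ?c x \<odot>\<^bsub>A\<^esub> fst x) xs \<in> carrier A"
      using sm Cons.prems by (intro lsum_A_closed) auto
    then show ?case
      using Cons sm[of x] duals_mem[of x] lin(2) lin(3)[OF pairing_in_F[OF _ v]] by simp
  qed
  from this[OF subset_refl] show "\<phi> v = lsum E (\<lambda>(e, f). (\<Oplus>i\<in>carrier P. f i \<otimes> v i) \<otimes> \<phi> e) duals"
    by (simp add: dual_expansion[OF v] case_prod_unfold)
qed (rule A_closed)

text \<open>Since \<open>\<Sum> e p \<cdot> f q\<close> over the dual families is the Kronecker delta, \<open>\<Sum> e \<otimes> (f a)\<close> represents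
  \<open>\<Sum> a\<^sub>p (p \<otimes> p)\<close>.  This shows that the comultiplication exists.\<close>

definition split where
  "split a = map (\<lambda>x. (fst x, pointwise (snd x) a)) duals"

lemma split_mem: "a \<in> carrier A \<Longrightarrow> set (split a) \<subseteq> carrier A \<times> carrier A"
  unfolding split_def set_map by (rule image_subsetI) (simp add: duals_mem pointwise_closed)

lemma split_matrix:
  assumes "a \<in> carrier A" "p \<in> carrier P" "q \<in> carrier P"
  shows "lsum E (\<lambda>(u, v). u p \<otimes> v q) (split a) = (if p = q then a p else \<zero>)"
proof -
  have "lsum E (\<lambda>(u, v). u p \<otimes> v q) (split a) = lsum E (\<lambda>x. (fst x p \<otimes> snd x q) \<otimes> a q) duals"
    unfolding split_def lsum_map
    by (rule lsum_cong) (simp add: assms pointwise_def A_closed duals_mem m_assoc)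
  also have "\<dots> = lsum E (\<lambda>x. fst x p \<otimes> snd x q) duals \<otimes> a q"
    by (rule lsum_mult_right[symmetric]) (simp_all add: assms A_closed duals_mem)
  finally show ?thesis using assms by (simp add: duals_delta A_closed)
qed

lemma comult_mem: "a \<in> carrier A \<Longrightarrow> set (comult A a) \<subseteq> carrier A \<times> carrier A"
  and comult_matrix: "a \<in> carrier A \<Longrightarrow> p \<in> carrier P \<Longrightarrow> q \<in> carrier P \<Longrightarrow>
    lsum E (\<lambda>(u, v). u p \<otimes> v q) (comult A a) = (if p = q then a p else \<zero>)"
proof -
  have "set (comult A a) \<subseteq> carrier A \<times> carrier A \<and> (\<forall>p\<in>carrier P. \<forall>q\<in>carrier P.
    lsum E (\<lambda>(u, v). u p \<otimes> v q) (comult A a) = (if p = q then a p else \<zero>))" if "a \<in> carrier A"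
  proof -
    have "comult A a = (SOME xs. set xs \<subseteq> carrier A \<times> carrier A \<and> (\<forall>p\<in>carrier P. \<forall>q\<in>carrier P.
        lsum E (\<lambda>(u, v). u p \<otimes> v q) xs = (if p = q then a p else \<zero>)))"
      by (simp add: descended_hopf_def)
    then show ?thesis
      using someI[of "\<lambda>xs. set xs \<subseteq> carrier A \<times> carrier A \<and> (\<forall>p\<in>carrier P. \<forall>q\<in>carrier P.
        lsum E (\<lambda>(u, v). u p \<otimes> v q) xs = (if p = q then a p else \<zero>))" "split a"]
        split_mem[OF that] split_matrix[OF that] by simp
  qed
  then show "a \<in> carrier A \<Longrightarrow> set (comult A a) \<subseteq> carrier A \<times> carrier A"
    "a \<in> carrier A \<Longrightarrow> p \<in> carrier P \<Longrightarrow> q \<in> carrier P \<Longrightarrow>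
      lsum E (\<lambda>(u, v). u p \<otimes> v q) (comult A a) = (if p = q then a p else \<zero>)" by blast+
qed

lemmas A_tensor_eqI = tensor_eqI[OF A_frame A_frame]

end

section \<open>The Hopf algebra axioms\<close>

context gal_group_action
begin

text \<open>For \<open>g\<close> the constant \<open>1\<close>, or the values at one element under the action, this gives the
  compatibility of the product with the counit and with the action.\<close>

lemma convolution_sum:
  assumes a: "a \<in> carrier A" and b: "b \<in> carrier A" and g: "\<And>r. r \<in> carrier P \<Longrightarrow> g r \<in> carrier E"
  shows "(\<Oplus>r\<in>carrier P. (a \<otimes>\<^bsub>A\<^esub> b) r \<otimes> g r)
    = (\<Oplus>p\<in>carrier P. \<Oplus>q\<in>carrier P. a p \<otimes> b q \<otimes> g (p \<otimes>\<^bsub>P\<^esub> q))"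
proof -
  note cl = A_closed[OF a] A_closed[OF b] g finite_P
  have "(\<Oplus>r\<in>carrier P. (a \<otimes>\<^bsub>A\<^esub> b) r \<otimes> g r)
      = (\<Oplus>r\<in>carrier P. \<Oplus>p\<in>carrier P. a p \<otimes> b (inv\<^bsub>P\<^esub> p \<otimes>\<^bsub>P\<^esub> r) \<otimes> g r)"
    by (rule finsum_cong_fun) (simp add: A_simps(6) finsum_mult_right cl)
  also have "\<dots> = (\<Oplus>p\<in>carrier P. \<Oplus>r\<in>carrier P. a p \<otimes> b (inv\<^bsub>P\<^esub> p \<otimes>\<^bsub>P\<^esub> r) \<otimes> g r)"
    by (rule finsum_swap) (simp_all add: cl)
  also have "\<dots> = (\<Oplus>p\<in>carrier P. \<Oplus>q\<in>carrier P. a p \<otimes> b q \<otimes> g (p \<otimes>\<^bsub>P\<^esub> q))"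
  proof (rule finsum_cong_fun)
    fix p assume p: "p \<in> carrier P"
    have "bij_betw (\<lambda>q. p \<otimes>\<^bsub>P\<^esub> q) (carrier P) (carrier P)"
      using p by (intro bij_betwI[where g = "\<lambda>r. inv\<^bsub>P\<^esub> p \<otimes>\<^bsub>P\<^esub> r"]) (simp_all flip: P.m_assoc)
    from finsum_bij[OF this, of "\<lambda>r. a p \<otimes> b (inv\<^bsub>P\<^esub> p \<otimes>\<^bsub>P\<^esub> r) \<otimes> g r"]
    show "(\<Oplus>r\<in>carrier P. a p \<otimes> b (inv\<^bsub>P\<^esub> p \<otimes>\<^bsub>P\<^esub> r) \<otimes> g r)
        = (\<Oplus>q\<in>carrier P. a p \<otimes> b q \<otimes> g (p \<otimes>\<^bsub>P\<^esub> q))"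
      using p by (simp add: cl flip: P.m_assoc cong: finsum_cong_fun)
  qed
  finally show ?thesis .
qed

lemma A_one: "\<one>\<^bsub>A\<^esub> \<in> carrier A"
proof (rule A_memI)
  fix \<gamma> p assume "\<gamma> \<in> \<Gamma>" "p \<in> carrier P"
  moreover then have "c \<gamma> p = \<one>\<^bsub>P\<^esub> \<longleftrightarrow> p = \<one>\<^bsub>P\<^esub>" using c_inj[of \<gamma> p "\<one>\<^bsub>P\<^esub>"] by (simp add: c_one)
  ultimately show "\<one>\<^bsub>A\<^esub> (c \<gamma> p) = \<gamma> (\<one>\<^bsub>A\<^esub> p)" by (simp add: A_simps(5) c_closed gal_props)
qed (simp_all add: A_simps(5) A_extensional)

lemma A_mult:
  assumes a: "a \<in> carrier A" and b: "b \<in> carrier A"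
  shows "a \<otimes>\<^bsub>A\<^esub> b \<in> carrier A"
proof (rule A_memI)
  note cl = A_closed[OF a] A_closed[OF b] finite_P
  show "(a \<otimes>\<^bsub>A\<^esub> b) p \<in> carrier E" if "p \<in> carrier P" for p
    using that by (simp add: A_simps(6) cl)
  fix \<gamma> q assume g: "\<gamma> \<in> \<Gamma>" and q: "q \<in> carrier P"
  show "(a \<otimes>\<^bsub>A\<^esub> b) (c \<gamma> q) = \<gamma> ((a \<otimes>\<^bsub>A\<^esub> b) q)"
    unfolding A_simps(6)[OF q] A_simps(6)[OF c_closed[OF g q]]
  proof (rule gal_sum_equivariant[OF g, symmetric])
    fix p assume p: "p \<in> carrier P"
    have "inv\<^bsub>P\<^esub> (c \<gamma> p) \<otimes>\<^bsub>P\<^esub> c \<gamma> q = c \<gamma> (inv\<^bsub>P\<^esub> p \<otimes>\<^bsub>P\<^esub> q)"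
      using g p q by (simp add: c_mult c_inv)
    then show "a (c \<gamma> p) \<otimes> b (inv\<^bsub>P\<^esub> (c \<gamma> p) \<otimes>\<^bsub>P\<^esub> c \<gamma> q) = \<gamma> (a p \<otimes> b (inv\<^bsub>P\<^esub> p \<otimes>\<^bsub>P\<^esub> q))"
      using g p q by (simp add: A_equivariant a b gal_props cl)
  qed (use g q in \<open>simp_all add: cl c_closed\<close>)
qed (simp add: A_extensional)

lemma A_mult_assoc:
  assumes a: "a \<in> carrier A" and b: "b \<in> carrier A" and d: "d \<in> carrier A"
  shows "(a \<otimes>\<^bsub>A\<^esub> b) \<otimes>\<^bsub>A\<^esub> d = a \<otimes>\<^bsub>A\<^esub> (b \<otimes>\<^bsub>A\<^esub> d)"
proof (rule A_eqI)
  note cl = A_closed[OF a] A_closed[OF b] A_closed[OF d] finite_P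
  fix q assume q: "q \<in> carrier P"
  have "((a \<otimes>\<^bsub>A\<^esub> b) \<otimes>\<^bsub>A\<^esub> d) q = (\<Oplus>p\<in>carrier P. \<Oplus>s\<in>carrier P. a p \<otimes> b s \<otimes> d (inv\<^bsub>P\<^esub> (p \<otimes>\<^bsub>P\<^esub> s) \<otimes>\<^bsub>P\<^esub> q))"
    unfolding A_simps(6)[OF q, of "a \<otimes>\<^bsub>A\<^esub> b"]
    by (rule convolution_sum[OF a b]) (simp add: cl q)
  also have "\<dots> = (\<Oplus>p\<in>carrier P. a p \<otimes> (b \<otimes>\<^bsub>A\<^esub> d) (inv\<^bsub>P\<^esub> p \<otimes>\<^bsub>P\<^esub> q))"
  proof (rule finsum_cong_fun)
    fix p assume p: "p \<in> carrier P"
    show "(\<Oplus>s\<in>carrier P. a p \<otimes> b s \<otimes> d (inv\<^bsub>P\<^esub> (p \<otimes>\<^bsub>P\<^esub> s) \<otimes>\<^bsub>P\<^esub> q)) = a p \<otimes> (b \<otimes>\<^bsub>A\<^esub> d) (inv\<^bsub>P\<^esub> p \<otimes>\<^bsub>P\<^esub> q)"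
      using p q by (simp add: A_simps(6) finsum_mult_left cl m_assoc P.inv_mult_group P.m_assoc
          cong: finsum_cong_fun)
  qed
  finally show "((a \<otimes>\<^bsub>A\<^esub> b) \<otimes>\<^bsub>A\<^esub> d) q = (a \<otimes>\<^bsub>A\<^esub> (b \<otimes>\<^bsub>A\<^esub> d)) q"
    using q by (simp add: A_simps(6))
qed (intro A_mult a b d)+

lemma A_abelian_group: "abelian_group A"
proof (rule abelian_groupI)
  fix x assume x: "x \<in> carrier A"
  let ?y = "\<lambda>p\<in>carrier P. \<ominus> x p"
  have "?y \<in> carrier A"
    using x by (intro A_memI)
      (simp_all add: A_closed A_equivariant c_closed gal_minus[OF ring_axioms, of _ F])
  moreover then have "?y \<oplus>\<^bsub>A\<^esub> x = \<zero>\<^bsub>A\<^esub>"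
    using x by (intro A_eqI A_add A_zero) (simp_all add: A_simps(2-) A_closed l_neg)
  ultimately show "\<exists>y\<in>carrier A. y \<oplus>\<^bsub>A\<^esub> x = \<zero>\<^bsub>A\<^esub>" by blast
qed (intro A_add A_zero A_eqI; simp add: A_simps(2-) A_closed A_add A_zero a_ac)+

lemma A_ring: "ring A"
proof (rule ringI[OF A_abelian_group])
  show "monoid A"
  proof (rule monoidI)
    fix a assume a: "a \<in> carrier A"
    show "\<one>\<^bsub>A\<^esub> \<otimes>\<^bsub>A\<^esub> a = a"
    proof (rule A_eqI[OF A_mult[OF A_one a] a])
      fix q assume q: "q \<in> carrier P"
      have "(\<one>\<^bsub>A\<^esub> \<otimes>\<^bsub>A\<^esub> a) q = (\<Oplus>p\<in>carrier P. if p = \<one>\<^bsub>P\<^esub> then a (inv\<^bsub>P\<^esub> p \<otimes>\<^bsub>P\<^esub> q) else \<zero>)"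
        unfolding A_simps(6)[OF q] using q a by (intro finsum_cong_fun) (simp add: A_simps(5) A_closed)
      also have "\<dots> = a q" using finsum_delta'[OF finite_P P.one_closed, of "\<lambda>p. a (inv\<^bsub>P\<^esub> p \<otimes>\<^bsub>P\<^esub> q)"] q a
        by (simp add: A_closed)
      finally show "(\<one>\<^bsub>A\<^esub> \<otimes>\<^bsub>A\<^esub> a) q = a q" .
    qed
    show "a \<otimes>\<^bsub>A\<^esub> \<one>\<^bsub>A\<^esub> = a"
    proof (rule A_eqI[OF A_mult[OF a A_one] a])
      fix q assume q: "q \<in> carrier P"
      have "(a \<otimes>\<^bsub>A\<^esub> \<one>\<^bsub>A\<^esub>) q = (\<Oplus>p\<in>carrier P. if p = q then a p else \<zero>)"
        unfolding A_simps(6)[OF q]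
      proof (rule finsum_cong_fun)
        fix p assume p: "p \<in> carrier P"
        then have "inv\<^bsub>P\<^esub> p \<otimes>\<^bsub>P\<^esub> q = \<one>\<^bsub>P\<^esub> \<longleftrightarrow> p = q"
          using q P.inv_solve_left'[of "\<one>\<^bsub>P\<^esub>" p q] by auto
        then show "a p \<otimes> \<one>\<^bsub>A\<^esub> (inv\<^bsub>P\<^esub> p \<otimes>\<^bsub>P\<^esub> q) = (if p = q then a p else \<zero>)"
          using p q a by (simp add: A_simps(5) A_closed)
      qed
      also have "\<dots> = a q" using finsum_delta'[OF finite_P q, of a] q a by (simp add: A_closed)
      finally show "(a \<otimes>\<^bsub>A\<^esub> \<one>\<^bsub>A\<^esub>) q = a q" .
    qed
  qed (simp_all add: A_mult A_one A_mult_assoc)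
  fix x y z assume xyz: "x \<in> carrier A" "y \<in> carrier A" "z \<in> carrier A"
  show "(x \<oplus>\<^bsub>A\<^esub> y) \<otimes>\<^bsub>A\<^esub> z = x \<otimes>\<^bsub>A\<^esub> z \<oplus>\<^bsub>A\<^esub> y \<otimes>\<^bsub>A\<^esub> z"
    using xyz by (intro A_eqI A_mult A_add)
      (simp_all add: A_simps(2) A_simps(6) A_closed l_distr finsum_add_fun cong: finsum_cong_fun)
  show "z \<otimes>\<^bsub>A\<^esub> (x \<oplus>\<^bsub>A\<^esub> y) = z \<otimes>\<^bsub>A\<^esub> x \<oplus>\<^bsub>A\<^esub> z \<otimes>\<^bsub>A\<^esub> y"
    using xyz by (intro A_eqI A_mult A_add)
      (simp_all add: A_simps(2) A_simps(6) A_closed r_distr finsum_add_fun cong: finsum_cong_fun)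
qed

lemma F_field: "field (E\<lparr>carrier := F\<rparr>)"
  by (rule subfield_iff(2)[OF subfield])

lemma F_in: "r \<in> F \<Longrightarrow> r \<in> carrier E"
  using F_sub by auto

lemma A_module: "module (E\<lparr>carrier := F\<rparr>) A"
proof (rule moduleI)
  show "cring (E\<lparr>carrier := F\<rparr>)" using F_field by (rule fieldE(1))
qed (simp_all add: A_abelian_group A_smult,
  (rule A_eqI; simp add: A_add A_smult subringE[OF subfieldE(1)[OF subfield]] A_simps(2-) A_closed F_in
      l_distr r_distr m_assoc)+)

lemma counit_in_F: "a \<in> carrier A \<Longrightarrow> counit A a \<in> F"
  unfolding A_simps(7) by (rule sum_equivariant_in_F) (simp_all add: A_closed A_equivariant)

lemma counit_linear_A: "linear_map (E\<lparr>carrier := F\<rparr>) A (ext_module E F) (counit A)"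
  by (rule linear_map_ext_moduleI)
    (simp_all add: counit_in_F, simp_all add: A_simps(2-) A_closed F_in finsum_add_fun finsum_mult_left finite_P
      cong: finsum_cong_fun)

lemma counit_mult_A:
  assumes a: "a \<in> carrier A" and b: "b \<in> carrier A"
  shows "counit A (a \<otimes>\<^bsub>A\<^esub> b) = counit A a \<otimes> counit A b"
proof -
  have "counit A (a \<otimes>\<^bsub>A\<^esub> b) = (\<Oplus>r\<in>carrier P. (a \<otimes>\<^bsub>A\<^esub> b) r \<otimes> \<one>)"
    unfolding A_simps(7) using a b by (intro finsum_cong_fun) (simp add: A_closed A_mult)
  also have "\<dots> = (\<Oplus>p\<in>carrier P. \<Oplus>q\<in>carrier P. a p \<otimes> b q \<otimes> \<one>)"
    by (rule convolution_sum[OF a b]) simp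
  also have "\<dots> = (\<Oplus>p\<in>carrier P. a p \<otimes> counit A b)"
    unfolding A_simps(7) using a b
    by (intro finsum_cong_fun) (simp add: A_closed finsum_mult_left finite_P cong: finsum_cong_fun)
  also have "\<dots> = counit A a \<otimes> counit A b"
    unfolding A_simps(7)[of a] using a counit_in_F[OF b]
    by (intro finsum_mult_right[symmetric]) (simp_all add: A_closed finite_P F_in)
  finally show ?thesis .
qed

lemma antipode_closed: "a \<in> carrier A \<Longrightarrow> antipode A a \<in> carrier A"
  by (rule A_memI) (simp_all add: A_simps(8) A_extensional A_closed A_equivariant c_closed flip: c_inv)

lemma comult_val: "a \<in> carrier A \<Longrightarrow> x \<in> set (comult A a) \<Longrightarrow> fst x \<in> carrier A \<and> snd x \<in> carrier A"
  using comult_mem[of a] by auto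

lemma comult_matrix': "a \<in> carrier A \<Longrightarrow> p \<in> carrier P \<Longrightarrow> q \<in> carrier P \<Longrightarrow>
    lsum E (\<lambda>x. fst x p \<otimes> snd x q) (comult A a) = (if p = q then a p else \<zero>)"
  using comult_matrix[of a p q] by (simp add: case_prod_unfold)

text \<open>Sums over the comultiplication are sums over the diagonal.\<close>

lemma comult_diagonal:
  assumes a: "a \<in> carrier A" and g: "\<And>p q. p \<in> carrier P \<Longrightarrow> q \<in> carrier P \<Longrightarrow> g p q \<in> carrier E"
  shows "lsum E (\<lambda>x. \<Oplus>p\<in>carrier P. \<Oplus>q\<in>carrier P. (fst x p \<otimes> snd x q) \<otimes> g p q) (comult A a)
    = (\<Oplus>p\<in>carrier P. a p \<otimes> g p p)"
proof -
  note cl = A_closed[OF a] comult_val[OF a] A_closed g finite_P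
  have "lsum E (\<lambda>x. \<Oplus>p\<in>carrier P. \<Oplus>q\<in>carrier P. (fst x p \<otimes> snd x q) \<otimes> g p q) (comult A a)
      = (\<Oplus>p\<in>carrier P. \<Oplus>q\<in>carrier P. lsum E (\<lambda>x. fst x p \<otimes> snd x q) (comult A a) \<otimes> g p q)"
    by (simp add: lsum_finsum_swap lsum_mult_right cl cong: finsum_cong_fun)
  also have "\<dots> = (\<Oplus>p\<in>carrier P. \<Oplus>q\<in>carrier P. if p = q then a p \<otimes> g p q else \<zero>)"
    by (rule finsum_cong_fun, rule finsum_cong_fun) (simp add: comult_matrix'[OF a] cl)
  also have "\<dots> = (\<Oplus>p\<in>carrier P. a p \<otimes> g p p)"
    by (rule finsum_cong_fun, rule finsum_delta) (simp_all add: cl)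
  finally show ?thesis .
qed

end

lemma bilinear_formI:
  assumes "\<And>v w. v \<in> carrier V \<Longrightarrow> w \<in> carrier W \<Longrightarrow> \<beta> v w \<in> F"
    and "\<And>v v' w. v \<in> carrier V \<Longrightarrow> v' \<in> carrier V \<Longrightarrow> w \<in> carrier W \<Longrightarrow> \<beta> (v \<oplus>\<^bsub>V\<^esub> v') w = \<beta> v w \<oplus>\<^bsub>E\<^esub> \<beta> v' w"
    and "\<And>r v w. r \<in> F \<Longrightarrow> v \<in> carrier V \<Longrightarrow> w \<in> carrier W \<Longrightarrow> \<beta> (r \<odot>\<^bsub>V\<^esub> v) w = r \<otimes>\<^bsub>E\<^esub> \<beta> v w"
    and "\<And>v w w'. v \<in> carrier V \<Longrightarrow> w \<in> carrier W \<Longrightarrow> w' \<in> carrier W \<Longrightarrow> \<beta> v (w \<oplus>\<^bsub>W\<^esub> w') = \<beta> v w \<oplus>\<^bsub>E\<^esub> \<beta> v w'"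
    and "\<And>r v w. r \<in> F \<Longrightarrow> v \<in> carrier V \<Longrightarrow> w \<in> carrier W \<Longrightarrow> \<beta> v (r \<odot>\<^bsub>W\<^esub> w) = r \<otimes>\<^bsub>E\<^esub> \<beta> v w"
  shows "bilinear_form (E\<lparr>carrier := F\<rparr>) V W \<beta>"
  unfolding bilinear_form_def using assms by (auto intro!: linear_map_ext_moduleI)

lemma bilinear_form_simps:
  assumes "bilinear_form (E\<lparr>carrier := F\<rparr>) V W \<beta>"
  shows "v \<in> carrier V \<Longrightarrow> w \<in> carrier W \<Longrightarrow> \<beta> v w \<in> F"
    and "v \<in> carrier V \<Longrightarrow> v' \<in> carrier V \<Longrightarrow> w \<in> carrier W \<Longrightarrow> \<beta> (v \<oplus>\<^bsub>V\<^esub> v') w = \<beta> v w \<oplus>\<^bsub>E\<^esub> \<beta> v' w"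
    and "r \<in> F \<Longrightarrow> v \<in> carrier V \<Longrightarrow> w \<in> carrier W \<Longrightarrow> \<beta> (r \<odot>\<^bsub>V\<^esub> v) w = r \<otimes>\<^bsub>E\<^esub> \<beta> v w"
    and "v \<in> carrier V \<Longrightarrow> w \<in> carrier W \<Longrightarrow> w' \<in> carrier W \<Longrightarrow> \<beta> v (w \<oplus>\<^bsub>W\<^esub> w') = \<beta> v w \<oplus>\<^bsub>E\<^esub> \<beta> v w'"
    and "r \<in> F \<Longrightarrow> v \<in> carrier V \<Longrightarrow> w \<in> carrier W \<Longrightarrow> \<beta> v (r \<odot>\<^bsub>W\<^esub> w) = r \<otimes>\<^bsub>E\<^esub> \<beta> v w"
  using linear_map_ext_moduleD[OF bilinear_formD(1)[OF assms]]
    linear_map_ext_moduleD[OF bilinear_formD(2)[OF assms]] by auto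

lemma trilinear_form_simps:
  assumes "trilinear_form (E\<lparr>carrier := F\<rparr>) V \<tau>" and u: "u \<in> carrier V" and v: "v \<in> carrier V" and w: "w \<in> carrier V"
  shows "\<tau> u v w \<in> F"
    and "u' \<in> carrier V \<Longrightarrow> \<tau> (u \<oplus>\<^bsub>V\<^esub> u') v w = \<tau> u v w \<oplus>\<^bsub>E\<^esub> \<tau> u' v w"
    and "r \<in> F \<Longrightarrow> \<tau> (r \<odot>\<^bsub>V\<^esub> u) v w = r \<otimes>\<^bsub>E\<^esub> \<tau> u v w"
    and "v' \<in> carrier V \<Longrightarrow> \<tau> u (v \<oplus>\<^bsub>V\<^esub> v') w = \<tau> u v w \<oplus>\<^bsub>E\<^esub> \<tau> u v' w"
    and "r \<in> F \<Longrightarrow> \<tau> u (r \<odot>\<^bsub>V\<^esub> v) w = r \<otimes>\<^bsub>E\<^esub> \<tau> u v w"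
    and "w' \<in> carrier V \<Longrightarrow> \<tau> u v (w \<oplus>\<^bsub>V\<^esub> w') = \<tau> u v w \<oplus>\<^bsub>E\<^esub> \<tau> u v w'"
    and "r \<in> F \<Longrightarrow> \<tau> u v (r \<odot>\<^bsub>V\<^esub> w) = r \<otimes>\<^bsub>E\<^esub> \<tau> u v w"
proof -
  have bl: "bilinear_form (E\<lparr>carrier := F\<rparr>) V V (\<tau> u)"
    using assms by (auto simp: trilinear_form_def)
  have "linear_map (E\<lparr>carrier := F\<rparr>) V (ext_module E F) (\<lambda>u. \<tau> u v w)"
    using assms by (auto simp: trilinear_form_def)
  note lin = linear_map_ext_moduleD[OF this]
  show "\<tau> u v w \<in> F"
    and "u' \<in> carrier V \<Longrightarrow> \<tau> (u \<oplus>\<^bsub>V\<^esub> u') v w = \<tau> u v w \<oplus>\<^bsub>E\<^esub> \<tau> u' v w"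
    and "r \<in> F \<Longrightarrow> \<tau> (r \<odot>\<^bsub>V\<^esub> u) v w = r \<otimes>\<^bsub>E\<^esub> \<tau> u v w"
    using lin u by auto
  show "v' \<in> carrier V \<Longrightarrow> \<tau> u (v \<oplus>\<^bsub>V\<^esub> v') w = \<tau> u v w \<oplus>\<^bsub>E\<^esub> \<tau> u v' w"
    and "r \<in> F \<Longrightarrow> \<tau> u (r \<odot>\<^bsub>V\<^esub> v) w = r \<otimes>\<^bsub>E\<^esub> \<tau> u v w"
    and "w' \<in> carrier V \<Longrightarrow> \<tau> u v (w \<oplus>\<^bsub>V\<^esub> w') = \<tau> u v w \<oplus>\<^bsub>E\<^esub> \<tau> u v w'"
    and "r \<in> F \<Longrightarrow> \<tau> u v (r \<odot>\<^bsub>V\<^esub> w) = r \<otimes>\<^bsub>E\<^esub> \<tau> u v w"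
    using bilinear_form_simps[OF bl] v w by auto
qed

lemma (in module) lsum_smult_as_finsum:
  assumes "\<And>x. x \<in> set xs \<Longrightarrow> r x \<in> carrier R" "\<And>x. x \<in> set xs \<Longrightarrow> b x \<in> carrier M"
  shows "\<exists>k\<in>b ` set xs \<rightarrow> carrier R.
    lsum M (\<lambda>x. r x \<odot>\<^bsub>M\<^esub> b x) xs = (\<Oplus>\<^bsub>M\<^esub>y\<in>b ` set xs. k y \<odot>\<^bsub>M\<^esub> y)"
  using assms
proof (induction xs)
  case Nil
  then show ?case by (simp add: M.finsum_empty)
next
  case (Cons x xs)
  let ?B = "b ` set xs" and ?B' = "b ` set xs - {b x}"
  obtain k where k: "k \<in> ?B \<rightarrow> carrier R"
    "lsum M (\<lambda>x. r x \<odot>\<^bsub>M\<^esub> b x) xs = (\<Oplus>\<^bsub>M\<^esub>y\<in>?B. k y \<odot>\<^bsub>M\<^esub> y)"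
    using Cons by auto
  define k0 where "k0 = (if b x \<in> ?B then k (b x) else \<zero>)"
  have bx: "b x \<in> carrier M" "r x \<in> carrier R" using Cons.prems by auto
  have Bc: "y \<in> carrier M" if "y \<in> ?B" for y using Cons.prems that by auto
  have kc: "k y \<in> carrier R" if "y \<in> ?B" for y using k(1) that by auto
  have k0: "k0 \<in> carrier R" using kc by (auto simp: k0_def)
  have rest: "(\<Oplus>\<^bsub>M\<^esub>y\<in>?B'. k y \<odot>\<^bsub>M\<^esub> y) \<in> carrier M"
    using Bc kc by (intro M.finsum_closed) auto
  have "(\<Oplus>\<^bsub>M\<^esub>y\<in>?B. k y \<odot>\<^bsub>M\<^esub> y) = k0 \<odot>\<^bsub>M\<^esub> b x \<oplus>\<^bsub>M\<^esub> (\<Oplus>\<^bsub>M\<^esub>y\<in>?B'. k y \<odot>\<^bsub>M\<^esub> y)"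
  proof (cases "b x \<in> ?B")
    case True
    then have "(\<Oplus>\<^bsub>M\<^esub>y\<in>insert (b x) ?B'. k y \<odot>\<^bsub>M\<^esub> y) = k (b x) \<odot>\<^bsub>M\<^esub> b x \<oplus>\<^bsub>M\<^esub> (\<Oplus>\<^bsub>M\<^esub>y\<in>?B'. k y \<odot>\<^bsub>M\<^esub> y)"
      using Bc kc bx by (intro M.finsum_insert) auto
    moreover have "insert (b x) ?B' = ?B" using True by blast
    ultimately show ?thesis using True by (simp add: k0_def)
  next
    case False
    then have "?B' = ?B" by blast
    then show ?thesis using False rest bx by (simp add: k0_def smult_l_null)
  qed
  then have "lsum M (\<lambda>x. r x \<odot>\<^bsub>M\<^esub> b x) (x # xs)
      = (r x \<oplus> k0) \<odot>\<^bsub>M\<^esub> b x \<oplus>\<^bsub>M\<^esub> (\<Oplus>\<^bsub>M\<^esub>y\<in>?B'. k y \<odot>\<^bsub>M\<^esub> y)"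
    using bx k0 rest k(2) by (simp add: smult_l_distr M.a_assoc)
  also have "(\<Oplus>\<^bsub>M\<^esub>y\<in>?B'. k y \<odot>\<^bsub>M\<^esub> y) = (\<Oplus>\<^bsub>M\<^esub>y\<in>?B'. (k(b x := r x \<oplus> k0)) y \<odot>\<^bsub>M\<^esub> y)"
    by (rule finsum_cong_fun) auto
  also have "(r x \<oplus> k0) \<odot>\<^bsub>M\<^esub> b x \<oplus>\<^bsub>M\<^esub> \<dots>
      = (\<Oplus>\<^bsub>M\<^esub>y\<in>insert (b x) ?B'. (k(b x := r x \<oplus> k0)) y \<odot>\<^bsub>M\<^esub> y)"
    using Bc kc bx k0 by (subst M.finsum_insert) auto
  also have "insert (b x) ?B' = b ` set (x # xs)" by auto
  finally show ?case using kc k0 bx by (intro bexI[of _ "k(b x := r x \<oplus> k0)"]) auto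
qed

context gal_group_action
begin

lemma A_finite_dimensional: "finite_dimensional (E\<lparr>carrier := F\<rparr>) A"
  unfolding finite_dimensional_def
proof (intro exI[of _ "fst ` set duals"] conjI ballI)
  interpret M: module "E\<lparr>carrier := F\<rparr>" A by (rule A_module)
  fix a assume a: "a \<in> carrier A"
  let ?r = "\<lambda>x. \<Oplus>p\<in>carrier P. snd x p \<otimes> a p"
  have "\<exists>k\<in>fst ` set duals \<rightarrow> carrier (E\<lparr>carrier := F\<rparr>).
      lsum A (\<lambda>x. ?r x \<odot>\<^bsub>A\<^esub> fst x) duals = (\<Oplus>\<^bsub>A\<^esub>y\<in>fst ` set duals. k y \<odot>\<^bsub>A\<^esub> y)"
    by (rule M.lsum_smult_as_finsum) (simp_all add: pairing_in_F duals_mem a)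
  then show "\<exists>k\<in>fst ` set duals \<rightarrow> carrier (E\<lparr>carrier := F\<rparr>). a = (\<Oplus>\<^bsub>A\<^esub>b\<in>fst ` set duals. k b \<odot>\<^bsub>A\<^esub> b)"
    by (simp add: dual_expansion[OF a])
qed (simp_all add: image_subset_iff duals_mem)

lemma pointwise_linear:
  assumes "f \<in> carrier A" "u \<in> carrier A"
  shows "v \<in> carrier A \<Longrightarrow> pointwise f (u \<oplus>\<^bsub>A\<^esub> v) = pointwise f u \<oplus>\<^bsub>A\<^esub> pointwise f v"
    and "r \<in> F \<Longrightarrow> pointwise f (r \<odot>\<^bsub>A\<^esub> u) = r \<odot>\<^bsub>A\<^esub> pointwise f u"
proof -
  show "pointwise f (u \<oplus>\<^bsub>A\<^esub> v) = pointwise f u \<oplus>\<^bsub>A\<^esub> pointwise f v" if "v \<in> carrier A"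
    by (rule A_eqI; (simp add: pointwise_closed A_add assms that)?)
      (simp add: pointwise_def A_simps(2-) A_closed r_distr assms that)
  show "pointwise f (r \<odot>\<^bsub>A\<^esub> u) = r \<odot>\<^bsub>A\<^esub> pointwise f u" if "r \<in> F"
    by (rule A_eqI; (simp add: pointwise_closed A_smult assms that)?)
      (simp add: pointwise_def A_simps(2-) A_closed m_lcomm F_in assms that)
qed

lemma lsum_in_F: "(\<And>x. x \<in> set xs \<Longrightarrow> g x \<in> F) \<Longrightarrow> lsum E g xs \<in> F"
proof -
  interpret R: field "E\<lparr>carrier := F\<rparr>" by (rule F_field)
  assume "\<And>x. x \<in> set xs \<Longrightarrow> g x \<in> F"
  then show ?thesis using R.lsum_closed[of xs g] by simp
qed

text \<open>With the explicit representatives \<open>\<Sum> x\<^sub>i \<otimes> y\<^sub>i a\<close> given by the dual families, the two sides are the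
  values of \<open>\<tau>\<close> on \<open>\<Sum> x\<^sub>i \<otimes> y\<^sub>i x\<^sub>j \<otimes> y\<^sub>j a\<close> and \<open>\<Sum> x\<^sub>i \<otimes> x\<^sub>j \<otimes> y\<^sub>j y\<^sub>i a\<close>.  For
  fixed \<open>i\<close> the last two factors of both have the diagonal matrix with entries those of \<open>y\<^sub>i a\<close>.\<close>

lemma A_coassoc:
  assumes a: "a \<in> carrier A" and \<tau>: "trilinear_form (E\<lparr>carrier := F\<rparr>) A \<tau>"
  shows "lsum E (\<lambda>(u, v). lsum E (\<lambda>(u1, u2). \<tau> u1 u2 v) (comult A u)) (comult A a)
    = lsum E (\<lambda>(u, v). lsum E (\<lambda>(v1, v2). \<tau> u v1 v2) (comult A v)) (comult A a)"
proof -
  note tri = trilinear_form_simps[OF \<tau>]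
  note tri_E = F_in[OF tri(1)]
  have split_comult: "lsum E (\<lambda>(u, v). \<beta> u v) (comult A u) = lsum E (\<lambda>x. \<beta> (fst x) (pointwise (snd x) u)) duals"
    if "bilinear_form (E\<lparr>carrier := F\<rparr>) A A \<beta>" and u: "u \<in> carrier A" for \<beta> u
  proof -
    have "lsum E (\<lambda>(u, v). \<beta> u v) (comult A u) = lsum E (\<lambda>(u, v). \<beta> u v) (split u)"
      by (rule bilinear_form_eqI[OF A_frame A_frame comult_mem[OF u] split_mem[OF u] _ that(1)])
        (simp add: comult_matrix u split_matrix)
    then show ?thesis by (simp add: split_def lsum_map)
  qed
  note mem = duals_mem pointwise_closed
  let ?L = "\<lambda>u v. lsum E (\<lambda>x. \<tau> (fst x) (pointwise (snd x) u) v) duals"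
  let ?R = "\<lambda>u v. lsum E (\<lambda>x. \<tau> u (fst x) (pointwise (snd x) v)) duals"
  have L: "bilinear_form (E\<lparr>carrier := F\<rparr>) A A ?L"
  proof (rule bilinear_formI)
  qed (simp_all add: lsum_in_F tri tri_E mem pointwise_linear A_add A_smult F_in lsum_mult_left
      flip: lsum_add cong: lsum_cong)
  have R: "bilinear_form (E\<lparr>carrier := F\<rparr>) A A ?R"
  proof (rule bilinear_formI)
  qed (simp_all add: lsum_in_F tri tri_E mem pointwise_linear A_add A_smult F_in lsum_mult_left
      flip: lsum_add cong: lsum_cong)
  have bl1: "bilinear_form (E\<lparr>carrier := F\<rparr>) A A (\<lambda>u1 u2. \<tau> u1 u2 v)" if "v \<in> carrier A" for v
    by (rule bilinear_formI) (simp_all add: tri that)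
  have bl2: "bilinear_form (E\<lparr>carrier := F\<rparr>) A A (\<tau> u)" if "u \<in> carrier A" for u
    by (rule bilinear_formI) (simp_all add: tri that)
  have "lsum E (\<lambda>(u, v). lsum E (\<lambda>(u1, u2). \<tau> u1 u2 v) (comult A u)) (comult A a)
      = lsum E (\<lambda>(u, v). ?L u v) (comult A a)"
  proof (rule lsum_cong, clarify)
    fix u v assume "(u, v) \<in> set (comult A a)"
    then have "u \<in> carrier A" "v \<in> carrier A" using comult_mem[OF a] by auto
    then show "lsum E (\<lambda>(u1, u2). \<tau> u1 u2 v) (comult A u) = ?L u v"
      using split_comult[OF bl1] by simp
  qed
  also have "\<dots> = lsum E (\<lambda>y. ?L (fst y) (pointwise (snd y) a)) duals"
    by (rule split_comult[OF L a])
  also have "\<dots> = lsum E (\<lambda>x. lsum E (\<lambda>y. \<tau> (fst x) (pointwise (snd x) (fst y)) (pointwise (snd y) a)) duals) duals"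
    by (rule lsum_swap) (simp add: tri_E mem a)
  also have "\<dots> = lsum E (\<lambda>x. lsum E (\<lambda>y. \<tau> (fst x) (fst y) (pointwise (snd y) (pointwise (snd x) a))) duals) duals"
  proof (rule lsum_cong)
    fix x assume x: "x \<in> set duals"
    let ?xs = "map (\<lambda>y. (pointwise (snd x) (fst y), pointwise (snd y) a)) duals"
    let ?b = "pointwise (snd x) a"
    have b: "?b \<in> carrier A" by (simp add: mem x a)
    have m: "set ?xs \<subseteq> carrier A \<times> carrier A" using x a by (auto simp del: split_paired_All simp: mem image_subset_iff)
    have "lsum E (\<lambda>(u, v). \<tau> (fst x) u v) ?xs = lsum E (\<lambda>(u, v). \<tau> (fst x) u v) (split ?b)"
    proof (rule bilinear_form_eqI[OF A_frame A_frame m split_mem[OF b] _ bl2[OF duals_mem(1)[OF x]]])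
      fix p q assume p: "p \<in> carrier P" and q: "q \<in> carrier P"
      have "lsum E (\<lambda>(u, v). u p \<otimes> v q) ?xs = lsum E (\<lambda>y. (snd x p \<otimes> a q) \<otimes> (fst y p \<otimes> snd y q)) duals"
        unfolding lsum_map
        by (rule lsum_cong) (simp add: p q pointwise_def A_closed a mem x m_ac)
      also have "\<dots> = (snd x p \<otimes> a q) \<otimes> lsum E (\<lambda>y. fst y p \<otimes> snd y q) duals"
        by (rule lsum_mult_left[symmetric]) (simp_all add: p q A_closed a mem x)
      also have "\<dots> = (if p = q then ?b p else \<zero>)"
        using p q x a by (simp add: duals_delta pointwise_def A_closed mem)
      finally show "lsum E (\<lambda>(u, v). u p \<otimes> v q) ?xs = lsum E (\<lambda>(u, v). u p \<otimes> v q) (split ?b)"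
        by (simp add: split_matrix b p q)
    qed
    then show "lsum E (\<lambda>y. \<tau> (fst x) (pointwise (snd x) (fst y)) (pointwise (snd y) a)) duals
        = lsum E (\<lambda>y. \<tau> (fst x) (fst y) (pointwise (snd y) (pointwise (snd x) a))) duals"
      by (simp add: split_def lsum_map)
  qed
  also have "\<dots> = lsum E (\<lambda>(u, v). ?R u v) (comult A a)"
    by (rule split_comult[OF R a, symmetric])
  also have "\<dots> = lsum E (\<lambda>(u, v). lsum E (\<lambda>(v1, v2). \<tau> u v1 v2) (comult A v)) (comult A a)"
  proof (rule lsum_cong, clarify)
    fix u v assume "(u, v) \<in> set (comult A a)"
    then have "u \<in> carrier A" "v \<in> carrier A" using comult_mem[OF a] by auto
    then show "?R u v = lsum E (\<lambda>(v1, v2). \<tau> u v1 v2) (comult A v)"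
      using split_comult[OF bl2] by simp
  qed
  finally show ?thesis .
qed

end

context gal_group_action
begin

text \<open>By \<open>tensor_eqI\<close>, whatever has a diagonal matrix with entries \<open>a p\<close> is the comultiplication of
  \<open>a\<close>.\<close>

lemma A_tensor_eq_comultI:
  assumes "a \<in> carrier A" "set xs \<subseteq> carrier A \<times> carrier A"
    and "\<And>p q. p \<in> carrier P \<Longrightarrow> q \<in> carrier P \<Longrightarrow> lsum E (\<lambda>x. fst x p \<otimes> snd x q) xs = (if p = q then a p else \<zero>)"
  shows "tensor_eq (E\<lparr>carrier := F\<rparr>) A A (comult A a) xs"
    and "tensor_eq (E\<lparr>carrier := F\<rparr>) A A xs (comult A a)"
  using assms comult_mem[of a]
  by (auto intro!: A_tensor_eqI simp: comult_matrix' case_prod_unfold)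

text \<open>The product of the diagonal matrices of \<open>a\<close> and \<open>b\<close> has entries
  \<open>\<Sum> a\<^sub>r b\<^sub>s\<close> over \<open>r s = p\<close> and \<open>r s = q\<close>, so it is diagonal with the entries of the convolution.\<close>

lemma A_comult_mult:
  assumes a: "a \<in> carrier A" and b: "b \<in> carrier A"
  shows "tensor_eq (E\<lparr>carrier := F\<rparr>) A A (comult A (a \<otimes>\<^bsub>A\<^esub> b))
    [(u \<otimes>\<^bsub>A\<^esub> u', v \<otimes>\<^bsub>A\<^esub> v'). (u, v) \<leftarrow> comult A a, (u', v') \<leftarrow> comult A b]"
proof -
  let ?xs = "concat (map (\<lambda>x. map (\<lambda>y. (fst x \<otimes>\<^bsub>A\<^esub> fst y, snd x \<otimes>\<^bsub>A\<^esub> snd y)) (comult A b)) (comult A a))"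
  note cl = comult_val[OF a] comult_val[OF b] A_closed A_mult finite_P a b
  have mem: "fst z \<in> carrier A \<and> snd z \<in> carrier A" if "z \<in> set ?xs" for z
    using that comult_val[OF a] comult_val[OF b] by (auto intro!: A_mult)
  have "tensor_eq (E\<lparr>carrier := F\<rparr>) A A (comult A (a \<otimes>\<^bsub>A\<^esub> b)) ?xs"
  proof (rule A_tensor_eq_comultI(1)[OF A_mult[OF a b]])
    show "set ?xs \<subseteq> carrier A \<times> carrier A"
    proof
      fix z assume "z \<in> set ?xs"
      from mem[OF this] show "z \<in> carrier A \<times> carrier A" by (simp add: mem_Times_iff)
    qed
    fix p q assume p: "p \<in> carrier P" and q: "q \<in> carrier P"
    let ?g = "\<lambda>r s. if inv\<^bsub>P\<^esub> r \<otimes>\<^bsub>P\<^esub> p = inv\<^bsub>P\<^esub> s \<otimes>\<^bsub>P\<^esub> q then b (inv\<^bsub>P\<^esub> r \<otimes>\<^bsub>P\<^esub> p) else \<zero>"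
    have "lsum E (\<lambda>z. fst z p \<otimes> snd z q) ?xs
        = lsum E (\<lambda>x. lsum E (\<lambda>y. (fst x \<otimes>\<^bsub>A\<^esub> fst y) p \<otimes> (snd x \<otimes>\<^bsub>A\<^esub> snd y) q) (comult A b)) (comult A a)"
    proof -
      have "lsum E (\<lambda>z. fst z p \<otimes> snd z q) ?xs = lsum E (lsum E (\<lambda>z. fst z p \<otimes> snd z q))
          (map (\<lambda>x. map (\<lambda>y. (fst x \<otimes>\<^bsub>A\<^esub> fst y, snd x \<otimes>\<^bsub>A\<^esub> snd y)) (comult A b)) (comult A a))"
      proof (rule lsum_concat)
        fix l z assume "l \<in> set (map (\<lambda>x. map (\<lambda>y. (fst x \<otimes>\<^bsub>A\<^esub> fst y, snd x \<otimes>\<^bsub>A\<^esub> snd y)) (comult A b)) (comult A a))"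
          "z \<in> set l"
        then have "z \<in> set ?xs" unfolding set_concat by blast
        from mem[OF this] show "fst z p \<otimes> snd z q \<in> carrier E" using p q by (simp add: A_closed)
      qed
      then show ?thesis by (simp add: lsum_map)
    qed
    also have "\<dots> = lsum E (\<lambda>x. \<Oplus>r\<in>carrier P. \<Oplus>s\<in>carrier P. (fst x r \<otimes> snd x s) \<otimes> ?g r s) (comult A a)"
    proof (rule lsum_cong)
      fix x assume x: "x \<in> set (comult A a)"
      have "lsum E (\<lambda>y. (fst x \<otimes>\<^bsub>A\<^esub> fst y) p \<otimes> (snd x \<otimes>\<^bsub>A\<^esub> snd y) q) (comult A b)
          = (\<Oplus>r\<in>carrier P. \<Oplus>s\<in>carrier P. lsum E (\<lambda>y. (fst x r \<otimes> fst y (inv\<^bsub>P\<^esub> r \<otimes>\<^bsub>P\<^esub> p))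
              \<otimes> (snd x s \<otimes> snd y (inv\<^bsub>P\<^esub> s \<otimes>\<^bsub>P\<^esub> q))) (comult A b))"
        using p q by (simp add: A_simps(6), intro lsum_finsum_product) (simp_all add: cl x)
      also have "\<dots> = (\<Oplus>r\<in>carrier P. \<Oplus>s\<in>carrier P. (fst x r \<otimes> snd x s) \<otimes>
          lsum E (\<lambda>y. fst y (inv\<^bsub>P\<^esub> r \<otimes>\<^bsub>P\<^esub> p) \<otimes> snd y (inv\<^bsub>P\<^esub> s \<otimes>\<^bsub>P\<^esub> q)) (comult A b))"
        by (rule finsum_cong_fun, rule finsum_cong_fun, subst lsum_mult_left)
          (simp_all add: cl x p q m_ac cong: lsum_cong)
      finally show "lsum E (\<lambda>y. (fst x \<otimes>\<^bsub>A\<^esub> fst y) p \<otimes> (snd x \<otimes>\<^bsub>A\<^esub> snd y) q) (comult A b)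
          = (\<Oplus>r\<in>carrier P. \<Oplus>s\<in>carrier P. (fst x r \<otimes> snd x s) \<otimes> ?g r s)"
        by (simp add: comult_matrix'[OF b] p q cong: finsum_cong_fun)
    qed
    also have "\<dots> = (\<Oplus>r\<in>carrier P. a r \<otimes> ?g r r)"
      by (rule comult_diagonal[OF a]) (simp add: cl p q)
    also have "\<dots> = (\<Oplus>r\<in>carrier P. if p = q then a r \<otimes> b (inv\<^bsub>P\<^esub> r \<otimes>\<^bsub>P\<^esub> p) else \<zero>)"
      by (rule finsum_cong_fun) (simp add: cl p q)
    also have "\<dots> = (if p = q then (a \<otimes>\<^bsub>A\<^esub> b) p else \<zero>)"
      using p by (auto simp: A_simps(6) intro: finsum_zero_fun)
    finally show "lsum E (\<lambda>z. fst z p \<otimes> snd z q) ?xs = (if p = q then (a \<otimes>\<^bsub>A\<^esub> b) p else \<zero>)" .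
  qed
  then show ?thesis by (simp add: case_prod_unfold)
qed

lemma A_antipode_left:
  assumes a: "a \<in> carrier A"
  shows "lsum A (\<lambda>(u, v). antipode A u \<otimes>\<^bsub>A\<^esub> v) (comult A a) = counit A a \<odot>\<^bsub>A\<^esub> \<one>\<^bsub>A\<^esub>"
proof (rule A_eqI)
  note cl = comult_val[OF a] A_closed A_mult antipode_closed finite_P a
  show "lsum A (\<lambda>(u, v). antipode A u \<otimes>\<^bsub>A\<^esub> v) (comult A a) \<in> carrier A"
    by (rule lsum_A_closed) (simp add: case_prod_unfold cl)
  show "counit A a \<odot>\<^bsub>A\<^esub> \<one>\<^bsub>A\<^esub> \<in> carrier A" using a by (intro A_smult A_one counit_in_F)
  fix q assume q: "q \<in> carrier P"
  have "lsum A (\<lambda>(u, v). antipode A u \<otimes>\<^bsub>A\<^esub> v) (comult A a) q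
      = lsum E (\<lambda>x. \<Oplus>p\<in>carrier P. fst x (inv\<^bsub>P\<^esub> p) \<otimes> snd x (inv\<^bsub>P\<^esub> p \<otimes>\<^bsub>P\<^esub> q)) (comult A a)"
    using q by (simp add: lsum_A_apply case_prod_unfold A_simps(6) A_simps(8) cong: finsum_cong_fun)
  also have "\<dots> = (\<Oplus>p\<in>carrier P. lsum E (\<lambda>x. fst x (inv\<^bsub>P\<^esub> p) \<otimes> snd x (inv\<^bsub>P\<^esub> p \<otimes>\<^bsub>P\<^esub> q)) (comult A a))"
    by (rule lsum_finsum_swap) (simp_all add: cl q)
  also have "\<dots> = (\<Oplus>p\<in>carrier P. if q = \<one>\<^bsub>P\<^esub> then a (inv\<^bsub>P\<^esub> p) else \<zero>)"
  proof (rule finsum_cong_fun)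
    fix p assume p: "p \<in> carrier P"
    have "inv\<^bsub>P\<^esub> p = inv\<^bsub>P\<^esub> p \<otimes>\<^bsub>P\<^esub> q \<longleftrightarrow> q = \<one>\<^bsub>P\<^esub>"
      using p q P.r_cancel_one'[of q "inv\<^bsub>P\<^esub> p"] P.l_cancel_one'[of "inv\<^bsub>P\<^esub> p" q] by auto
    then show "lsum E (\<lambda>x. fst x (inv\<^bsub>P\<^esub> p) \<otimes> snd x (inv\<^bsub>P\<^esub> p \<otimes>\<^bsub>P\<^esub> q)) (comult A a) = (if q = \<one>\<^bsub>P\<^esub> then a (inv\<^bsub>P\<^esub> p) else \<zero>)"
      using p q by (simp add: comult_matrix'[OF a])
  qed
  also have "\<dots> = (\<Oplus>p\<in>carrier P. if q = \<one>\<^bsub>P\<^esub> then a p else \<zero>)"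
  proof (rule finsum_bij[where f = "\<lambda>p. if q = \<one>\<^bsub>P\<^esub> then a p else \<zero>"])
    show "bij_betw (\<lambda>p. inv\<^bsub>P\<^esub> p) (carrier P) (carrier P)"
      by (rule bij_betwI[where g = "\<lambda>p. inv\<^bsub>P\<^esub> p"]) auto
  qed (simp add: cl)
  also have "\<dots> = (counit A a \<odot>\<^bsub>A\<^esub> \<one>\<^bsub>A\<^esub>) q"
    using q counit_in_F[OF a] by (auto simp: A_simps(2-5,7) F_in cl intro: finsum_zero_fun)
  finally show "lsum A (\<lambda>(u, v). antipode A u \<otimes>\<^bsub>A\<^esub> v) (comult A a) q = (counit A a \<odot>\<^bsub>A\<^esub> \<one>\<^bsub>A\<^esub>) q" .
qed

lemma A_antipode_right:
  assumes a: "a \<in> carrier A"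
  shows "lsum A (\<lambda>(u, v). u \<otimes>\<^bsub>A\<^esub> antipode A v) (comult A a) = counit A a \<odot>\<^bsub>A\<^esub> \<one>\<^bsub>A\<^esub>"
proof (rule A_eqI)
  note cl = comult_val[OF a] A_closed A_mult antipode_closed finite_P a
  show "lsum A (\<lambda>(u, v). u \<otimes>\<^bsub>A\<^esub> antipode A v) (comult A a) \<in> carrier A"
    by (rule lsum_A_closed) (simp add: case_prod_unfold cl)
  show "counit A a \<odot>\<^bsub>A\<^esub> \<one>\<^bsub>A\<^esub> \<in> carrier A" using a by (intro A_smult A_one counit_in_F)
  fix q assume q: "q \<in> carrier P"
  have "lsum A (\<lambda>(u, v). u \<otimes>\<^bsub>A\<^esub> antipode A v) (comult A a) q
      = lsum E (\<lambda>x. \<Oplus>p\<in>carrier P. fst x p \<otimes> snd x (inv\<^bsub>P\<^esub> q \<otimes>\<^bsub>P\<^esub> p)) (comult A a)"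
    using q by (simp add: lsum_A_apply case_prod_unfold A_simps(6) A_simps(8) P.inv_mult_group cong: finsum_cong_fun)
  also have "\<dots> = (\<Oplus>p\<in>carrier P. lsum E (\<lambda>x. fst x p \<otimes> snd x (inv\<^bsub>P\<^esub> q \<otimes>\<^bsub>P\<^esub> p)) (comult A a))"
    by (rule lsum_finsum_swap) (simp_all add: cl q)
  also have "\<dots> = (\<Oplus>p\<in>carrier P. if q = \<one>\<^bsub>P\<^esub> then a p else \<zero>)"
  proof (rule finsum_cong_fun)
    fix p assume p: "p \<in> carrier P"
    have "p = inv\<^bsub>P\<^esub> q \<otimes>\<^bsub>P\<^esub> p \<longleftrightarrow> q = \<one>\<^bsub>P\<^esub>"
      using p q P.inv_solve_left[of p q p] P.r_cancel_one[of p q] by auto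
    then show "lsum E (\<lambda>x. fst x p \<otimes> snd x (inv\<^bsub>P\<^esub> q \<otimes>\<^bsub>P\<^esub> p)) (comult A a) = (if q = \<one>\<^bsub>P\<^esub> then a p else \<zero>)"
      using p q by (simp add: comult_matrix'[OF a])
  qed
  also have "\<dots> = (counit A a \<odot>\<^bsub>A\<^esub> \<one>\<^bsub>A\<^esub>) q"
    using q counit_in_F[OF a] by (auto simp: A_simps(2-5,7) F_in cl intro: finsum_zero_fun)
  finally show "lsum A (\<lambda>(u, v). u \<otimes>\<^bsub>A\<^esub> antipode A v) (comult A a) q = (counit A a \<odot>\<^bsub>A\<^esub> \<one>\<^bsub>A\<^esub>) q" .
qed

lemma counit_left_of_diagonal:
  assumes a: "a \<in> carrier A" and xs: "set xs \<subseteq> carrier A \<times> carrier A"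
    and diag: "\<And>p q. p \<in> carrier P \<Longrightarrow> q \<in> carrier P \<Longrightarrow>
      lsum E (\<lambda>x. fst x p \<otimes> snd x q) xs = (if p = q then a p else \<zero>)"
  shows "lsum A (\<lambda>x. counit A (fst x) \<odot>\<^bsub>A\<^esub> snd x) xs = a"
proof (rule A_eqI[OF _ a])
  have xp: "fst x \<in> carrier A" "snd x \<in> carrier A" if "x \<in> set xs" for x using xs that by auto
  note cl = xp A_closed A_smult counit_in_F finite_P a
  show "lsum A (\<lambda>x. counit A (fst x) \<odot>\<^bsub>A\<^esub> snd x) xs \<in> carrier A"
    by (rule lsum_A_closed) (simp add: cl)
  fix q assume q: "q \<in> carrier P"
  have "lsum A (\<lambda>x. counit A (fst x) \<odot>\<^bsub>A\<^esub> snd x) xs q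
      = (\<Oplus>p\<in>carrier P. lsum E (\<lambda>x. fst x p \<otimes> snd x q) xs)"
    using q by (simp add: lsum_A_apply A_simps(3) A_simps(7) finsum_mult_right lsum_finsum_swap cl cong: lsum_cong)
  also have "\<dots> = (\<Oplus>p\<in>carrier P. if p = q then a p else \<zero>)"
    using q by (intro finsum_cong_fun) (simp add: diag)
  also have "\<dots> = a q" by (rule finsum_delta') (simp_all add: cl q)
  finally show "lsum A (\<lambda>x. counit A (fst x) \<odot>\<^bsub>A\<^esub> snd x) xs q = a q" .
qed

lemma comult_swap:
  assumes a: "a \<in> carrier A"
  shows "set (map prod.swap (comult A a)) \<subseteq> carrier A \<times> carrier A"
    and "p \<in> carrier P \<Longrightarrow> q \<in> carrier P \<Longrightarrow>
      lsum E (\<lambda>x. fst x p \<otimes> snd x q) (map prod.swap (comult A a)) = (if p = q then a p else \<zero>)"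
proof -
  show "set (map prod.swap (comult A a)) \<subseteq> carrier A \<times> carrier A"
    unfolding set_map by (rule image_subsetI) (simp add: comult_val[OF a] mem_Times_iff)
  assume pq: "p \<in> carrier P" "q \<in> carrier P"
  then have "lsum E (\<lambda>x. snd x p \<otimes> fst x q) (comult A a) = lsum E (\<lambda>x. fst x q \<otimes> snd x p) (comult A a)"
    by (intro lsum_cong) (simp add: m_comm comult_val[OF a] A_closed)
  then show "lsum E (\<lambda>x. fst x p \<otimes> snd x q) (map prod.swap (comult A a)) = (if p = q then a p else \<zero>)"
    using pq by (auto simp: lsum_map comult_matrix'[OF a])
qed

lemma A_counit:
  assumes a: "a \<in> carrier A"
  shows "lsum A (\<lambda>(u, v). counit A u \<odot>\<^bsub>A\<^esub> v) (comult A a) = a"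
    and "lsum A (\<lambda>(u, v). counit A v \<odot>\<^bsub>A\<^esub> u) (comult A a) = a"
  using counit_left_of_diagonal[OF a comult_mem[OF a] comult_matrix'[OF a]]
    counit_left_of_diagonal[OF a comult_swap[OF a]]
  by (simp_all add: case_prod_unfold lsum_map)

lemma A_cocommutative: "cocommutative (E\<lparr>carrier := F\<rparr>) A"
  unfolding cocommutative_def
proof
  fix a assume a: "a \<in> carrier A"
  have "tensor_eq (E\<lparr>carrier := F\<rparr>) A A (map prod.swap (comult A a)) (comult A a)"
    by (rule A_tensor_eq_comultI(2)[OF a comult_swap[OF a]])
  then show "tensor_eq (E\<lparr>carrier := F\<rparr>) A A [(v, u). (u, v) \<leftarrow> comult A a] (comult A a)"
    by (simp add: prod.swap_def[abs_def] case_prod_unfold)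
qed

lemma A_hopf_algebra: "hopf_algebra (E\<lparr>carrier := F\<rparr>) A"
proof (rule hopf_algebra.intro)
  show "field (E\<lparr>carrier := F\<rparr>)" by (rule F_field)
  show "ring A" by (rule A_ring)
  show "module (E\<lparr>carrier := F\<rparr>) A" by (rule A_module)
  show "counit A \<one>\<^bsub>A\<^esub> = \<one>\<^bsub>E\<lparr>carrier := F\<rparr>\<^esub>"
    using finsum_delta'[OF finite_P P.one_closed, of "\<lambda>_. \<one>"]
    by (simp add: A_simps(7) A_simps(5) cong: finsum_cong_fun)
  show "linear_map (E\<lparr>carrier := F\<rparr>) A (ext_module (E\<lparr>carrier := F\<rparr>) (carrier (E\<lparr>carrier := F\<rparr>))) (counit A)"
    using counit_linear_A by simp
  show "linear_map (E\<lparr>carrier := F\<rparr>) A A (antipode A)"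
    unfolding linear_map_def
  proof (intro conjI ballI)
    show "antipode A \<in> carrier A \<rightarrow> carrier A" by (rule funcsetI, rule antipode_closed)
  next
    fix x y assume "x \<in> carrier A" "y \<in> carrier A"
    then show "antipode A (x \<oplus>\<^bsub>A\<^esub> y) = antipode A x \<oplus>\<^bsub>A\<^esub> antipode A y"
      by (intro A_eqI antipode_closed A_add) (simp_all add: A_simps(2) A_simps(8))
  next
    fix r x assume "r \<in> carrier (E\<lparr>carrier := F\<rparr>)" "x \<in> carrier A"
    then show "antipode A (r \<odot>\<^bsub>A\<^esub> x) = r \<odot>\<^bsub>A\<^esub> antipode A x"
      by (intro A_eqI antipode_closed A_smult) (simp_all add: A_simps(3) A_simps(8))
  qed
  show "tensor_eq (E\<lparr>carrier := F\<rparr>) A A (comult A \<one>\<^bsub>A\<^esub>) [(\<one>\<^bsub>A\<^esub>, \<one>\<^bsub>A\<^esub>)]"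
    by (rule A_tensor_eq_comultI(1)) (auto simp: A_one A_simps(5))
next
  fix r a b assume ra: "r \<in> carrier (E\<lparr>carrier := F\<rparr>)" "a \<in> carrier A" "b \<in> carrier A"
  then show "(r \<odot>\<^bsub>A\<^esub> a) \<otimes>\<^bsub>A\<^esub> b = r \<odot>\<^bsub>A\<^esub> (a \<otimes>\<^bsub>A\<^esub> b)"
    by (intro A_eqI A_mult A_smult)
      (simp_all add: A_simps(3) A_simps(6) A_closed F_in finsum_mult_left finite_P m_assoc cong: finsum_cong_fun)
  from ra show "a \<otimes>\<^bsub>A\<^esub> (r \<odot>\<^bsub>A\<^esub> b) = r \<odot>\<^bsub>A\<^esub> (a \<otimes>\<^bsub>A\<^esub> b)"
    by (intro A_eqI A_mult A_smult)
      (simp_all add: A_simps(3) A_simps(6) A_closed F_in finsum_mult_left finite_P m_lcomm cong: finsum_cong_fun)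
next
  fix a b assume a: "a \<in> carrier A" and b: "b \<in> carrier A"
  show "counit A (a \<otimes>\<^bsub>A\<^esub> b) = counit A a \<otimes>\<^bsub>E\<lparr>carrier := F\<rparr>\<^esub> counit A b"
    using counit_mult_A[OF a b] by simp
  show "tensor_eq (E\<lparr>carrier := F\<rparr>) A A (comult A (a \<oplus>\<^bsub>A\<^esub> b)) (comult A a @ comult A b)"
  proof (rule A_tensor_eq_comultI(1)[OF A_add[OF a b]])
    show "set (comult A a @ comult A b) \<subseteq> carrier A \<times> carrier A"
      using comult_mem[OF a] comult_mem[OF b] by auto
    fix p q assume pq: "p \<in> carrier P" "q \<in> carrier P"
    have "lsum E (\<lambda>x. fst x p \<otimes> snd x q) (comult A a @ comult A b)
        = lsum E (\<lambda>x. fst x p \<otimes> snd x q) (comult A a) \<oplus> lsum E (\<lambda>x. fst x p \<otimes> snd x q) (comult A b)"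
    proof (rule lsum_append)
      fix x assume "x \<in> set (comult A a) \<union> set (comult A b)"
      then have "fst x \<in> carrier A" "snd x \<in> carrier A" using comult_val[OF a] comult_val[OF b] by blast+
      then show "fst x p \<otimes> snd x q \<in> carrier E" using pq by (simp add: A_closed)
    qed
    then show "lsum E (\<lambda>x. fst x p \<otimes> snd x q) (comult A a @ comult A b) = (if p = q then (a \<oplus>\<^bsub>A\<^esub> b) p else \<zero>)"
      using pq by (simp add: comult_matrix'[OF a] comult_matrix'[OF b] A_simps(2))
  qed
  show "tensor_eq (E\<lparr>carrier := F\<rparr>) A A (comult A (a \<otimes>\<^bsub>A\<^esub> b))
    [(u \<otimes>\<^bsub>A\<^esub> u', v \<otimes>\<^bsub>A\<^esub> v'). (u, v) \<leftarrow> comult A a, (u', v') \<leftarrow> comult A b]"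
    by (rule A_comult_mult[OF a b])
next
  fix r a assume r': "r \<in> carrier (E\<lparr>carrier := F\<rparr>)" and a: "a \<in> carrier A"
  have r: "r \<in> F" using r' by simp
  have "tensor_eq (E\<lparr>carrier := F\<rparr>) A A (comult A (r \<odot>\<^bsub>A\<^esub> a)) (map (\<lambda>x. (r \<odot>\<^bsub>A\<^esub> fst x, snd x)) (comult A a))"
  proof (rule A_tensor_eq_comultI(1)[OF A_smult[OF r a]])
    show "set (map (\<lambda>x. (r \<odot>\<^bsub>A\<^esub> fst x, snd x)) (comult A a)) \<subseteq> carrier A \<times> carrier A"
      unfolding set_map by (rule image_subsetI) (simp add: comult_val[OF a] A_smult r)
    fix p q assume pq: "p \<in> carrier P" "q \<in> carrier P"
    have "lsum E (\<lambda>x. fst x p \<otimes> snd x q) (map (\<lambda>x. (r \<odot>\<^bsub>A\<^esub> fst x, snd x)) (comult A a))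
        = lsum E (\<lambda>x. r \<otimes> (fst x p \<otimes> snd x q)) (comult A a)"
      unfolding lsum_map
      by (rule lsum_cong) (simp add: pq A_simps(3) m_assoc F_in r comult_val[OF a] A_closed)
    also have "\<dots> = r \<otimes> lsum E (\<lambda>x. fst x p \<otimes> snd x q) (comult A a)"
      by (rule lsum_mult_left[symmetric]) (simp_all add: pq F_in r comult_val[OF a] A_closed)
    finally show "lsum E (\<lambda>x. fst x p \<otimes> snd x q) (map (\<lambda>x. (r \<odot>\<^bsub>A\<^esub> fst x, snd x)) (comult A a))
      = (if p = q then (r \<odot>\<^bsub>A\<^esub> a) p else \<zero>)"
      using pq r by (simp add: comult_matrix'[OF a] A_simps(3) F_in)
  qed
  then show "tensor_eq (E\<lparr>carrier := F\<rparr>) A A (comult A (r \<odot>\<^bsub>A\<^esub> a)) [(r \<odot>\<^bsub>A\<^esub> u, v). (u, v) \<leftarrow> comult A a]"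
    by (simp add: case_prod_unfold)
next
  fix a \<tau> assume "a \<in> carrier A" "trilinear_form (E\<lparr>carrier := F\<rparr>) A \<tau>"
  then show "lsum (E\<lparr>carrier := F\<rparr>) (\<lambda>(u, v). lsum (E\<lparr>carrier := F\<rparr>) (\<lambda>(u1, u2). \<tau> u1 u2 v) (comult A u)) (comult A a)
    = lsum (E\<lparr>carrier := F\<rparr>) (\<lambda>(u, v). lsum (E\<lparr>carrier := F\<rparr>) (\<lambda>(v1, v2). \<tau> u v1 v2) (comult A v)) (comult A a)"
    using A_coassoc by simp
qed (rule comult_mem A_counit A_antipode_left A_antipode_right; assumption)+

end

section \<open>The action on an intermediate field\<close>

text \<open>An intermediate field \<open>F'\<close> of \<open>E/F\<close> together with a bijection \<open>p \<mapsto> ap p\<close> from \<open>P\<close> to the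
  \<open>F\<close>-embeddings of \<open>F'\<close> into \<open>E\<close>.  In the Greither-Pareigis construction \<open>ap p\<close> is the embedding
  given by the coset \<open>p\<inverse>(\<Delta>)\<close>.  The rule \<open>ap_twist\<close> expresses how such a bijection interacts with
  composition: on \<open>F'\<close> the automorphism \<open>\<gamma>\<close> is some \<open>ap p\<close>, and then \<open>\<gamma> \<circ> ap q\<close> is \<open>ap (p \<cdot> c \<gamma> q)\<close>.\<close>

locale gal_point_action = gal_group_action E F P c
  for E (structure) and F and P :: "('g, 'n) monoid_scheme" and c +
  fixes F' :: "'a set" and ap :: "'g \<Rightarrow> 'a \<Rightarrow> 'a"
  assumes F'_subfield: "subfield F' E" and F_F': "F \<subseteq> F'"
    and ap_is_gal: "p \<in> carrier P \<Longrightarrow> \<exists>\<gamma>\<in>\<Gamma>. \<forall>x\<in>F'. ap p x = \<gamma> x"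
    and gal_is_ap: "\<gamma> \<in> \<Gamma> \<Longrightarrow> \<exists>p\<in>carrier P. \<forall>x\<in>F'. ap p x = \<gamma> x"
    and ap_inj: "p \<in> carrier P \<Longrightarrow> q \<in> carrier P \<Longrightarrow> (\<And>x. x \<in> F' \<Longrightarrow> ap p x = ap q x) \<Longrightarrow> p = q"
    and ap_one: "x \<in> F' \<Longrightarrow> ap \<one>\<^bsub>P\<^esub> x = x"
    and ap_twist: "\<gamma> \<in> \<Gamma> \<Longrightarrow> p \<in> carrier P \<Longrightarrow> q \<in> carrier P \<Longrightarrow>
      (\<And>x. x \<in> F' \<Longrightarrow> ap p x = \<gamma> x) \<Longrightarrow> x \<in> F' \<Longrightarrow> \<gamma> (ap q x) = ap (p \<otimes>\<^bsub>P\<^esub> c \<gamma> q) x"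
begin

lemma F'_sub: "x \<in> F' \<Longrightarrow> x \<in> carrier E"
  using subfieldE(3)[OF F'_subfield] by auto

lemma F_in_F': "x \<in> F \<Longrightarrow> x \<in> F'"
  using F_F' by auto

lemmas F'_subring = subfieldE(1)[OF F'_subfield]
lemmas F'_closed = subringE(2,3)[OF F'_subring] subringE(6,7)[OF F'_subring]

lemma ap_props:
  assumes "p \<in> carrier P"
  shows ap_closed: "x \<in> F' \<Longrightarrow> ap p x \<in> carrier E"
    and ap_add: "x \<in> F' \<Longrightarrow> y \<in> F' \<Longrightarrow> ap p (x \<oplus> y) = ap p x \<oplus> ap p y"
    and ap_mult: "x \<in> F' \<Longrightarrow> y \<in> F' \<Longrightarrow> ap p (x \<otimes> y) = ap p x \<otimes> ap p y"
    and ap_unit: "ap p \<one> = \<one>"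
    and ap_fixes: "r \<in> F \<Longrightarrow> ap p r = r"
proof -
  obtain \<gamma> where g: "\<gamma> \<in> \<Gamma>" "\<And>x. x \<in> F' \<Longrightarrow> ap p x = \<gamma> x"
    using ap_is_gal[OF assms] by auto
  show "x \<in> F' \<Longrightarrow> ap p x \<in> carrier E"
    and "x \<in> F' \<Longrightarrow> y \<in> F' \<Longrightarrow> ap p (x \<oplus> y) = ap p x \<oplus> ap p y"
    and "x \<in> F' \<Longrightarrow> y \<in> F' \<Longrightarrow> ap p (x \<otimes> y) = ap p x \<otimes> ap p y"
    and "ap p \<one> = \<one>"
    and "r \<in> F \<Longrightarrow> ap p r = r"
    using g by (simp_all add: F'_closed F'_sub gal_props F_in_F')
qed

lemma gal_F'_ap:
  assumes "\<delta> \<in> carrier (gal E F')" "q \<in> carrier P" "x \<in> F'"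
  shows "\<delta> (ap q x) = ap (c \<delta> q) x"
proof -
  have d: "\<delta> \<in> \<Gamma>" using assms(1) gal_mono[OF F_F', of E] by auto
  have "\<delta> (ap q x) = ap (\<one>\<^bsub>P\<^esub> \<otimes>\<^bsub>P\<^esub> c \<delta> q) x"
    by (rule ap_twist[OF d]) (simp_all add: assms ap_one gal_fixes[OF ring_axioms assms(1)])
  then show ?thesis by (simp add: c_closed d assms)
qed

lemma in_F'I:
  assumes "x \<in> carrier E" "\<And>\<delta>. \<delta> \<in> carrier (gal E F') \<Longrightarrow> \<delta> x = x"
  shows "x \<in> F'"
  using fixed_field_gal[OF F'_subring F_F'] assms by (auto simp: fixed_field_def)

definition act :: "('g \<Rightarrow> 'a) \<Rightarrow> 'a \<Rightarrow> 'a" where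
  "act a x = (\<Oplus>p\<in>carrier P. a p \<otimes> ap p x)"

lemma act_closed_E: "a \<in> carrier A \<Longrightarrow> x \<in> F' \<Longrightarrow> act a x \<in> carrier E"
  by (simp add: act_def A_closed ap_closed)

text \<open>\<open>Gal(E/F')\<close> permutes the summands.\<close>

lemma act_closed:
  assumes a: "a \<in> carrier A" and x: "x \<in> F'"
  shows "act a x \<in> F'"
proof (rule in_F'I[OF act_closed_E[OF a x]])
  fix \<delta> assume d': "\<delta> \<in> carrier (gal E F')"
  then have d: "\<delta> \<in> \<Gamma>" using gal_mono[OF F_F', of E] by auto
  show "\<delta> (act a x) = act a x"
    unfolding act_def
    by (rule gal_sum_equivariant[OF d])
      (simp_all add: a x d A_closed ap_closed A_equivariant gal_props gal_F'_ap[OF d'])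
qed

text \<open>The embedding \<open>ap p\<close> is applied to the element \<open>\<Sum> b\<^sub>q (ap q x)\<close> of \<open>F'\<close> as some \<open>\<gamma>\<close>, which by
  equivariance of \<open>b\<close> and \<open>ap_twist\<close> turns it into \<open>\<Sum> b\<^sub>q (ap (p q) x)\<close>.\<close>

lemma act_convolution:
  assumes a: "a \<in> carrier A" and b: "b \<in> carrier A" and x: "x \<in> F'"
  shows "act (a \<otimes>\<^bsub>A\<^esub> b) x = act a (act b x)"
proof -
  have "act (a \<otimes>\<^bsub>A\<^esub> b) x = (\<Oplus>p\<in>carrier P. \<Oplus>q\<in>carrier P. a p \<otimes> b q \<otimes> ap (p \<otimes>\<^bsub>P\<^esub> q) x)"
    unfolding act_def by (rule convolution_sum[OF a b]) (simp add: ap_closed x)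
  also have "\<dots> = (\<Oplus>p\<in>carrier P. a p \<otimes> ap p (act b x))"
  proof (rule finsum_cong_fun)
    fix p assume p: "p \<in> carrier P"
    obtain \<gamma> where g: "\<gamma> \<in> \<Gamma>" "\<And>x. x \<in> F' \<Longrightarrow> ap p x = \<gamma> x"
      using ap_is_gal[OF p] by auto
    have "ap p (act b x) = \<gamma> (\<Oplus>q\<in>carrier P. b q \<otimes> ap q x)"
      using g(2)[OF act_closed[OF b x]] by (simp add: act_def)
    also have "\<dots> = (\<Oplus>q\<in>carrier P. b q \<otimes> ap (p \<otimes>\<^bsub>P\<^esub> q) x)"
      by (rule gal_sum_equivariant[OF g(1)])
        (simp_all add: b p x g A_closed ap_closed A_equivariant gal_props ap_twist[OF g(1) p _ g(2)])
    finally show "(\<Oplus>q\<in>carrier P. a p \<otimes> b q \<otimes> ap (p \<otimes>\<^bsub>P\<^esub> q) x) = a p \<otimes> ap p (act b x)"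
      by (simp add: finsum_mult_left finite_P A_closed a b p x ap_closed m_assoc cong: finsum_cong_fun)
  qed
  finally show ?thesis by (simp add: act_def)
qed

lemma act_product:
  assumes h: "h \<in> carrier A" and x: "x \<in> F'" and y: "y \<in> F'"
  shows "act h (x \<otimes> y) = lsum E (\<lambda>(u, v). act u x \<otimes> act v y) (comult A h)"
proof -
  note cl = comult_val[OF h] A_closed ap_closed finite_P x y
  have "lsum E (\<lambda>(u, v). act u x \<otimes> act v y) (comult A h) = lsum E (\<lambda>z. \<Oplus>p\<in>carrier P. \<Oplus>q\<in>carrier P.
      (fst z p \<otimes> snd z q) \<otimes> (ap p x \<otimes> ap q y)) (comult A h)"
    unfolding act_def case_prod_unfold
    by (rule lsum_cong) (simp add: finsum_product cl m_ac cong: finsum_cong_fun)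
  also have "\<dots> = (\<Oplus>p\<in>carrier P. h p \<otimes> (ap p x \<otimes> ap p y))"
    by (rule comult_diagonal[OF h]) (simp add: cl)
  also have "\<dots> = act h (x \<otimes> y)"
    unfolding act_def by (rule finsum_cong_fun) (simp add: ap_mult x y)
  finally show ?thesis by simp
qed

text \<open>Separating coordinates with both entries in \<open>F'\<close> are dual families for \<open>F'\<close>, embedded in \<open>E\<^sup>P\<close>
  by \<open>x \<mapsto> (ap p x)\<^sub>p\<close>, in the same sense as \<^const>\<open>duals\<close> is for the descended algebra.\<close>

definition coords where
  "coords = (SOME xs. set xs \<subseteq> F' \<times> F' \<and> (\<forall>\<gamma>\<in>\<Gamma>.
      lsum E (\<lambda>(a, b). a \<otimes> \<gamma> b) xs = (if \<gamma> \<in> carrier (gal E F') then \<one> else \<zero>)))"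

lemma coords_spec:
  "set coords \<subseteq> F' \<times> F'"
  "\<gamma> \<in> \<Gamma> \<Longrightarrow> lsum E (\<lambda>(a, b). a \<otimes> \<gamma> b) coords = (if \<gamma> \<in> carrier (gal E F') then \<one> else \<zero>)"
proof -
  have "\<exists>xs. set xs \<subseteq> F' \<times> F' \<and> (\<forall>\<gamma>\<in>\<Gamma>.
      lsum E (\<lambda>(a, b). a \<otimes> \<gamma> b) xs = (if \<gamma> \<in> carrier (gal E F') then \<one> else \<zero>))"
    using intermediate_coordinates[OF F'_subring F_F'] by metis
  from someI_ex[OF this] show "set coords \<subseteq> F' \<times> F'"
    "\<gamma> \<in> \<Gamma> \<Longrightarrow> lsum E (\<lambda>(a, b). a \<otimes> \<gamma> b) coords = (if \<gamma> \<in> carrier (gal E F') then \<one> else \<zero>)"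
    unfolding coords_def[symmetric] by blast+
qed

lemma coords_mem: "x \<in> set coords \<Longrightarrow> fst x \<in> F'" "x \<in> set coords \<Longrightarrow> snd x \<in> F'"
  using coords_spec(1) by auto

lemma coords_delta:
  assumes p: "p \<in> carrier P" and q: "q \<in> carrier P"
  shows "lsum E (\<lambda>x. ap p (fst x) \<otimes> ap q (snd x)) coords = (if p = q then \<one> else \<zero>)"
proof -
  obtain \<gamma> where g: "\<gamma> \<in> \<Gamma>" "\<And>x. x \<in> F' \<Longrightarrow> ap p x = \<gamma> x"
    using ap_is_gal[OF p] by auto
  obtain \<tau> where t: "\<tau> \<in> \<Gamma>" "\<And>x. x \<in> F' \<Longrightarrow> ap q x = \<tau> x"
    using ap_is_gal[OF q] by auto
  let ?d = "inv\<^bsub>gal E F\<^esub> \<gamma> \<otimes>\<^bsub>gal E F\<^esub> \<tau>"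
  have xs: "set coords \<subseteq> carrier E \<times> carrier E" using coords_spec(1) F'_sub by auto
  have "lsum E (\<lambda>x. ap p (fst x) \<otimes> ap q (snd x)) coords = lsum E (\<lambda>(a, b). \<gamma> a \<otimes> \<tau> b) coords"
    by (rule lsum_cong) (simp add: g t coords_mem case_prod_unfold)
  also have "\<dots> = (if ?d \<in> carrier (gal E F') then \<one> else \<zero>)"
    by (rule coordinates_sum_shift[OF g(1) t(1) xs coords_spec(2)])
  also have "?d \<in> carrier (gal E F') \<longleftrightarrow> p = q"
  proof
    assume d: "?d \<in> carrier (gal E F')"
    have "ap p x = ap q x" if x: "x \<in> F'" for x
    proof -
      have "\<gamma> (?d x) = \<tau> x" using g t F'_sub[OF x] by (simp add: gal_props)
      then show ?thesis using gal_fixes[OF ring_axioms d x] g(2)[OF x] t(2)[OF x] by simp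
    qed
    then show "p = q" using ap_inj p q by blast
  next
    assume "p = q"
    then have eq: "\<gamma> x = \<tau> x" if "x \<in> F'" for x using g t that by metis
    have "?d x = x" if "x \<in> F'" for x
      using g(1) t(1) F'_sub[OF that] by (simp add: gal_props flip: eq[OF that])
    moreover have "?d \<in> \<Gamma>" using g t by simp
    ultimately show "?d \<in> carrier (gal E F')" by (auto simp: gal_mem_iff)
  qed
  finally show ?thesis .
qed

lemma trace_ap_in_F:
  assumes z: "z \<in> F'"
  shows "(\<Oplus>p\<in>carrier P. ap p z) \<in> F"
  unfolding in_F_iff
proof (intro conjI ballI)
  show "(\<Oplus>p\<in>carrier P. ap p z) \<in> carrier E" by (simp add: ap_closed z)
  fix \<tau> assume t: "\<tau> \<in> \<Gamma>"
  obtain p where p: "p \<in> carrier P" "\<And>x. x \<in> F' \<Longrightarrow> ap p x = \<tau> x" using gal_is_ap[OF t] by auto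
  have "\<tau> (\<Oplus>q\<in>carrier P. ap q z) = (\<Oplus>q\<in>carrier P. ap (p \<otimes>\<^bsub>P\<^esub> q) z)"
    by (rule gal_sum_equivariant[OF t]) (simp_all add: ap_closed z p ap_twist[OF t p(1) _ p(2)])
  also have "\<dots> = (\<Oplus>q\<in>carrier P. ap q z)"
  proof (rule finsum_bij[where f = "\<lambda>q. ap q z"])
    show "bij_betw (\<lambda>q. p \<otimes>\<^bsub>P\<^esub> q) (carrier P) (carrier P)"
      using p by (intro bij_betwI[where g = "\<lambda>r. inv\<^bsub>P\<^esub> p \<otimes>\<^bsub>P\<^esub> r"]) (simp_all flip: P.m_assoc)
  qed (simp add: ap_closed z)
  finally show "\<tau> (\<Oplus>q\<in>carrier P. ap q z) = (\<Oplus>q\<in>carrier P. ap q z)" .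
qed

lemma pairing_ap_in_F:
  assumes "x \<in> F'" "y \<in> F'"
  shows "(\<Oplus>p\<in>carrier P. ap p x \<otimes> ap p y) \<in> F"
  using trace_ap_in_F[of "x \<otimes> y"] assms by (simp add: F'_closed ap_mult cong: finsum_cong_fun)

lemma F'_expansion:
  assumes v: "v \<in> F'"
  shows "lsum E (\<lambda>x. (\<Oplus>p\<in>carrier P. ap p (snd x) \<otimes> ap p v) \<otimes> fst x) coords = v"
proof -
  have "lsum E (\<lambda>x. (\<Oplus>p\<in>carrier P. ap p (snd x) \<otimes> ap p v) \<otimes> fst x) coords = ap \<one>\<^bsub>P\<^esub> v"
    by (rule dual_families_contract)
      (simp_all add: finite_P v coords_mem ap_closed F'_sub ap_one cong: lsum_cong flip: coords_delta)
  then show ?thesis by (simp add: ap_one v)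
qed

lemma linear_expansion:
  assumes \<phi>: "linear_map (E\<lparr>carrier := F\<rparr>) (ext_module E F') (ext_module E W) \<phi>"
    and W: "W \<subseteq> carrier E" and v: "v \<in> F'"
  shows "\<phi> v = lsum E (\<lambda>x. (\<Oplus>p\<in>carrier P. ap p (snd x) \<otimes> ap p v) \<otimes> \<phi> (fst x)) coords"
proof -
  have lin: "x \<in> F' \<Longrightarrow> \<phi> x \<in> carrier E" "x \<in> F' \<Longrightarrow> y \<in> F' \<Longrightarrow> \<phi> (x \<oplus> y) = \<phi> x \<oplus> \<phi> y"
    "r \<in> F \<Longrightarrow> x \<in> F' \<Longrightarrow> \<phi> (r \<otimes> x) = r \<otimes> \<phi> x" for x y r
    using linear_map_ext_moduleD[OF \<phi>] W by (auto simp: ext_module_def)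
  interpret F': ring "E\<lparr>carrier := F'\<rparr>" by (rule subring_is_ring[OF F'_subring])
  let ?c = "\<lambda>x. \<Oplus>p\<in>carrier P. ap p (snd x) \<otimes> ap p v"
  have cF: "?c x \<in> F" if "x \<in> set coords" for x
    using that by (intro pairing_ap_in_F coords_mem v)
  have "\<phi> (lsum (E\<lparr>carrier := F'\<rparr>) (\<lambda>x. ?c x \<otimes> fst x) coords) = lsum E (\<lambda>x. \<phi> (?c x \<otimes> fst x)) coords"
  proof (rule lsum_hom[OF F'.ring_axioms ring_axioms])
    show "\<phi> \<zero>\<^bsub>E\<lparr>carrier := F'\<rparr>\<^esub> = \<zero>"
      using lin(3)[of \<zero> \<zero>] lin(1)[of \<zero>] F'_closed(1) subringE(2)[OF subfieldE(1)[OF subfield]] by simp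
  qed (simp_all add: lin F'_closed F_in_F' cF coords_mem)
  also have "\<dots> = lsum E (\<lambda>x. ?c x \<otimes> \<phi> (fst x)) coords"
    by (rule lsum_cong) (simp add: lin cF coords_mem)
  finally show ?thesis by (simp add: F'_expansion v)
qed

lemma F'_frame:
  "frame (ext_module E F') (carrier P) (\<lambda>x p. ap p x) (map (\<lambda>x. (fst x, \<lambda>p. ap p (snd x))) coords)"
  unfolding frame_def
proof (intro conjI allI impI ballI finite_P)
  show "set (map (\<lambda>x. (fst x, \<lambda>p. ap p (snd x))) coords) \<subseteq> carrier (ext_module E F') \<times> (carrier P \<rightarrow> carrier E)"
    unfolding set_map by (rule image_subsetI) (simp add: ext_module_def coords_mem ap_closed)
  fix \<phi> v assume "linear_map (E\<lparr>carrier := F\<rparr>) (ext_module E F') (ext_module E F) \<phi>" "v \<in> carrier (ext_module E F')"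
  then show "\<phi> v = lsum E (\<lambda>(e, f). (\<Oplus>i\<in>carrier P. f i \<otimes> ap i v) \<otimes> \<phi> e) (map (\<lambda>x. (fst x, \<lambda>p. ap p (snd x))) coords)"
    using linear_expansion[OF _ F_sub] by (simp add: lsum_map ext_module_def)
qed (simp add: ext_module_def ap_closed)

text \<open>An endomorphism \<open>f\<close> of \<open>F'\<close> is \<open>\<Sum> g\<^sub>p p\<close> with \<open>\<Delta>\<close>-equivariant coefficients \<open>g\<^sub>p\<close> in \<open>E\<close>;
  pairing these with the dual families writes it with coefficients in \<open>F'\<close>.\<close>

lemma act_surjective:
  assumes f: "linear_map (E\<lparr>carrier := F\<rparr>) (ext_module E F') (ext_module E F') f"
  shows "\<exists>xs. set xs \<subseteq> F' \<times> carrier A \<and> (\<forall>y\<in>F'. f y = lsum E (\<lambda>(x, h). x \<otimes> act h y) xs)"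
proof -
  have fF': "x \<in> F' \<Longrightarrow> f x \<in> F'" for x
    using linear_map_ext_moduleD(1)[OF f] by (simp add: ext_module_def)
  note cl = fF' coords_mem ap_closed finite_P F'_sub duals_mem A_closed
  define g where "g p = lsum E (\<lambda>x. f (fst x) \<otimes> ap p (snd x)) coords" for p
  have gE: "g p \<in> carrier E" if "p \<in> carrier P" for p using that by (simp add: g_def cl)
  have g_equiv: "g (c \<delta> p) = \<delta> (g p)" if d': "\<delta> \<in> carrier (gal E F')" and p: "p \<in> carrier P" for \<delta> p
  proof -
    have d: "\<delta> \<in> \<Gamma>" using d' gal_mono[OF F_F', of E] by auto
    have "\<delta> (g p) = lsum E (\<lambda>x. \<delta> (f (fst x) \<otimes> ap p (snd x))) coords"
      unfolding g_def by (rule gal_lsum[OF ring_axioms d]) (simp add: cl p)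
    also have "\<dots> = g (c \<delta> p)"
      unfolding g_def
      by (rule lsum_cong) (simp add: cl p d gal_props gal_F'_ap[OF d' p] gal_fixes[OF ring_axioms d'])
    finally show ?thesis by simp
  qed
  let ?x = "\<lambda>z. \<Oplus>p\<in>carrier P. snd z p \<otimes> g p"
  have xF': "?x z \<in> F'" if z: "z \<in> set duals" for z
  proof (rule in_F'I)
    show "?x z \<in> carrier E" by (simp add: cl z gE)
    fix \<delta> assume d': "\<delta> \<in> carrier (gal E F')"
    then have d: "\<delta> \<in> \<Gamma>" using gal_mono[OF F_F', of E] by auto
    show "\<delta> (?x z) = ?x z"
      by (rule gal_sum_equivariant[OF d])
        (simp_all add: cl z gE d gal_props g_equiv[OF d'] A_equivariant)
  qed
  let ?xs = "map (\<lambda>z. (?x z, fst z)) duals"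
  have "f y = lsum E (\<lambda>(x, h). x \<otimes> act h y) ?xs" if y: "y \<in> F'" for y
  proof -
    have "f y = lsum E (\<lambda>x. (\<Oplus>p\<in>carrier P. ap p (snd x) \<otimes> ap p y) \<otimes> f (fst x)) coords"
      using y by (intro linear_expansion[OF f]) (auto simp: F'_sub)
    also have "\<dots> = lsum E (\<lambda>x. \<Oplus>p\<in>carrier P. f (fst x) \<otimes> ap p (snd x) \<otimes> ap p y) coords"
      by (rule lsum_cong, subst finsum_mult_right) (simp_all add: cl y m_ac cong: finsum_cong_fun)
    also have "\<dots> = (\<Oplus>p\<in>carrier P. g p \<otimes> ap p y)"
      by (simp add: cl y g_def lsum_mult_right lsum_finsum_swap cong: finsum_cong_fun)
    finally have f_eq: "f y = (\<Oplus>q\<in>carrier P. g q \<otimes> ap q y)" .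
    have "lsum E (\<lambda>(x, h). x \<otimes> act h y) ?xs = lsum E (\<lambda>z. \<Oplus>q\<in>carrier P. ?x z \<otimes> fst z q \<otimes> ap q y) duals"
      unfolding lsum_map act_def
      by (rule lsum_cong) (simp add: finsum_mult_left cl gE y m_assoc cong: finsum_cong_fun)
    also have "\<dots> = (\<Oplus>q\<in>carrier P. lsum E (\<lambda>z. ?x z \<otimes> fst z q) duals \<otimes> ap q y)"
      by (simp add: cl gE y lsum_mult_right lsum_finsum_swap cong: finsum_cong_fun)
    also have "\<dots> = (\<Oplus>q\<in>carrier P. g q \<otimes> ap q y)"
      by (rule finsum_cong_fun, subst dual_families_contract) (simp_all add: cl gE duals_delta)
    finally show ?thesis using f_eq by simp
  qed
  moreover have "set ?xs \<subseteq> F' \<times> carrier A"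
    unfolding set_map by (rule image_subsetI) (simp add: xF' duals_mem)
  ultimately show ?thesis by blast
qed

text \<open>If \<open>\<Sum> x h\<close> acts as zero, then \<open>m\<^sub>q = \<Sum> x h\<^sub>q\<close> vanishes for all \<open>q\<close>, by independence of the
  embeddings \<open>ap q\<close>.  The coordinates \<open>\<Sum> (ap p x) h\<^sub>q\<close> of the tensor are images of the \<open>m\<^sub>r\<close> under
  automorphisms.\<close>

lemma act_injective:
  assumes xs: "set xs \<subseteq> F' \<times> carrier A"
    and zero: "\<And>y. y \<in> F' \<Longrightarrow> lsum E (\<lambda>(x, h). x \<otimes> act h y) xs = \<zero>"
  shows "tensor_eq (E\<lparr>carrier := F\<rparr>) (ext_module E F') A xs []"
proof (rule tensor_eqI[OF F'_frame A_frame])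
  show "set xs \<subseteq> carrier (ext_module E F') \<times> carrier A" using xs by (simp add: ext_module_def)
  show "set [] \<subseteq> carrier (ext_module E F') \<times> carrier A" by simp
  have xp: "fst z \<in> F'" "snd z \<in> carrier A" if "z \<in> set xs" for z using that xs by auto
  note cl = xp A_closed ap_closed finite_P F'_sub coords_mem
  define m where "m q = lsum E (\<lambda>z. fst z \<otimes> snd z q) xs" for q
  have mE: "m q \<in> carrier E" if "q \<in> carrier P" for q using that by (simp add: m_def cl)
  have m_sum: "(\<Oplus>q\<in>carrier P. m q \<otimes> ap q y) = \<zero>" if y: "y \<in> F'" for y
  proof -
    have "(\<Oplus>q\<in>carrier P. m q \<otimes> ap q y) = (\<Oplus>q\<in>carrier P. lsum E (\<lambda>z. fst z \<otimes> snd z q \<otimes> ap q y) xs)"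
      unfolding m_def by (rule finsum_cong_fun, rule lsum_mult_right) (simp_all add: cl y)
    also have "\<dots> = lsum E (\<lambda>z. \<Oplus>q\<in>carrier P. fst z \<otimes> snd z q \<otimes> ap q y) xs"
      by (rule lsum_finsum_swap[symmetric]) (simp_all add: cl y)
    also have "\<dots> = lsum E (\<lambda>(x, h). x \<otimes> act h y) xs"
      by (rule lsum_cong)
        (simp add: act_def case_prod_unfold finsum_mult_left cl y m_assoc cong: finsum_cong_fun)
    finally show ?thesis using zero[OF y] by simp
  qed
  have m_zero: "m r = \<zero>" if r: "r \<in> carrier P" for r
  proof -
    have "m r = lsum E (\<lambda>z. (\<Oplus>q\<in>carrier P. ap q (snd z) \<otimes> m q) \<otimes> ap r (fst z)) coords"
      by (rule dual_families_contract[symmetric]) (simp_all add: cl r mE coords_delta)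
    also have "\<dots> = \<zero>"
      using m_sum by (intro lsum_zero) (simp add: cl r mE m_comm cong: finsum_cong_fun)
    finally show ?thesis .
  qed
  fix p q assume p: "p \<in> carrier P" and q: "q \<in> carrier P"
  obtain \<gamma> where g: "\<gamma> \<in> \<Gamma>" "\<And>x. x \<in> F' \<Longrightarrow> ap p x = \<gamma> x"
    using ap_is_gal[OF p] by auto
  let ?q = "c (inv\<^bsub>gal E F\<^esub> \<gamma>) q"
  have q': "?q \<in> carrier P" "c \<gamma> ?q = q"
    using g q c_comp[of \<gamma> "inv\<^bsub>gal E F\<^esub> \<gamma>" q] by (simp_all add: c_closed c_id)
  have hq: "h q = \<gamma> (h ?q)" if "h \<in> carrier A" for h
    using A_equivariant[OF that g(1) q'(1)] q'(2) by simp
  have "lsum E (\<lambda>(x, h). ap p x \<otimes> h q) xs = lsum E (\<lambda>z. \<gamma> (fst z \<otimes> snd z ?q)) xs"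
    by (rule lsum_cong) (simp add: case_prod_unfold cl g q q' gal_props hq)
  also have "\<dots> = \<gamma> (m ?q)"
    unfolding m_def by (rule gal_lsum[OF ring_axioms g(1), symmetric]) (simp add: cl q')
  finally show "lsum E (\<lambda>(x, h). ap p x \<otimes> h q) xs = lsum E (\<lambda>(x, h). ap p x \<otimes> h q) []"
    using g by (simp add: m_zero q' gal_props)
qed

theorem descended_hopf_galois: "hopf_galois_structure E F F' A act"
proof (rule hopf_galois_structure.intro)
  show "field E" by (rule field_axioms)
  show "hopf_algebra (E\<lparr>carrier := F\<rparr>) A" by (rule A_hopf_algebra)
  show "finite_dimensional (E\<lparr>carrier := F\<rparr>) A" by (rule A_finite_dimensional)
  show "cocommutative (E\<lparr>carrier := F\<rparr>) A" by (rule A_cocommutative)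
next
  fix h assume h: "h \<in> carrier A"
  show "linear_map (E\<lparr>carrier := F\<rparr>) (ext_module E F') (ext_module E F') (act h)"
  proof (rule linear_map_ext_moduleI)
    fix r v assume r: "r \<in> F" and v: "v \<in> carrier (ext_module E F')"
    then have v': "v \<in> F'" by (simp add: ext_module_def)
    have "act h (r \<otimes> v) = (\<Oplus>p\<in>carrier P. r \<otimes> (h p \<otimes> ap p v))"
      unfolding act_def using r v' h
      by (intro finsum_cong_fun) (simp add: ap_mult F_in_F' ap_fixes A_closed ap_closed F_in m_lcomm)
    then show "act h (r \<odot>\<^bsub>ext_module E F'\<^esub> v) = r \<otimes> act h v"
      using r v' h by (simp add: ext_module_def act_def finsum_mult_left finite_P F_in A_closed ap_closed)
  qed (use h in \<open>simp_all add: ext_module_def act_closed, simp add: act_def ap_add A_closed ap_closed r_distr finsum_add_fun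
        cong: finsum_cong_fun\<close>)
  show "act h \<one> = counit A h"
    unfolding act_def A_simps(7) using h by (intro finsum_cong_fun) (simp add: ap_unit A_closed)
next
  fix x assume x: "x \<in> F'"
  show "linear_map (E\<lparr>carrier := F\<rparr>) A (ext_module E F') (\<lambda>h. act h x)"
    by (rule linear_map_ext_moduleI, simp add: act_closed x)
      (simp_all add: act_def A_simps(2) A_simps(3) A_closed ap_closed x l_distr finsum_add_fun
        F_in m_assoc finsum_mult_left finite_P cong: finsum_cong_fun)
  have "act \<one>\<^bsub>A\<^esub> x = (\<Oplus>p\<in>carrier P. if p = \<one>\<^bsub>P\<^esub> then ap p x else \<zero>)"
    unfolding act_def by (rule finsum_cong_fun) (simp add: A_simps(5) ap_closed x)
  also have "\<dots> = ap \<one>\<^bsub>P\<^esub> x" by (rule finsum_delta') (simp_all add: finite_P ap_closed x)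
  finally show "act \<one>\<^bsub>A\<^esub> x = x" by (simp add: ap_one x)
qed (rule F'_subfield subfield F_F' act_convolution act_product act_surjective act_injective; (assumption | blast))+

end

section \<open>The structure attached to a regular subgroup\<close>

lemma (in group) conj_mult:
  assumes "l \<in> carrier G" "p \<in> carrier G" "q \<in> carrier G"
  shows "l \<otimes> (p \<otimes> q) \<otimes> inv l = (l \<otimes> p \<otimes> inv l) \<otimes> (l \<otimes> q \<otimes> inv l)"
proof -
  have "inv l \<otimes> (l \<otimes> z) = z" if "z \<in> carrier G" for z
    using that assms by (simp flip: m_assoc)
  then show ?thesis using assms by (simp add: m_assoc)
qed

lemma BijGroup_apply:
  "f \<in> Bij S \<Longrightarrow> g \<in> Bij S \<Longrightarrow> x \<in> S \<Longrightarrow> (f \<otimes>\<^bsub>BijGroup S\<^esub> g) x = f (g x)"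
  by (simp add: BijGroup_def compose_def)

lemma BijGroup_simps:
  "carrier (BijGroup S) = Bij S" "x \<in> S \<Longrightarrow> \<one>\<^bsub>BijGroup S\<^esub> x = x"
  by (simp_all add: BijGroup_def)

lemma Bij_apply_closed: "f \<in> Bij S \<Longrightarrow> x \<in> S \<Longrightarrow> f x \<in> S"
  using Bij_imp_funcset by blast

lemma Bij_eqI: "f \<in> Bij S \<Longrightarrow> g \<in> Bij S \<Longrightarrow> (\<And>x. x \<in> S \<Longrightarrow> f x = g x) \<Longrightarrow> f = g"
  by (rule extensionalityI[of _ S]) (auto simp: Bij_def)

lemma BijGroup_inv_apply:
  assumes "f \<in> Bij S" "x \<in> S"
  shows "(inv\<^bsub>BijGroup S\<^esub> f) (f x) = x"
  using assms inv_BijGroup[of f S] Bij_apply_closed[of f S x] by (simp add: Bij_def bij_betw_def)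

lemma BijGroup_inv_closed: "f \<in> Bij S \<Longrightarrow> inv\<^bsub>BijGroup S\<^esub> f \<in> Bij S"
  using group.inv_closed[OF group_BijGroup, of f S] by (simp add: BijGroup_simps)

lemma regular_subgroup_finite:
  assumes "regular_subgroup P \<Omega>" "finite \<Omega>" "x \<in> \<Omega>"
  shows "finite P"
proof (rule inj_on_finite)
  have P: "P \<subseteq> Bij \<Omega>"
  proof -
    have "subgroup P (BijGroup \<Omega>)" using assms(1) by (simp add: regular_subgroup_def)
    from subgroup.subset[OF this] show ?thesis by (simp add: BijGroup_simps)
  qed
  have closed: "p x \<in> \<Omega>" if "p \<in> P" for p
    using Bij_apply_closed[OF subsetD[OF P that] assms(3)] .
  then show "(\<lambda>p. p x) ` P \<subseteq> \<Omega>" by (rule image_subsetI)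
  show "inj_on (\<lambda>p. p x) P"
  proof (rule inj_onI)
    fix p q assume pq: "p \<in> P" "q \<in> P" "p x = q x"
    have "\<exists>!r. r \<in> P \<and> r x = p x"
      using assms(1,3) closed[OF pq(1)] by (simp add: regular_subgroup_def)
    then show "p = q" using pq by (auto simp: Ex1_def)
  qed
qed (rule assms(2))

context galois
begin

lemma left_translation_mult:
  assumes "F \<subseteq> M" "M \<subseteq> carrier E" "\<gamma> \<in> \<Gamma>" "\<tau> \<in> \<Gamma>"
  shows "left_translation E F M (\<gamma> \<otimes>\<^bsub>gal E F\<^esub> \<tau>)
    = left_translation E F M \<gamma> \<otimes>\<^bsub>BijGroup (gal_cosets E F M)\<^esub> left_translation E F M \<tau>"
proof (rule Bij_eqI)
  show "left_translation E F M (\<gamma> \<otimes>\<^bsub>gal E F\<^esub> \<tau>) \<in> Bij (gal_cosets E F M)"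
    using assms by (simp add: left_translation_Bij)
  show "left_translation E F M \<gamma> \<otimes>\<^bsub>BijGroup (gal_cosets E F M)\<^esub> left_translation E F M \<tau> \<in> Bij (gal_cosets E F M)"
    using monoid.m_closed[OF group.is_monoid[OF group_BijGroup], of _ "gal_cosets E F M"]
      left_translation_Bij[OF assms(1,2)] assms(3,4) by (simp add: BijGroup_simps)
  fix x assume x: "x \<in> gal_cosets E F M"
  then obtain \<rho> where r: "\<rho> \<in> \<Gamma>" "x = \<rho> <#\<^bsub>gal E F\<^esub> carrier (gal E M)"
    by (auto simp: gal_cosets_eq)
  then show "left_translation E F M (\<gamma> \<otimes>\<^bsub>gal E F\<^esub> \<tau>) x
      = (left_translation E F M \<gamma> \<otimes>\<^bsub>BijGroup (gal_cosets E F M)\<^esub> left_translation E F M \<tau>) x"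
    using assms x by (simp add: BijGroup_apply left_translation_Bij left_translation_coset G.m_assoc)
qed

lemma left_translation_one:
  assumes "F \<subseteq> M" "M \<subseteq> carrier E"
  shows "left_translation E F M \<one>\<^bsub>gal E F\<^esub> = \<one>\<^bsub>BijGroup (gal_cosets E F M)\<^esub>"
proof (rule Bij_eqI)
  show "left_translation E F M \<one>\<^bsub>gal E F\<^esub> \<in> Bij (gal_cosets E F M)"
    using assms by (simp add: left_translation_Bij)
  show "\<one>\<^bsub>BijGroup (gal_cosets E F M)\<^esub> \<in> Bij (gal_cosets E F M)"
    by (simp add: BijGroup_def id_Bij)
  fix x assume x: "x \<in> gal_cosets E F M"
  then obtain \<rho> where r: "\<rho> \<in> \<Gamma>" "x = \<rho> <#\<^bsub>gal E F\<^esub> carrier (gal E M)"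
    by (auto simp: gal_cosets_eq)
  then show "left_translation E F M \<one>\<^bsub>gal E F\<^esub> x = \<one>\<^bsub>BijGroup (gal_cosets E F M)\<^esub> x"
    using assms x by (simp add: left_translation_coset BijGroup_simps)
qed

end

locale gp = galois E F for E (structure) and F +
  fixes F' and P
  assumes F'_subfield: "subfield F' E" and F_F': "F \<subseteq> F'" and gp: "gp_subgroup E F F' P"
begin

abbreviation "\<Omega> \<equiv> gal_cosets E F F'"
abbreviation "B \<equiv> BijGroup \<Omega>"
abbreviation "\<Delta> \<equiv> carrier (gal E F')"
abbreviation "l \<equiv> left_translation E F F'"

lemma F'_sub: "F' \<subseteq> carrier E"
  using subfieldE(3)[OF F'_subfield] .

sublocale B: group B by (rule group_BijGroup)

lemma P_subgroup: "subgroup P B"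
  and P_regular: "x \<in> \<Omega> \<Longrightarrow> y \<in> \<Omega> \<Longrightarrow> \<exists>!p. p \<in> P \<and> p x = y"
  and P_normalised: "\<gamma> \<in> \<Gamma> \<Longrightarrow> conj_translation E F F' \<gamma> ` P = P"
  using gp by (auto simp: gp_subgroup_def regular_subgroup_def)

sublocale P: subgroup P B by (rule P_subgroup)

lemma P_Bij: "p \<in> P \<Longrightarrow> p \<in> Bij \<Omega>"
  using P.mem_carrier by (simp add: BijGroup_simps)

lemma l_B: "\<gamma> \<in> \<Gamma> \<Longrightarrow> l \<gamma> \<in> carrier B"
  using left_translation_Bij[OF F_F' F'_sub] by (simp add: BijGroup_simps)

lemma conj_eq: "conj_translation E F F' \<gamma> p = l \<gamma> \<otimes>\<^bsub>B\<^esub> p \<otimes>\<^bsub>B\<^esub> inv\<^bsub>B\<^esub> (l \<gamma>)"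
  by (simp add: conj_translation_def Let_def)

lemma base_coset: "\<Delta> = \<one>\<^bsub>gal E F\<^esub> <#\<^bsub>gal E F\<^esub> \<Delta>"
proof -
  have "\<Delta> \<subseteq> \<Gamma>" by (rule gal_mono[OF F_F'])
  then show ?thesis by (auto simp: l_coset_def subset_iff)
qed

lemma base_mem: "\<Delta> \<in> \<Omega>"
  using base_coset G.one_closed unfolding gal_cosets_eq by blast

lemma inv_P: "p \<in> P \<Longrightarrow> inv\<^bsub>perm_subgroup E F F' P\<^esub> p = inv\<^bsub>B\<^esub> p"
  by (rule B.m_inv_consistent[OF P_subgroup])

text \<open>The embedding of \<open>F'\<close> given by the coset \<open>p\<inverse>(\<Delta>)\<close>.\<close>

definition point :: "('a coset_perm) \<Rightarrow> 'a \<Rightarrow> 'a" where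
  "point p x = coset_app ((inv\<^bsub>perm_subgroup E F F' P\<^esub> p) \<Delta>) x"

lemma coset_of_perm:
  assumes "p \<in> P"
  obtains \<gamma> where "\<gamma> \<in> \<Gamma>" "(inv\<^bsub>B\<^esub> p) \<Delta> = \<gamma> <#\<^bsub>gal E F\<^esub> \<Delta>"
    "\<And>x. x \<in> F' \<Longrightarrow> point p x = \<gamma> x"
proof -
  have "(inv\<^bsub>B\<^esub> p) \<Delta> \<in> \<Omega>"
    using P_Bij[OF P.m_inv_closed[OF assms]] base_mem by (rule Bij_apply_closed)
  then obtain \<gamma> where g: "\<gamma> \<in> \<Gamma>" "(inv\<^bsub>B\<^esub> p) \<Delta> = \<gamma> <#\<^bsub>gal E F\<^esub> \<Delta>"
    by (auto simp: gal_cosets_eq)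
  then show ?thesis
    using that[OF g] coset_app_gal_coset[OF F_F' F'_sub g(1)] by (simp add: point_def inv_P[OF assms])
qed

lemma coset_of_perm_unique:
  assumes "p \<in> P" "\<gamma> \<in> \<Gamma>" "\<And>x. x \<in> F' \<Longrightarrow> point p x = \<gamma> x"
  shows "(inv\<^bsub>B\<^esub> p) \<Delta> = \<gamma> <#\<^bsub>gal E F\<^esub> \<Delta>"
proof -
  obtain \<tau> where t: "\<tau> \<in> \<Gamma>" "(inv\<^bsub>B\<^esub> p) \<Delta> = \<tau> <#\<^bsub>gal E F\<^esub> \<Delta>" "\<And>x. x \<in> F' \<Longrightarrow> point p x = \<tau> x"
    using coset_of_perm[OF assms(1)] by metis
  then show ?thesis using gal_coset_eq_iff[OF F_F' F'_sub t(1) assms(2)] assms(3) by simp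
qed

lemma P_eqI:
  assumes "p \<in> P" "q \<in> P" "(inv\<^bsub>B\<^esub> p) \<Delta> = (inv\<^bsub>B\<^esub> q) \<Delta>"
  shows "p = q"
proof -
  have "(inv\<^bsub>B\<^esub> p) \<Delta> \<in> \<Omega>"
    using P_Bij[OF P.m_inv_closed[OF assms(1)]] base_mem by (rule Bij_apply_closed)
  then have "\<exists>!r. r \<in> P \<and> r \<Delta> = (inv\<^bsub>B\<^esub> p) \<Delta>" by (rule P_regular[OF base_mem])
  then have "inv\<^bsub>B\<^esub> p = inv\<^bsub>B\<^esub> q" using assms P.m_inv_closed by metis
  then show ?thesis using assms B.inv_inj P.mem_carrier by (metis B.inv_inv)
qed

lemma conj_closed: "\<gamma> \<in> \<Gamma> \<Longrightarrow> p \<in> P \<Longrightarrow> conj_translation E F F' \<gamma> p \<in> P"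
  using P_normalised by blast

text \<open>With \<open>p\<inverse>(\<Delta>) = \<gamma>\<Delta>\<close> and \<open>q\<inverse>(\<Delta>) = \<tau>\<Delta>\<close>, the inverse of \<open>p \<cdot> l\<^sub>\<gamma> q l\<^sub>\<gamma>\<inverse>\<close> takes \<open>\<Delta>\<close> via
  \<open>\<gamma>\<Delta>\<close>, \<open>\<Delta>\<close> and \<open>\<tau>\<Delta>\<close> to \<open>\<gamma>\<tau>\<Delta>\<close>.\<close>

lemma point_twist:
  assumes g: "\<gamma> \<in> \<Gamma>" and p: "p \<in> P" and q: "q \<in> P"
    and pg: "\<And>x. x \<in> F' \<Longrightarrow> point p x = \<gamma> x" and x: "x \<in> F'"
  shows "\<gamma> (point q x) = point (p \<otimes>\<^bsub>B\<^esub> conj_translation E F F' \<gamma> q) x"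
proof -
  obtain \<tau> where t: "\<tau> \<in> \<Gamma>" "(inv\<^bsub>B\<^esub> q) \<Delta> = \<tau> <#\<^bsub>gal E F\<^esub> \<Delta>" "\<And>x. x \<in> F' \<Longrightarrow> point q x = \<tau> x"
    using coset_of_perm[OF q] by metis
  have pc: "(inv\<^bsub>B\<^esub> p) \<Delta> = \<gamma> <#\<^bsub>gal E F\<^esub> \<Delta>" by (rule coset_of_perm_unique[OF p g pg])
  let ?r = "p \<otimes>\<^bsub>B\<^esub> conj_translation E F F' \<gamma> q"
  have r: "?r \<in> P" using p conj_closed[OF g q] by (rule P.m_closed)
  note mem = P.mem_carrier[OF p] P.mem_carrier[OF q] l_B[OF g]
  have bij: "inv\<^bsub>B\<^esub> p \<in> Bij \<Omega>" "inv\<^bsub>B\<^esub> q \<in> Bij \<Omega>" "l \<gamma> \<in> Bij \<Omega>" "inv\<^bsub>B\<^esub> (l \<gamma>) \<in> Bij \<Omega>"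
    using mem by (simp_all add: BijGroup_simps BijGroup_inv_closed)
  have bij2: "inv\<^bsub>B\<^esub> (l \<gamma>) \<otimes>\<^bsub>B\<^esub> inv\<^bsub>B\<^esub> p \<in> Bij \<Omega>"
    "inv\<^bsub>B\<^esub> q \<otimes>\<^bsub>B\<^esub> (inv\<^bsub>B\<^esub> (l \<gamma>) \<otimes>\<^bsub>B\<^esub> inv\<^bsub>B\<^esub> p) \<in> Bij \<Omega>"
    using B.m_closed B.inv_closed mem unfolding BijGroup_simps(1)[symmetric] by simp_all
  have lD: "l \<gamma> \<Delta> = \<gamma> <#\<^bsub>gal E F\<^esub> \<Delta>"
    using left_translation_coset[OF F_F' F'_sub g G.one_closed] g by (simp flip: base_coset)
  have "inv\<^bsub>B\<^esub> ?r = l \<gamma> \<otimes>\<^bsub>B\<^esub> (inv\<^bsub>B\<^esub> q \<otimes>\<^bsub>B\<^esub> (inv\<^bsub>B\<^esub> (l \<gamma>) \<otimes>\<^bsub>B\<^esub> inv\<^bsub>B\<^esub> p))"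
    using mem unfolding conj_eq by (simp add: B.inv_mult_group B.m_assoc)
  then have "(inv\<^bsub>B\<^esub> ?r) \<Delta> = l \<gamma> ((inv\<^bsub>B\<^esub> q) ((inv\<^bsub>B\<^esub> (l \<gamma>)) (\<gamma> <#\<^bsub>gal E F\<^esub> \<Delta>)))"
    using bij bij2 base_mem by (simp add: BijGroup_apply pc)
  also have "(inv\<^bsub>B\<^esub> (l \<gamma>)) (\<gamma> <#\<^bsub>gal E F\<^esub> \<Delta>) = \<Delta>"
    using BijGroup_inv_apply[OF bij(3) base_mem] by (simp add: lD)
  also have "l \<gamma> ((inv\<^bsub>B\<^esub> q) \<Delta>) = (\<gamma> \<otimes>\<^bsub>gal E F\<^esub> \<tau>) <#\<^bsub>gal E F\<^esub> \<Delta>"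
    unfolding t(2) by (rule left_translation_coset[OF F_F' F'_sub g t(1)])
  finally have "point ?r x = (\<gamma> \<otimes>\<^bsub>gal E F\<^esub> \<tau>) x"
    using coset_app_gal_coset[OF F_F' F'_sub _ x, of "\<gamma> \<otimes>\<^bsub>gal E F\<^esub> \<tau>"] g t(1)
    by (simp add: point_def inv_P[OF r])
  then show ?thesis using g t x F'_sub by (auto simp: gal_comp_apply subset_iff)
qed

lemma point_action:
  "gal_point_action E F (perm_subgroup E F F' P) (conj_translation E F F') F' point"
proof (intro gal_point_action.intro gal_group_action.intro gal_point_action_axioms.intro
    gal_group_action_axioms.intro)
  show "galois E F" by (rule galois_axioms)
  show "group (perm_subgroup E F F' P)" by (rule P.subgroup_is_group) (rule B.group_axioms)
  show "finite (carrier (perm_subgroup E F F' P))"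
    using regular_subgroup_finite[OF _ finite_gal_cosets base_mem] gp by (simp add: gp_subgroup_def)
next
  fix \<gamma> p assume g: "\<gamma> \<in> \<Gamma>" and p: "p \<in> carrier (perm_subgroup E F F' P)"
  show "conj_translation E F F' \<gamma> p \<in> carrier (perm_subgroup E F F' P)"
    using conj_closed[OF g] p by simp
  fix q assume q: "q \<in> carrier (perm_subgroup E F F' P)"
  show "conj_translation E F F' \<gamma> (p \<otimes>\<^bsub>perm_subgroup E F F' P\<^esub> q)
    = conj_translation E F F' \<gamma> p \<otimes>\<^bsub>perm_subgroup E F F' P\<^esub> conj_translation E F F' \<gamma> q"
    using B.conj_mult[OF l_B[OF g], of p q] p q P.mem_carrier[of p] P.mem_carrier[of q]
    by (simp add: conj_eq)
next
  fix \<gamma> \<tau> p assume g: "\<gamma> \<in> \<Gamma>" "\<tau> \<in> \<Gamma>"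
    and p: "p \<in> carrier (perm_subgroup E F F' P)"
  show "conj_translation E F F' (\<gamma> \<otimes>\<^bsub>gal E F\<^esub> \<tau>) p = conj_translation E F F' \<gamma> (conj_translation E F F' \<tau> p)"
    unfolding conj_eq left_translation_mult[OF F_F' F'_sub g]
    using P.mem_carrier[of p] p l_B[OF g(1)] l_B[OF g(2)] by (simp add: B.inv_mult_group B.m_assoc)
next
  fix p assume p: "p \<in> carrier (perm_subgroup E F F' P)"
  show "conj_translation E F F' \<one>\<^bsub>gal E F\<^esub> p = p"
    unfolding conj_eq left_translation_one[OF F_F' F'_sub]
    using P.mem_carrier[of p] p by simp
next
  show "subfield F' E" "F \<subseteq> F'" by (rule F'_subfield F_F')+
next
  fix p assume "p \<in> carrier (perm_subgroup E F F' P)"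
  then have "p \<in> P" by simp
  then obtain \<gamma> where "\<gamma> \<in> \<Gamma>" "\<And>x. x \<in> F' \<Longrightarrow> point p x = \<gamma> x"
    using coset_of_perm[of p] by metis
  then show "\<exists>\<gamma>\<in>\<Gamma>. \<forall>x\<in>F'. point p x = \<gamma> x" by auto
next
  fix \<gamma> assume g: "\<gamma> \<in> \<Gamma>"
  then have "\<gamma> <#\<^bsub>gal E F\<^esub> \<Delta> \<in> \<Omega>" by (simp add: gal_cosets_eq)
  then obtain r where r: "r \<in> P" "r \<Delta> = \<gamma> <#\<^bsub>gal E F\<^esub> \<Delta>" using P_regular[OF base_mem] by blast
  have "point (inv\<^bsub>B\<^esub> r) x = \<gamma> x" if "x \<in> F'" for x
    using coset_app_gal_coset[OF F_F' F'_sub g that] r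
    by (simp add: point_def inv_P P.m_inv_closed P.mem_carrier)
  then show "\<exists>p\<in>carrier (perm_subgroup E F F' P). \<forall>x\<in>F'. point p x = \<gamma> x"
    using P.m_inv_closed[OF r(1)] by auto
next
  fix p q assume "p \<in> carrier (perm_subgroup E F F' P)" "q \<in> carrier (perm_subgroup E F F' P)"
    and eq: "\<And>x. x \<in> F' \<Longrightarrow> point p x = point q x"
  then have pq: "p \<in> P" "q \<in> P" by auto
  obtain \<tau> where t: "\<tau> \<in> \<Gamma>" "(inv\<^bsub>B\<^esub> q) \<Delta> = \<tau> <#\<^bsub>gal E F\<^esub> \<Delta>" "\<And>x. x \<in> F' \<Longrightarrow> point q x = \<tau> x"
    using coset_of_perm[OF pq(2)] by metis
  show "p = q"
    using coset_of_perm_unique[OF pq(1) t(1)] eq t by (intro P_eqI[OF pq]) auto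
next
  fix x assume x: "x \<in> F'"
  have "point \<one>\<^bsub>B\<^esub> x = \<one>\<^bsub>gal E F\<^esub> x"
    using coset_app_gal_coset[OF F_F' F'_sub G.one_closed x] base_mem
    by (simp add: point_def inv_P P.one_closed BijGroup_simps flip: base_coset)
  then show "point \<one>\<^bsub>perm_subgroup E F F' P\<^esub> x = x"
    using x F'_sub by (auto simp: gal_id_apply)
next
  fix \<gamma> p q x assume "\<gamma> \<in> \<Gamma>" "p \<in> carrier (perm_subgroup E F F' P)"
    "q \<in> carrier (perm_subgroup E F F' P)" "\<And>x. x \<in> F' \<Longrightarrow> point p x = \<gamma> x" "x \<in> F'"
  then show "\<gamma> (point q x)
    = point (p \<otimes>\<^bsub>perm_subgroup E F F' P\<^esub> conj_translation E F F' \<gamma> q) x"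
    using point_twist by simp
qed

theorem gp_hopf_galois: "hopf_galois_structure E F F' (gp_hopf E F F' P) (gp_action E F F' P)"
proof -
  interpret A: gal_point_action E F "perm_subgroup E F F' P" "conj_translation E F F'" F' point
    by (rule point_action)
  have "gp_hopf E F F' P = descended_hopf E F (perm_subgroup E F F' P) (conj_translation E F F')"
    by (simp add: gp_hopf_def descended_hopf_def Let_def gp_fixed_def descended_def group_algebra_def)
  moreover have "gp_action E F F' P = A.act"
    by (intro ext) (simp add: gp_action_def A.act_def point_def)
  ultimately show ?thesis using A.descended_hopf_galois by simp
qed

end

text \<open>All conditions speak of \<open>F\<close>, \<open>F'\<close> and their operations, which the Galois closure \<open>M\<close> shares
  with the larger field \<open>E\<close>.\<close>

lemma hopf_galois_structure_extend_ambient: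
  assumes hg: "hopf_galois_structure (E\<lparr>carrier := M\<rparr>) F F' A act"
    and "field E" "subfield F E" "subfield F' E"
  shows "hopf_galois_structure E F F' A act"
proof -
  interpret hopf_galois_structure "E\<lparr>carrier := M\<rparr>" F F' A act by fact
  show ?thesis
    using hopf findim cocomm act_linear act_linear_left act_one act_act act_unit act_mult surjective
      injective subfields(3) assms(2-4)
    by (intro hopf_galois_structure.intro) simp_all
qed

lemma hopf_iso_id: "hopf_iso R A A id"
  unfolding hopf_iso_def
  by (auto simp: ring_iso_def linear_map_def tensor_eq_def intro!: ring_hom_memI)

section \<open>Products of regular permutation groups\<close>

text \<open>A set \<open>\<Omega>\<close> identified with a product by its two coordinate functions.\<close>

locale product_action =
  fixes \<Omega> :: "'z set" and \<Omega>1 :: "'x set" and \<Omega>2 :: "'y set" and f1 f2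
  assumes bij: "bij_betw (\<lambda>z. (f1 z, f2 z)) \<Omega> (\<Omega>1 \<times> \<Omega>2)"
    and nonempty: "\<Omega>1 \<noteq> {}" "\<Omega>2 \<noteq> {}"
begin

definition prod_perm :: "('x \<Rightarrow> 'x) \<Rightarrow> ('y \<Rightarrow> 'y) \<Rightarrow> 'z \<Rightarrow> 'z" where
  "prod_perm n m = (\<lambda>z\<in>\<Omega>. inv_into \<Omega> (\<lambda>z. (f1 z, f2 z)) (n (f1 z), m (f2 z)))"

lemma f_closed: "z \<in> \<Omega> \<Longrightarrow> f1 z \<in> \<Omega>1" "z \<in> \<Omega> \<Longrightarrow> f2 z \<in> \<Omega>2"
  using bij by (auto simp: bij_betw_def)

lemma f_inj: "z \<in> \<Omega> \<Longrightarrow> z' \<in> \<Omega> \<Longrightarrow> f1 z = f1 z' \<Longrightarrow> f2 z = f2 z' \<Longrightarrow> z = z'"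
  using bij by (auto simp: bij_betw_def inj_on_def)

lemma f_surj:
  assumes "x \<in> \<Omega>1" "y \<in> \<Omega>2"
  obtains z where "z \<in> \<Omega>" "f1 z = x" "f2 z = y"
proof -
  have "(x, y) \<in> (\<lambda>z. (f1 z, f2 z)) ` \<Omega>" using bij assms by (simp add: bij_betw_def)
  then show ?thesis using that by auto
qed

lemma prod_perm_apply:
  assumes "n \<in> Bij \<Omega>1" "m \<in> Bij \<Omega>2" "z \<in> \<Omega>"
  shows "prod_perm n m z \<in> \<Omega>" "f1 (prod_perm n m z) = n (f1 z)" "f2 (prod_perm n m z) = m (f2 z)"
proof -
  let ?f = "\<lambda>z. (f1 z, f2 z)"
  have "(n (f1 z), m (f2 z)) \<in> ?f ` \<Omega>"
    using bij f_closed[OF assms(3)] Bij_apply_closed[OF assms(1)] Bij_apply_closed[OF assms(2)]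
    by (simp add: bij_betw_def)
  from inv_into_into[OF this] f_inv_into_f[OF this]
  show "prod_perm n m z \<in> \<Omega>" "f1 (prod_perm n m z) = n (f1 z)" "f2 (prod_perm n m z) = m (f2 z)"
    using assms(3) by (simp_all add: prod_perm_def)
qed

lemma prod_perm_eqI:
  assumes "n \<in> Bij \<Omega>1" "m \<in> Bij \<Omega>2" "p \<in> extensional \<Omega>"
    and "\<And>z. z \<in> \<Omega> \<Longrightarrow> p z \<in> \<Omega>" "\<And>z. z \<in> \<Omega> \<Longrightarrow> f1 (p z) = n (f1 z)" "\<And>z. z \<in> \<Omega> \<Longrightarrow> f2 (p z) = m (f2 z)"
  shows "p = prod_perm n m"
proof (rule extensionalityI[of _ \<Omega>])
  show "prod_perm n m \<in> extensional \<Omega>" by (simp add: prod_perm_def)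
  fix z assume "z \<in> \<Omega>"
  then show "p z = prod_perm n m z"
    using assms prod_perm_apply[OF assms(1,2)] by (intro f_inj) auto
qed (rule assms(3))

lemma prod_perm_comp:
  assumes "n \<in> Bij \<Omega>1" "m \<in> Bij \<Omega>2" "n' \<in> Bij \<Omega>1" "m' \<in> Bij \<Omega>2" "z \<in> \<Omega>"
  shows "prod_perm n m (prod_perm n' m' z) = prod_perm (compose \<Omega>1 n n') (compose \<Omega>2 m m') z"
  using assms f_closed[OF assms(5)]
  by (intro f_inj) (simp_all add: prod_perm_apply compose_Bij compose_eq)

lemma prod_perm_id: "z \<in> \<Omega> \<Longrightarrow> prod_perm (\<lambda>x\<in>\<Omega>1. x) (\<lambda>x\<in>\<Omega>2. x) z = z"
  using f_closed by (intro f_inj) (simp_all add: prod_perm_apply id_Bij)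

lemma prod_perm_Bij:
  assumes n: "n \<in> Bij \<Omega>1" and m: "m \<in> Bij \<Omega>2"
  shows "prod_perm n m \<in> Bij \<Omega>"
proof -
  let ?n = "restrict (inv_into \<Omega>1 n) \<Omega>1" and ?m = "restrict (inv_into \<Omega>2 m) \<Omega>2"
  have nm: "?n \<in> Bij \<Omega>1" "?m \<in> Bij \<Omega>2" using n m by (auto intro: restrict_inv_into_Bij)
  have "compose \<Omega>1 ?n n = (\<lambda>x\<in>\<Omega>1. x)" "compose \<Omega>2 ?m m = (\<lambda>x\<in>\<Omega>2. x)"
    using Bij_compose_restrict_eq n m by blast+
  moreover have "compose \<Omega>1 n ?n = (\<lambda>x\<in>\<Omega>1. x)" "compose \<Omega>2 m ?m = (\<lambda>x\<in>\<Omega>2. x)"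
    using n m by (auto simp: Bij_def intro!: compose_id_inv_into[THEN trans] simp: bij_betw_def)
  ultimately have "prod_perm ?n ?m (prod_perm n m z) = z" "prod_perm n m (prod_perm ?n ?m z) = z"
    if "z \<in> \<Omega>" for z
    using prod_perm_comp[OF nm n m that] prod_perm_comp[OF n m nm that] prod_perm_id[OF that] by simp_all
  then have "bij_betw (prod_perm n m) \<Omega> \<Omega>"
    using prod_perm_apply(1)[OF n m] prod_perm_apply(1)[OF nm]
    by (intro bij_betwI[where g = "prod_perm ?n ?m"]) auto
  then show ?thesis by (simp add: Bij_def prod_perm_def)
qed

lemma prod_perm_hom:
  "group_hom (BijGroup \<Omega>1 \<times>\<times> BijGroup \<Omega>2) (BijGroup \<Omega>) (\<lambda>(n, m). prod_perm n m)"
proof (intro group_hom.intro group_hom_axioms.intro DirProd_group group_BijGroup homI)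
  fix x assume "x \<in> carrier (BijGroup \<Omega>1 \<times>\<times> BijGroup \<Omega>2)"
  then show "(case x of (n, m) \<Rightarrow> prod_perm n m) \<in> carrier (BijGroup \<Omega>)"
    by (auto simp: BijGroup_simps prod_perm_Bij)
next
  fix x y assume xy: "x \<in> carrier (BijGroup \<Omega>1 \<times>\<times> BijGroup \<Omega>2)" "y \<in> carrier (BijGroup \<Omega>1 \<times>\<times> BijGroup \<Omega>2)"
  obtain n m n' m' where e: "x = (n, m)" "y = (n', m')" by (cases x; cases y)
  have mem: "n \<in> Bij \<Omega>1" "m \<in> Bij \<Omega>2" "n' \<in> Bij \<Omega>1" "m' \<in> Bij \<Omega>2"
    using xy e by (auto simp: BijGroup_simps)
  have "prod_perm (compose \<Omega>1 n n') (compose \<Omega>2 m m') = compose \<Omega> (prod_perm n m) (prod_perm n' m')"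
    by (rule Bij_eqI[of _ \<Omega>])
      (simp_all add: mem compose_Bij prod_perm_Bij prod_perm_comp compose_eq)
  then show "(case x \<otimes>\<^bsub>BijGroup \<Omega>1 \<times>\<times> BijGroup \<Omega>2\<^esub> y of (n, m) \<Rightarrow> prod_perm n m)
      = (case x of (n, m) \<Rightarrow> prod_perm n m) \<otimes>\<^bsub>BijGroup \<Omega>\<^esub> (case y of (n, m) \<Rightarrow> prod_perm n m)"
    using mem e by (simp add: BijGroup_def prod_perm_Bij)
qed

lemma prod_perm_inj:
  assumes "n \<in> Bij \<Omega>1" "m \<in> Bij \<Omega>2" "n' \<in> Bij \<Omega>1" "m' \<in> Bij \<Omega>2" and eq: "prod_perm n m = prod_perm n' m'"
  shows "n = n'" "m = m'"
proof -
  show "n = n'"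
  proof (rule Bij_eqI[OF assms(1,3)])
    fix x assume x: "x \<in> \<Omega>1"
    obtain y where y: "y \<in> \<Omega>2" using nonempty by auto
    obtain z where "z \<in> \<Omega>" "f1 z = x" using f_surj[OF x y] by blast
    then show "n x = n' x"
      using prod_perm_apply(2)[OF assms(1,2)] prod_perm_apply(2)[OF assms(3,4)] eq by metis
  qed
  show "m = m'"
  proof (rule Bij_eqI[OF assms(2,4)])
    fix y assume y: "y \<in> \<Omega>2"
    obtain x where x: "x \<in> \<Omega>1" using nonempty by auto
    obtain z where "z \<in> \<Omega>" "f2 z = y" using f_surj[OF x y] by blast
    then show "m y = m' y"
      using prod_perm_apply(3)[OF assms(1,2)] prod_perm_apply(3)[OF assms(3,4)] eq by metis
  qed
qed

context
  fixes P1 P2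
  assumes P1: "regular_subgroup P1 \<Omega>1" and P2: "regular_subgroup P2 \<Omega>2"
begin

lemma P12_Bij: "n \<in> P1 \<Longrightarrow> n \<in> Bij \<Omega>1" "m \<in> P2 \<Longrightarrow> m \<in> Bij \<Omega>2"
  using subgroup.subset[of P1 "BijGroup \<Omega>1"] subgroup.subset[of P2 "BijGroup \<Omega>2"] P1 P2
  by (auto simp: regular_subgroup_def BijGroup_simps)

lemma prod_perm_regular: "regular_subgroup ((\<lambda>(n, m). prod_perm n m) ` (P1 \<times> P2)) \<Omega>"
  unfolding regular_subgroup_def
proof (intro conjI ballI)
  interpret hom: group_hom "BijGroup \<Omega>1 \<times>\<times> BijGroup \<Omega>2" "BijGroup \<Omega>" "\<lambda>(n, m). prod_perm n m"
    by (rule prod_perm_hom)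
  have "subgroup (P1 \<times> P2) (BijGroup \<Omega>1 \<times>\<times> BijGroup \<Omega>2)"
    using P1 P2 by (intro DirProd_subgroups group_BijGroup) (auto simp: regular_subgroup_def)
  then show "subgroup ((\<lambda>(n, m). prod_perm n m) ` (P1 \<times> P2)) (BijGroup \<Omega>)"
    by (rule hom.subgroup_img_is_subgroup)
  fix z w assume z: "z \<in> \<Omega>" and w: "w \<in> \<Omega>"
  have "\<exists>!n. n \<in> P1 \<and> n (f1 z) = f1 w" "\<exists>!m. m \<in> P2 \<and> m (f2 z) = f2 w"
    using P1 P2 f_closed[OF z] f_closed[OF w] by (simp_all add: regular_subgroup_def)
  then obtain n m where nm: "n \<in> P1" "n (f1 z) = f1 w" "m \<in> P2" "m (f2 z) = f2 w"
    and uniq: "\<And>n'. n' \<in> P1 \<Longrightarrow> n' (f1 z) = f1 w \<Longrightarrow> n' = n" "\<And>m'. m' \<in> P2 \<Longrightarrow> m' (f2 z) = f2 w \<Longrightarrow> m' = m"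
    by metis
  show "\<exists>!p. p \<in> (\<lambda>(n, m). prod_perm n m) ` (P1 \<times> P2) \<and> p z = w"
  proof (rule ex1I[of _ "prod_perm n m"])
    have "prod_perm n m z = w"
      using nm z w prod_perm_apply[OF P12_Bij(1)[OF nm(1)] P12_Bij(2)[OF nm(3)] z] by (intro f_inj) auto
    then show "prod_perm n m \<in> (\<lambda>(n, m). prod_perm n m) ` (P1 \<times> P2) \<and> prod_perm n m z = w"
      using nm by auto
    fix p assume p: "p \<in> (\<lambda>(n, m). prod_perm n m) ` (P1 \<times> P2) \<and> p z = w"
    then obtain n' m' where "n' \<in> P1" "m' \<in> P2" "p = prod_perm n' m'" by auto
    then show "p = prod_perm n m"
      using p uniq prod_perm_apply[OF P12_Bij(1)[of n'] P12_Bij(2)[of m'] z] by auto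
  qed
qed

lemma prod_perm_iso:
  "(\<lambda>(n, m). prod_perm n m) \<in>
     iso ((BijGroup \<Omega>1)\<lparr>carrier := P1\<rparr> \<times>\<times> (BijGroup \<Omega>2)\<lparr>carrier := P2\<rparr>)
         ((BijGroup \<Omega>)\<lparr>carrier := (\<lambda>(n, m). prod_perm n m) ` (P1 \<times> P2)\<rparr>)"
proof (rule isoI)
  interpret hom: group_hom "BijGroup \<Omega>1 \<times>\<times> BijGroup \<Omega>2" "BijGroup \<Omega>" "\<lambda>(n, m). prod_perm n m"
    by (rule prod_perm_hom)
  show "(\<lambda>(n, m). prod_perm n m) \<in>
     hom ((BijGroup \<Omega>1)\<lparr>carrier := P1\<rparr> \<times>\<times> (BijGroup \<Omega>2)\<lparr>carrier := P2\<rparr>)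
         ((BijGroup \<Omega>)\<lparr>carrier := (\<lambda>(n, m). prod_perm n m) ` (P1 \<times> P2)\<rparr>)"
  proof (rule homI)
    fix x y assume "x \<in> carrier ((BijGroup \<Omega>1)\<lparr>carrier := P1\<rparr> \<times>\<times> (BijGroup \<Omega>2)\<lparr>carrier := P2\<rparr>)"
      "y \<in> carrier ((BijGroup \<Omega>1)\<lparr>carrier := P1\<rparr> \<times>\<times> (BijGroup \<Omega>2)\<lparr>carrier := P2\<rparr>)"
    then show "(case x \<otimes>\<^bsub>(BijGroup \<Omega>1)\<lparr>carrier := P1\<rparr> \<times>\<times> (BijGroup \<Omega>2)\<lparr>carrier := P2\<rparr>\<^esub> y of (n, m) \<Rightarrow> prod_perm n m)
      = (case x of (n, m) \<Rightarrow> prod_perm n m) \<otimes>\<^bsub>(BijGroup \<Omega>)\<lparr>carrier := (\<lambda>(n, m). prod_perm n m) ` (P1 \<times> P2)\<rparr>\<^esub>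
        (case y of (n, m) \<Rightarrow> prod_perm n m)"
      using hom.hom_mult[of x y] P12_Bij by (auto simp: BijGroup_simps mult_DirProd')
  qed auto
  have "inj_on (\<lambda>(n, m). prod_perm n m) (P1 \<times> P2)"
    by (rule inj_onI) (auto dest: prod_perm_inj[OF P12_Bij(1) P12_Bij(2) P12_Bij(1) P12_Bij(2)])
  then show "bij_betw (\<lambda>(n, m). prod_perm n m)
      (carrier ((BijGroup \<Omega>1)\<lparr>carrier := P1\<rparr> \<times>\<times> (BijGroup \<Omega>2)\<lparr>carrier := P2\<rparr>))
      (carrier ((BijGroup \<Omega>)\<lparr>carrier := (\<lambda>(n, m). prod_perm n m) ` (P1 \<times> P2)\<rparr>))"
    by (simp add: bij_betw_def)
qed

text \<open>\<^const>\<open>prod_perm\<close> is a homomorphism, so conjugation is carried out in each factor.\<close>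

lemma prod_perm_conj:
  assumes l: "l1 \<in> Bij \<Omega>1" "l2 \<in> Bij \<Omega>2"
    and inv1: "(\<lambda>p. l1 \<otimes>\<^bsub>BijGroup \<Omega>1\<^esub> p \<otimes>\<^bsub>BijGroup \<Omega>1\<^esub> inv\<^bsub>BijGroup \<Omega>1\<^esub> l1) ` P1 = P1"
    and inv2: "(\<lambda>p. l2 \<otimes>\<^bsub>BijGroup \<Omega>2\<^esub> p \<otimes>\<^bsub>BijGroup \<Omega>2\<^esub> inv\<^bsub>BijGroup \<Omega>2\<^esub> l2) ` P2 = P2"
  shows "(\<lambda>p. prod_perm l1 l2 \<otimes>\<^bsub>BijGroup \<Omega>\<^esub> p \<otimes>\<^bsub>BijGroup \<Omega>\<^esub> inv\<^bsub>BijGroup \<Omega>\<^esub> (prod_perm l1 l2)) `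
    (\<lambda>(n, m). prod_perm n m) ` (P1 \<times> P2) = (\<lambda>(n, m). prod_perm n m) ` (P1 \<times> P2)"
proof -
  interpret hom: group_hom "BijGroup \<Omega>1 \<times>\<times> BijGroup \<Omega>2" "BijGroup \<Omega>" "\<lambda>(n, m). prod_perm n m"
    by (rule prod_perm_hom)
  let ?c1 = "\<lambda>p. l1 \<otimes>\<^bsub>BijGroup \<Omega>1\<^esub> p \<otimes>\<^bsub>BijGroup \<Omega>1\<^esub> inv\<^bsub>BijGroup \<Omega>1\<^esub> l1"
  let ?c2 = "\<lambda>p. l2 \<otimes>\<^bsub>BijGroup \<Omega>2\<^esub> p \<otimes>\<^bsub>BijGroup \<Omega>2\<^esub> inv\<^bsub>BijGroup \<Omega>2\<^esub> l2"
  have conj: "prod_perm l1 l2 \<otimes>\<^bsub>BijGroup \<Omega>\<^esub> prod_perm n m \<otimes>\<^bsub>BijGroup \<Omega>\<^esub> inv\<^bsub>BijGroup \<Omega>\<^esub> (prod_perm l1 l2)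
      = prod_perm (?c1 n) (?c2 m)" if "n \<in> P1" "m \<in> P2" for n m
  proof -
    let ?D = "BijGroup \<Omega>1 \<times>\<times> BijGroup \<Omega>2"
    have mem: "(l1, l2) \<in> carrier ?D" "(n, m) \<in> carrier ?D"
      using l P12_Bij that by (auto simp: BijGroup_simps)
    have inv: "inv\<^bsub>?D\<^esub> (l1, l2) = (inv\<^bsub>BijGroup \<Omega>1\<^esub> l1, inv\<^bsub>BijGroup \<Omega>2\<^esub> l2)"
      using l by (intro inv_DirProd group_BijGroup) (auto simp: BijGroup_simps)
    have "(\<lambda>(n, m). prod_perm n m) ((l1, l2) \<otimes>\<^bsub>?D\<^esub> (n, m) \<otimes>\<^bsub>?D\<^esub> inv\<^bsub>?D\<^esub> (l1, l2))
        = prod_perm l1 l2 \<otimes>\<^bsub>BijGroup \<Omega>\<^esub> prod_perm n m \<otimes>\<^bsub>BijGroup \<Omega>\<^esub> inv\<^bsub>BijGroup \<Omega>\<^esub> (prod_perm l1 l2)"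
      using hom.hom_mult[of "(l1, l2) \<otimes>\<^bsub>?D\<^esub> (n, m)" "inv\<^bsub>?D\<^esub> (l1, l2)"] hom.hom_mult[OF mem]
        hom.hom_inv[OF mem(1)] hom.G.m_closed[OF mem] hom.G.inv_closed[OF mem(1)]
      by simp
    then show ?thesis unfolding inv by simp
  qed
  have "(\<lambda>p. prod_perm l1 l2 \<otimes>\<^bsub>BijGroup \<Omega>\<^esub> p \<otimes>\<^bsub>BijGroup \<Omega>\<^esub> inv\<^bsub>BijGroup \<Omega>\<^esub> (prod_perm l1 l2)) `
      (\<lambda>(n, m). prod_perm n m) ` (P1 \<times> P2) = (\<lambda>(n, m). prod_perm n m) ` (\<lambda>(n, m). (?c1 n, ?c2 m)) ` (P1 \<times> P2)"
    unfolding image_image by (rule image_cong[OF refl]) (auto simp: conj)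
  also have "(\<lambda>(n, m). (?c1 n, ?c2 m)) ` (P1 \<times> P2) = (?c1 ` P1) \<times> (?c2 ` P2)" by auto
  finally show ?thesis unfolding inv1 inv2 .
qed

end

end

section \<open>Semidirect decompositions\<close>

text \<open>\<open>\<pi>\<close> is the projection with kernel \<open>H\<close>: \<open>\<pi> g\<close> is the element \<open>s\<close> of \<open>S\<close> with \<open>g \<in> H s\<close>.\<close>

lemma (in group) semidirect_projection:
  assumes "H \<lhd> G" "subgroup S G" "H <#> S = carrier G" "H \<inter> S = {\<one>}"
  obtains \<pi> where "\<pi> \<in> hom G G" "\<And>g. g \<in> carrier G \<Longrightarrow> \<pi> g \<in> S" "\<And>s. s \<in> S \<Longrightarrow> \<pi> s = s"
proof -
  interpret H: normal H G by fact
  interpret S: subgroup S G by fact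
  have ex: "\<exists>s. s \<in> S \<and> g \<otimes> inv s \<in> H" if "g \<in> carrier G" for g
  proof -
    have "g \<in> H <#> S" using that assms(3) by simp
    then obtain h s where "h \<in> H" "s \<in> S" "g = h \<otimes> s" by (auto simp: set_mult_def)
    then show ?thesis by (intro exI[of _ s]) (simp add: m_assoc)
  qed
  define \<pi> where "\<pi> g = (SOME s. s \<in> S \<and> g \<otimes> inv s \<in> H)" for g
  have pi: "\<pi> g \<in> S" "g \<otimes> inv (\<pi> g) \<in> H" if "g \<in> carrier G" for g
    using someI_ex[OF ex[OF that]] by (simp_all add: \<pi>_def)
  have uniq: "\<pi> g = s" if g: "g \<in> carrier G" and s: "s \<in> S" "g \<otimes> inv s \<in> H" for g s
  proof -
    have c: "\<pi> g \<in> carrier G" "s \<in> carrier G" using pi[OF g] s by auto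
    have "inv (g \<otimes> inv (\<pi> g)) \<otimes> (g \<otimes> inv s) \<in> H" using H.m_closed[OF H.m_inv_closed[OF pi(2)[OF g]] s(2)] .
    also have "inv (g \<otimes> inv (\<pi> g)) \<otimes> (g \<otimes> inv s) = \<pi> g \<otimes> inv s"
    proof -
      have "inv g \<otimes> (g \<otimes> inv s) = inv s" using g c by (simp flip: m_assoc)
      then show ?thesis using g c by (simp add: inv_mult_group m_assoc)
    qed
    finally have "\<pi> g \<otimes> inv s \<in> H \<inter> S" using pi[OF g] s by auto
    then have "\<pi> g \<otimes> inv s = \<one>" using assms(4) by auto
    then show ?thesis using c by (metis inv_equality inv_inv inv_closed)
  qed
  have "\<pi> \<in> hom G G"
  proof (rule homI)
    show "\<pi> g \<in> carrier G" if "g \<in> carrier G" for g using pi(1)[OF that] by auto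
    fix g g' assume g: "g \<in> carrier G" "g' \<in> carrier G"
    note p = pi[OF g(1)] pi[OF g(2)]
    have c: "\<pi> g \<in> carrier G" "\<pi> g' \<in> carrier G" using p by auto
    have "\<pi> g \<otimes> (g' \<otimes> inv (\<pi> g')) \<otimes> inv (\<pi> g) \<in> H" using H.inv_op_closed2[OF c(1) p(4)] .
    then have "(g \<otimes> inv (\<pi> g)) \<otimes> (\<pi> g \<otimes> (g' \<otimes> inv (\<pi> g')) \<otimes> inv (\<pi> g)) \<in> H"
      using H.m_closed[OF p(2)] by simp
    also have "(g \<otimes> inv (\<pi> g)) \<otimes> (\<pi> g \<otimes> (g' \<otimes> inv (\<pi> g')) \<otimes> inv (\<pi> g))
        = (g \<otimes> g') \<otimes> inv (\<pi> g \<otimes> \<pi> g')"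
    proof -
      have "inv (\<pi> g) \<otimes> (\<pi> g \<otimes> z) = z" if "z \<in> carrier G" for z using that c by (simp flip: m_assoc)
      then show ?thesis using g c by (simp add: inv_mult_group m_assoc)
    qed
    finally show "\<pi> (g \<otimes> g') = \<pi> g \<otimes> \<pi> g'" using g p by (intro uniq) auto
  qed
  moreover have "\<pi> s = s" if "s \<in> S" for s using that by (intro uniq) auto
  ultimately show ?thesis using that pi(1) by blast
qed

section \<open>The induced structure\<close>

theorem corollary5p5:
  fixes E :: "('e, 'm) ring_scheme" and K L L' :: "'e set"
    and G :: "('e \<Rightarrow> 'e) monoid" and H S S' :: "('e \<Rightarrow> 'e) set"
    and N :: "('n, 'i) monoid_scheme" and M :: "('p, 'j) monoid_scheme"
    and A :: "('e, 'a, 'k) hopf_scheme" and actA :: "'a \<Rightarrow> 'e \<Rightarrow> 'e"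
    and B :: "('e, 'b, 'l) hopf_scheme" and actB :: "'b \<Rightarrow> 'e \<Rightarrow> 'e"
  assumes "finite_galois E K" and "G = gal E K"
    and "H \<lhd> G" and "subgroup S G"
    and "H <#>\<^bsub>G\<^esub> S = carrier G" and "H \<inter> S = {\<one>\<^bsub>G\<^esub>}"
    and "subgroup S' (G\<lparr>carrier := S\<rparr>)"
    and "L = fixed_field E S" and "L' = fixed_field E S'"
    and "group N" and "group M"
    and "hopf_galois_structure_of_type E K L A actA N"
    and "hopf_galois_structure_of_type E L L' B actB M"
  shows "\<exists>(C :: ('e, 'e coset_perm \<Rightarrow> 'e) hopf) actC.
           hopf_galois_structure_of_type E K L' C actC (N \<times>\<times> M)"
proof -
  interpret K: galois E K by (rule finite_galois_imp_galois[OF assms(1)])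
  have S: "subgroup S (gal E K)" using assms(2,4) by simp
  have S': "subgroup S' (gal E K)"
    using K.G.incl_subgroup[OF S] assms(2,7) by simp
  have SS: "S \<subseteq> carrier (gal E K)" "S' \<subseteq> carrier (gal E K)"
    using subgroup.subset[OF S] subgroup.subset[OF S'] by auto
  have "S' \<subseteq> S" using subgroup.subset[OF assms(7)] by simp
  then have LL': "L \<subseteq> L'" by (auto simp: assms(8,9) fixed_field_def)
  have KL: "K \<subseteq> L" unfolding assms(8) by (rule K.F_in_fixed_field[OF SS(1)])
  have sL: "subfield L E" "subfield L' E"
    unfolding assms(8,9) using K.fixed_field_subfield SS by auto
  have LE: "L \<subseteq> carrier E" "L' \<subseteq> carrier E" using subfieldE(3)[OF sL(1)] subfieldE(3)[OF sL(2)] by auto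
  have galL: "carrier (gal E L) = S" "carrier (gal E L') = S'"
    unfolding assms(8,9) by (rule K.gal_fixed_field, fact)+
  interpret L: galois E L by (rule K.galois_intermediate[OF sL(1) KL])
  have KL': "K \<subseteq> L'" using KL LL' by auto

  obtain M1 P1 where M1: "galois_closure E K L M1" and P1: "gp_subgroup (E\<lparr>carrier := M1\<rparr>) K L P1"
    and N: "perm_subgroup (E\<lparr>carrier := M1\<rparr>) K L P1 \<cong> N"
    using assms(12) by (auto simp: hopf_galois_structure_of_type_def)
  obtain M2 P2 where M2: "galois_closure E L L' M2" and P2: "gp_subgroup (E\<lparr>carrier := M2\<rparr>) L L' P2"
    and M: "perm_subgroup (E\<lparr>carrier := M2\<rparr>) L L' P2 \<cong> M"
    using assms(13) by (auto simp: hopf_galois_structure_of_type_def)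
  obtain M3 where M3: "galois_closure E K L' M3"
    using galois_closure_exists[OF assms(1) sL(2) KL'] by blast
  have LM: "L \<subseteq> M1" "L' \<subseteq> M2" "L' \<subseteq> M3"
    using M1 M2 M3 by (auto simp: galois_closure_def)
  interpret T1: galois_tower E K M1
    using M1 KL LM(1) by (intro galois_tower.intro galois_tower_axioms.intro K.galois_axioms)
      (auto simp: galois_closure_def intro: finite_galois_imp_galois)
  interpret T2: galois_tower E L M2
    using M2 LL' LM(2) by (intro galois_tower.intro galois_tower_axioms.intro L.galois_axioms)
      (auto simp: galois_closure_def intro: finite_galois_imp_galois)
  interpret T3: galois_tower E K M3
    using M3 KL' LM(3) by (intro galois_tower.intro galois_tower_axioms.intro K.galois_axioms)
      (auto simp: galois_closure_def intro: finite_galois_imp_galois)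

  \<comment> \<open>The projection \<open>\<pi>\<close> lets \<open>Gal(E/K)\<close> act on the cosets of \<open>S'\<close> in \<open>S\<close>.\<close>
  obtain \<pi> where pi_hom: "\<pi> \<in> hom (gal E K) (gal E K)"
    and pi_S: "\<And>g. g \<in> carrier (gal E K) \<Longrightarrow> \<pi> g \<in> S" and pi_id: "\<And>s. s \<in> S \<Longrightarrow> \<pi> s = s"
    using K.G.semidirect_projection[of H S] assms(2-6) by metis
  let ?G = "gal E K"
  interpret pi: group_hom ?G ?G \<pi>
    by (intro group_hom.intro group_hom_axioms.intro K.G.group_axioms pi_hom)
  have pi_L: "\<pi> g \<in> carrier (gal E L)" if "g \<in> carrier ?G" for g using pi_S[OF that] galL by simp
  have mult_L: "s \<otimes>\<^bsub>gal E L\<^esub> s' = s \<otimes>\<^bsub>?G\<^esub> s'" for s s' using gal_mult_eq[of E L K] by simp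

  \<comment> \<open>The orbit maps of the base points: \<open>?q1\<close>, \<open>?q2\<close>, \<open>?q3\<close> have the cosets of \<open>S\<close> in \<open>G\<close>, of \<open>S'\<close> in \<open>S\<close> and of \<open>S'\<close> in \<open>G\<close> as fibres.\<close>
  let ?q1 = "T1.coset_of L" and ?q2 = "T2.coset_of L'" and ?q3 = "T3.coset_of L'"
  let ?\<Omega>1 = "gal_cosets (E\<lparr>carrier := M1\<rparr>) K L" and ?\<Omega>2 = "gal_cosets (E\<lparr>carrier := M2\<rparr>) L L'"
    and ?\<Omega>3 = "gal_cosets (E\<lparr>carrier := M3\<rparr>) K L'"
  have q1: "?q1 g = ?q1 g' \<longleftrightarrow> inv\<^bsub>?G\<^esub> g \<otimes>\<^bsub>?G\<^esub> g' \<in> S" if "g \<in> carrier ?G" "g' \<in> carrier ?G" for g g'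
    using T1.coset_of_eq_iff[OF KL LM(1) that] K.gal_agree_iff[OF KL LE(1) that] galL by simp
  have q3: "?q3 g = ?q3 g' \<longleftrightarrow> inv\<^bsub>?G\<^esub> g \<otimes>\<^bsub>?G\<^esub> g' \<in> S'" if "g \<in> carrier ?G" "g' \<in> carrier ?G" for g g'
    using T3.coset_of_eq_iff[OF KL' LM(3) that] K.gal_agree_iff[OF KL' LE(2) that] galL by simp
  have q2: "?q2 s = ?q2 s' \<longleftrightarrow> inv\<^bsub>?G\<^esub> s \<otimes>\<^bsub>?G\<^esub> s' \<in> S'" if "s \<in> S" "s' \<in> S" for s s'
    using T2.coset_of_eq_iff[OF LL' LM(2), of s s'] K.gal_agree_iff[OF KL' LE(2), of s s'] galL that SS by auto
  have pi_div: "\<pi> (inv\<^bsub>?G\<^esub> g \<otimes>\<^bsub>?G\<^esub> g') = inv\<^bsub>?G\<^esub> (\<pi> g) \<otimes>\<^bsub>?G\<^esub> \<pi> g'"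
    if "g \<in> carrier ?G" "g' \<in> carrier ?G" for g g' using that by simp
  have q3_iff: "?q3 g = ?q3 g' \<longleftrightarrow> ?q1 g = ?q1 g' \<and> ?q2 (\<pi> g) = ?q2 (\<pi> g')"
    if g: "g \<in> carrier ?G" "g' \<in> carrier ?G" for g g'
    using q1[OF g] q3[OF g] q2[OF pi_S[OF g(1)] pi_S[OF g(2)]] pi_div[OF g]
      pi_id[of "inv\<^bsub>?G\<^esub> g \<otimes>\<^bsub>?G\<^esub> g'"] \<open>S' \<subseteq> S\<close> by auto

  \<comment> \<open>The bijection sends the coset of \<open>g\<close> to the pair of the cosets of \<open>g\<close> and of \<open>\<pi> g\<close>.\<close>
  define rep where "rep z = (SOME g. g \<in> carrier ?G \<and> ?q3 g = z)" for z
  have rep: "rep z \<in> carrier ?G" "?q3 (rep z) = z" if "z \<in> ?\<Omega>3" for z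
  proof -
    have "\<exists>g. g \<in> carrier ?G \<and> ?q3 g = z"
      using that unfolding T3.coset_of_surj[of L', symmetric] by blast
    from someI_ex[OF this] show "rep z \<in> carrier ?G" "?q3 (rep z) = z" by (simp_all add: rep_def)
  qed
  define f1 where "f1 z = ?q1 (rep z)" for z
  define f2 where "f2 z = ?q2 (\<pi> (rep z))" for z
  have q3_mem: "?q3 g \<in> ?\<Omega>3" if "g \<in> carrier ?G" for g using T3.coset_of_surj[of L'] that by blast
  have f: "f1 (?q3 g) = ?q1 g" "f2 (?q3 g) = ?q2 (\<pi> g)" if "g \<in> carrier ?G" for g
    using q3_iff[OF rep(1)[OF q3_mem[OF that]] that] rep(2)[OF q3_mem[OF that]]
    by (simp_all add: f1_def f2_def)
  interpret prod: product_action ?\<Omega>3 ?\<Omega>1 ?\<Omega>2 f1 f2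
  proof
    show "bij_betw (\<lambda>z. (f1 z, f2 z)) ?\<Omega>3 (?\<Omega>1 \<times> ?\<Omega>2)"
    proof (rule bij_betw_imageI)
      show "inj_on (\<lambda>z. (f1 z, f2 z)) ?\<Omega>3"
      proof (rule inj_onI)
        fix z w assume zw: "z \<in> ?\<Omega>3" "w \<in> ?\<Omega>3" "(f1 z, f2 z) = (f1 w, f2 w)"
        then have "?q3 (rep z) = ?q3 (rep w)"
          using q3_iff[OF rep(1)[OF zw(1)] rep(1)[OF zw(2)]] by (simp add: f1_def f2_def)
        then show "z = w" using rep(2) zw by simp
      qed
      show "(\<lambda>z. (f1 z, f2 z)) ` ?\<Omega>3 = ?\<Omega>1 \<times> ?\<Omega>2"
      proof
        have "?q1 g \<in> ?\<Omega>1" "?q2 (\<pi> g) \<in> ?\<Omega>2" if "g \<in> carrier ?G" for g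
          using T1.coset_of_surj[of L] T2.coset_of_surj[of L'] pi_L[OF that] that by blast+
        then show "(\<lambda>z. (f1 z, f2 z)) ` ?\<Omega>3 \<subseteq> ?\<Omega>1 \<times> ?\<Omega>2"
          using rep(1) by (auto simp: f1_def f2_def)
        show "?\<Omega>1 \<times> ?\<Omega>2 \<subseteq> (\<lambda>z. (f1 z, f2 z)) ` ?\<Omega>3"
        proof
          fix v assume "v \<in> ?\<Omega>1 \<times> ?\<Omega>2"
          then obtain g0 s0 where v: "v = (?q1 g0, ?q2 s0)" and g0: "g0 \<in> carrier ?G" and s0: "s0 \<in> S"
            unfolding T1.coset_of_surj[of L, symmetric] T2.coset_of_surj[of L', symmetric] galL by blast
          \<comment> \<open>The preimage of \<open>(g0 S, s0 S')\<close>: a translate of \<open>g0\<close> by an element of \<open>S\<close> that makes the projection \<open>s0\<close>.\<close>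
          let ?s = "inv\<^bsub>?G\<^esub> (\<pi> g0) \<otimes>\<^bsub>?G\<^esub> s0"
          let ?g = "g0 \<otimes>\<^bsub>?G\<^esub> ?s"
          have s: "?s \<in> S" using pi_S[OF g0] s0 S by (simp add: subgroup.m_closed subgroup.m_inv_closed)
          have sG: "?s \<in> carrier ?G" "s0 \<in> carrier ?G" "\<pi> g0 \<in> carrier ?G" using s s0 SS pi_S[OF g0] by auto
          have g: "?g \<in> carrier ?G" using g0 sG by simp
          have "inv\<^bsub>?G\<^esub> g0 \<otimes>\<^bsub>?G\<^esub> ?g = ?s" using g0 sG by (simp flip: K.G.m_assoc)
          then have "?q1 g0 = ?q1 ?g" using q1[OF g0 g] s by simp
          moreover have "\<pi> ?g = s0"
          proof -
            have "\<pi> ?g = \<pi> g0 \<otimes>\<^bsub>?G\<^esub> ?s" using pi.hom_mult[OF g0 sG(1)] pi_id[OF s] by simp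
            then show ?thesis using sG by (simp flip: K.G.m_assoc)
          qed
          ultimately have "v = (f1 (?q3 ?g), f2 (?q3 ?g))" using f[OF g] v by simp
          then show "v \<in> (\<lambda>z. (f1 z, f2 z)) ` ?\<Omega>3" using q3_mem[OF g] by blast
        qed
      qed
    qed
    show "?\<Omega>1 \<noteq> {}" "?\<Omega>2 \<noteq> {}"
      using T1.coset_of_surj[of L] T2.coset_of_surj[of L'] K.G.one_closed L.G.one_closed by blast+
  qed

  have reg: "regular_subgroup P1 ?\<Omega>1" "regular_subgroup P2 ?\<Omega>2"
    using P1 P2 by (auto simp: gp_subgroup_def)
  define P where "P = (\<lambda>(n, m). prod.prod_perm n m) ` (P1 \<times> P2)"
  have gp: "gp_subgroup (E\<lparr>carrier := M3\<rparr>) K L' P"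
    unfolding gp_subgroup_def
  proof (intro conjI ballI)
    show "regular_subgroup P ?\<Omega>3" unfolding P_def by (rule prod.prod_perm_regular[OF reg])
    fix \<gamma> assume "\<gamma> \<in> carrier (gal (E\<lparr>carrier := M3\<rparr>) K)"
    then obtain g where g: "g \<in> carrier ?G" and \<gamma>: "\<gamma> = restrict g M3"
      using T3.restrict_gal_surj by blast
    let ?l1 = "left_translation (E\<lparr>carrier := M1\<rparr>) K L (restrict g M1)"
    let ?l2 = "left_translation (E\<lparr>carrier := M2\<rparr>) L L' (restrict (\<pi> g) M2)"
    let ?l3 = "left_translation (E\<lparr>carrier := M3\<rparr>) K L' \<gamma>"
    have l1: "?l1 \<in> Bij ?\<Omega>1"
      using T1.M.left_translation_Bij[OF KL _ T1.restrict_gal[OF g]] LM(1) by simp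
    have l2: "?l2 \<in> Bij ?\<Omega>2"
      using T2.M.left_translation_Bij[OF LL' _ T2.restrict_gal[OF pi_L[OF g]]] LM(2) by simp
    have l3: "?l3 \<in> Bij ?\<Omega>3"
      unfolding \<gamma> using T3.M.left_translation_Bij[OF KL' _ T3.restrict_gal[OF g]] LM(3) by simp
    \<comment> \<open>Left translation by \<open>g\<close> is the product of the translations by \<open>g\<close> and by \<open>\<pi> g\<close>.\<close>
    have "?l3 = prod.prod_perm ?l1 ?l2"
    proof (rule prod.prod_perm_eqI[OF l1 l2])
      show "?l3 \<in> extensional ?\<Omega>3" using l3 by (rule Bij_imp_extensional)
      fix z assume z: "z \<in> ?\<Omega>3"
      show "?l3 z \<in> ?\<Omega>3" using l3 z by (rule Bij_apply_closed)
      note r = rep[OF z]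
      have l3z: "?l3 z = ?q3 (g \<otimes>\<^bsub>?G\<^esub> rep z)"
        using T3.left_translation_coset_of[OF KL' LM(3) g r(1)] r(2) \<gamma> by simp
      have gr: "g \<otimes>\<^bsub>?G\<^esub> rep z \<in> carrier ?G" using g r by simp
      show "f1 (?l3 z) = ?l1 (f1 z)"
        unfolding l3z f(1)[OF gr] f1_def[of z]
        using T1.left_translation_coset_of[OF KL LM(1) g r(1)] by simp
      show "f2 (?l3 z) = ?l2 (f2 z)"
        unfolding l3z f(2)[OF gr] f2_def[of z]
        using T2.left_translation_coset_of[OF LL' LM(2) pi_L[OF g] pi_L[OF r(1)]] g r by (simp add: mult_L)
    qed
    moreover have "conj_translation (E\<lparr>carrier := M1\<rparr>) K L (restrict g M1) ` P1 = P1"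
      using P1 T1.restrict_gal[OF g] by (simp add: gp_subgroup_def)
    moreover have "conj_translation (E\<lparr>carrier := M2\<rparr>) L L' (restrict (\<pi> g) M2) ` P2 = P2"
      using P2 T2.restrict_gal[OF pi_L[OF g]] by (simp add: gp_subgroup_def)
    ultimately show "conj_translation (E\<lparr>carrier := M3\<rparr>) K L' \<gamma> ` P = P"
      using prod.prod_perm_conj[OF reg l1 l2]
      by (simp add: conj_translation_def[abs_def] Let_def P_def)
  qed

  interpret gp: gp "E\<lparr>carrier := M3\<rparr>" K L' P
  proof (intro gp.intro gp_axioms.intro T3.M.galois_axioms KL' gp)
    show "subfield L' (E\<lparr>carrier := M3\<rparr>)"
      using LM(3) K.subfield_iff(2)[OF sL(2)] by (intro T3.M.subfield_iff(1)) auto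
  qed
  let ?C = "gp_hopf (E\<lparr>carrier := M3\<rparr>) K L' P" and ?act = "gp_action (E\<lparr>carrier := M3\<rparr>) K L' P"
  have "perm_subgroup (E\<lparr>carrier := M3\<rparr>) K L' P \<cong> N \<times>\<times> M"
  proof -
    let ?D = "perm_subgroup (E\<lparr>carrier := M1\<rparr>) K L P1 \<times>\<times> perm_subgroup (E\<lparr>carrier := M2\<rparr>) L L' P2"
    have grp: "group (perm_subgroup (E\<lparr>carrier := M1\<rparr>) K L P1)" "group (perm_subgroup (E\<lparr>carrier := M2\<rparr>) L L' P2)"
      using reg by (auto simp: regular_subgroup_def intro: subgroup.subgroup_is_group group_BijGroup)
    have "?D \<cong> perm_subgroup (E\<lparr>carrier := M3\<rparr>) K L' P"
      using prod.prod_perm_iso[OF reg] by (auto simp: is_iso_def P_def)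
    moreover have "?D \<cong> N \<times>\<times> M"
      by (rule group.DirProd_iso_trans[OF grp(1) N M])
    moreover have "group ?D" using grp by (rule DirProd_group)
    ultimately show ?thesis using group.iso_sym iso_trans by blast
  qed
  moreover have "hopf_galois_structure E K L' ?C ?act"
    by (rule hopf_galois_structure_extend_ambient[OF gp.gp_hopf_galois K.field_axioms K.subfield sL(2)])
  moreover have "corresponds_to (E\<lparr>carrier := M3\<rparr>) K L' ?C ?act P"
    unfolding corresponds_to_def by (intro exI[of _ id]) (simp add: hopf_iso_id)
  ultimately have "hopf_galois_structure_of_type E K L' ?C ?act (N \<times>\<times> M)"
    unfolding hopf_galois_structure_of_type_def using M3 gp by blast
  then show ?thesis by blast
qed

end
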